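(* Let $n\ge 2$ and $d>n$ be integers, let $N:=\frac{(n+1+d)!}{(n+1)!\,d!}-1$, let $\mathcal X\subset\mathbb P^{n+1}\times\mathbb P^{N}$ be the universal hypersurface of degree $d$, let $J^n_{\rm vert}(\mathcal X)$ be its space of vertical $n$-jets, and let $J^n_{\rm vert}(\mathcal X_0)$ be the space of vertical affine $n$-jets, with coordinates $(z_i,a_\alpha,z'_{j_1},\dots,z^{(n)}_{j_n})$. Let $\Sigma$ be the closure in $J^n_{\rm vert}(\mathcal X)$ of the Zariski closed subset $\Sigma_0$ of $J^n_{\rm vert}(\mathcal X_0)$ defined by requiring that all $n\times n$ Wronskians vanish, i.e. $\Sigma_0$ is the set of points $(z_i,a_\alpha,z'_{j_1},\dots,z^{(n)}_{j_n})$ of $J^n_{\rm vert}(\mathcal X_0)$ at which all the $n\times n$ minors of the $(n+1)\times n$ matrix $\big(z_i^{(\lambda)}\big)_{1\le i\le n+1}^{1\le\lambda\le n}$ are zero. Then the twisted tangent bundle $$T_{J^n_{\rm vert}(\mathcal X)}\otimes\mathcal O_{\mathbb P^{n+1}}\Big(\tfrac{n^2+5n}{2}\Big)\otimes\mathcal O_{\mathbb P^{N}}(1)$$ is generated by its global sections at every point of $J^n_{\rm vert}(\mathcal X)\setminus\Sigma$.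
   Context: Everything is over $\mathbb C$. Universal hypersurface: with homogeneous coordinates $[Z]=[Z_0:\cdots:Z_{n+1}]\in\mathbb P^{n+1}$ and $[A]=[(A_\alpha)_{\alpha\in\mathbb N^{n+2},\,|\alpha|=d}]\in\mathbb P^{N}$, where $|\alpha|=\alpha_0+\cdots+\alpha_{n+1}$ and $Z^\alpha=Z_0^{\alpha_0}\cdots Z_{n+1}^{\alpha_{n+1}}$, $$\mathcal X=\Big\{([Z],[A]):\ \sum_{|\alpha|=d}A_\alpha Z^\alpha=0\Big\}.$$ Vertical jets: $J^n_{\rm vert}(\mathcal X)$ is the space of $n$-jets of germs of holomorphic maps $(\mathbb C,0)\to\mathcal X$ that are tangent to the fibres of the projection $\mathcal X\to\mathbb P^N$, i.e. the space of $n$-jets of holomorphic discs in $\mathbb P^{n+1}$ satisfying, up to order $n$, the equation of the hypersurface with coefficients $[A]$ held constant. Affine chart: on $\{Z_0\ne0\}\times\{A_{0d0\cdots0}\neq0\}$ put $z_i=Z_i/Z_0$ $(1\le i\le n+1)$ and $a_{\alpha_1\cdots\alpha_{n+1}}=A_{\alpha_0\alpha_1\cdots\alpha_{n+1}}/A_{0d0\cdots0}$ with $\alpha_0=d-\alpha_1-\cdots-\alpha_{n+1}$. In this chart $\mathcal X$ becomes $$\mathcal X_0:\quad 0=z_1^d+\sum_{\alpha\in\mathbb N^{n+1},\,|\alpha|\le d,\,\alpha_1<d}a_\alpha z^\alpha ,$$ also written $0=\sum_{|\alpha|\le d}a_\alpha z^\alpha$ with the convention $a_{d0\cdots0}=1$.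 With independent jet coordinates $z^{(\lambda)}_k$ ($1\le k\le n+1$, $1\le\lambda\le n$, and $z^{(0)}_k=z_k$), and the total differentiation operator $$\mathsf D(\bullet)=\sum_{\lambda\in\mathbb N}\sum_{k=1}^{n+1}\frac{\partial(\bullet)}{\partial z_k^{(\lambda)}}\,z_k^{(\lambda+1)},$$ $J^n_{\rm vert}(\mathcal X_0)$ is the subset of the affine space with coordinates $(z_i,a_\alpha,z'_{j_1},\dots,z^{(n)}_{j_n})$ defined by the $n+1$ equations $0=\mathsf D^\kappa\big(\sum_\alpha a_\alpha z^\alpha\big)$, $\kappa=0,1,\dots,n$. The line bundles $\mathcal O_{\mathbb P^{n+1}}(\cdot)$ and $\mathcal O_{\mathbb P^N}(\cdot)$ are pulled back to $J^n_{\rm vert}(\mathcal X)$ via the natural projections $J^n_{\rm vert}(\mathcal X)\to\mathbb P^{n+1}$ and $J^n_{\rm vert}(\mathcal X)\to\mathbb P^N$. At possible singular points of $J^n_{\rm vert}(\mathcal X)$ (which lie in $\Sigma$), $T_{J^n_{\rm vert}(\mathcal X)}$ is understood as the tangent sheaf. "Generated by its global sections at a point $p$" means that the values at $p$ of global sections over $J^n_{\rm vert}(\mathcal X)$ span the fibre at $p$. *)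

theory Defs
  imports
    "HOL-Analysis.Analysis"
    "HOL-Library.Function_Algebras"
    "Jordan_Normal_Form.Determinant"
    "Jordan_Normal_Form.DL_Submatrix"
begin

section \<open>The universal hypersurface\<close>

text \<open>
  Exponents \<open>\<alpha> \<in> \<nat>\<^bsup>n+2\<^esup>\<close> with \<open>|\<alpha>| = d\<close>. They index the homogeneous coordinates of \<open>P\<^sup>N\<close>, so that
  \<open>N + 1\<close> is their number, see \<open>card_multi_indices\<close> below.
\<close>

definition multi_indices :: "nat \<Rightarrow> nat \<Rightarrow> (nat \<Rightarrow> nat) set" where
  "multi_indices n d = {\<alpha>. (\<forall>k>n+1. \<alpha> k = 0) \<and> (\<Sum>k\<le>n+1. \<alpha> k) = d}"

definition hypersurface_form ::
    "nat \<Rightarrow> nat \<Rightarrow> ((nat \<Rightarrow> nat) \<Rightarrow> complex) \<Rightarrow> (nat \<Rightarrow> complex) \<Rightarrow> complex" where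
  "hypersurface_form n d A Z = (\<Sum>\<alpha>\<in>multi_indices n d. A \<alpha> * (\<Prod>k\<le>n+1. Z k ^ \<alpha> k))"


section \<open>Vertical jets as jets of holomorphic discs\<close>

text \<open>
  A pair \<open>(Z, A)\<close> stands for the germ \<open>t \<mapsto> [Z\<^sub>0(t) : \<dots> : Z\<^bsub>n+1\<^esub>(t)]\<close> at \<open>0\<close> of a holomorphic disc in
  \<open>P\<^bsup>n+1\<^esup>\<close> together with a constant point \<open>[A]\<close> of \<open>P\<^sup>N\<close>.
\<close>

type_synonym disc = "(nat \<Rightarrow> complex \<Rightarrow> complex) \<times> ((nat \<Rightarrow> nat) \<Rightarrow> complex)"

definition vertical_discs :: "nat \<Rightarrow> nat \<Rightarrow> disc set" where
  "vertical_discs n d =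
    {(Z, A). (\<forall>k\<le>n+1. Z k analytic_on {0}) \<and> (\<exists>k\<le>n+1. Z k 0 \<noteq> 0)
           \<and> (\<exists>\<alpha>\<in>multi_indices n d. A \<alpha> \<noteq> 0)
           \<and> (\<forall>\<kappa>\<le>n. (deriv ^^ \<kappa>) (\<lambda>t. hypersurface_form n d A (\<lambda>k. Z k t)) 0 = 0)}"

text \<open>
  \<open>Zc k l\<close> names the jet coordinate \<open>z\<^sub>k\<^bsup>(l)\<^esup>\<close> and \<open>Ac \<alpha>\<close> the coordinate \<open>a\<^sub>\<alpha>\<close>. The chart \<open>(i, \<beta>)\<close> is
  \<open>{Z\<^sub>i \<noteq> 0} \<times> {A\<^sub>\<beta> \<noteq> 0}\<close>; its affine space is embedded in \<open>coord \<Rightarrow> complex\<close> as the slice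
  \<open>z\<^sub>i = 1\<close>, \<open>z\<^sub>i\<^bsup>(l)\<^esup> = 0\<close> for \<open>l \<ge> 1\<close>, \<open>a\<^sub>\<beta> = 1\<close>.
\<close>

datatype coord = Zc nat nat | Ac "nat \<Rightarrow> nat"

definition jet_coords :: "nat \<Rightarrow> nat \<Rightarrow> coord set" where
  "jet_coords n d = {Zc k l | k l. k \<le> n+1 \<and> l \<le> n} \<union> Ac ` multi_indices n d"

definition free_coords :: "nat \<Rightarrow> nat \<Rightarrow> nat \<Rightarrow> (nat \<Rightarrow> nat) \<Rightarrow> coord set" where
  "free_coords n d i \<beta> = jet_coords n d - range (Zc i) - {Ac \<beta>}"

fun in_chart :: "nat \<Rightarrow> (nat \<Rightarrow> nat) \<Rightarrow> disc \<Rightarrow> bool" where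
  "in_chart i \<beta> (Z, A) \<longleftrightarrow> Z i 0 \<noteq> 0 \<and> A \<beta> \<noteq> 0"

fun disc_coords :: "nat \<Rightarrow> nat \<Rightarrow> nat \<Rightarrow> (nat \<Rightarrow> nat) \<Rightarrow> disc \<Rightarrow> coord \<Rightarrow> complex" where
  "disc_coords n d i \<beta> (Z, A) (Zc k l) =
     (if k \<le> n+1 \<and> l \<le> n then (deriv ^^ l) (\<lambda>t. Z k t / Z i t) 0 else 0)"
| "disc_coords n d i \<beta> (Z, A) (Ac \<alpha>) =
     (if \<alpha> \<in> multi_indices n d then A \<alpha> / A \<beta> else 0)"

definition same_jet :: "nat \<Rightarrow> nat \<Rightarrow> (disc \<times> disc) set" where
  "same_jet n d = {(u, v). u \<in> vertical_discs n d \<and> v \<in> vertical_discs n d \<and>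
     (\<forall>i\<le>n+1. \<forall>\<beta>\<in>multi_indices n d.
        (in_chart i \<beta> u \<longleftrightarrow> in_chart i \<beta> v) \<and>
        (in_chart i \<beta> u \<longrightarrow> disc_coords n d i \<beta> u = disc_coords n d i \<beta> v))}"

definition vertical_jets :: "nat \<Rightarrow> nat \<Rightarrow> disc set set" where
  "vertical_jets n d = vertical_discs n d // same_jet n d"

definition jet_in_chart :: "nat \<Rightarrow> (nat \<Rightarrow> nat) \<Rightarrow> disc set \<Rightarrow> bool" where
  "jet_in_chart i \<beta> p \<longleftrightarrow> (\<forall>u\<in>p. in_chart i \<beta> u)"

definition chart_coords ::
    "nat \<Rightarrow> nat \<Rightarrow> nat \<Rightarrow> (nat \<Rightarrow> nat) \<Rightarrow> disc set \<Rightarrow> coord \<Rightarrow> complex" where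
  "chart_coords n d i \<beta> p = the_elem (disc_coords n d i \<beta> ` p)"


section \<open>The affine charts and their tangent spaces\<close>

definition partial_deriv ::
    "coord \<Rightarrow> ((coord \<Rightarrow> complex) \<Rightarrow> complex) \<Rightarrow> (coord \<Rightarrow> complex) \<Rightarrow> complex" where
  "partial_deriv c F x = deriv (\<lambda>s. F (x(c := s))) (x c)"

text \<open>
  The operator \<open>D\<close>, truncated to the jet coordinates of order at most \<open>n\<close>: the powers \<open>D\<^sup>\<kappa>\<close> with
  \<open>\<kappa> \<le> n\<close> of a function of the \<open>z\<^sub>k\<close> and \<open>a\<^sub>\<alpha>\<close> do not involve the omitted terms. The index \<open>k = i\<close>
  contributes nothing in the chart \<open>(i, \<beta>)\<close>, where \<open>z\<^sub>i\<^bsup>(l)\<^esup> = 0\<close> for \<open>l \<ge> 1\<close>.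
\<close>

definition total_deriv ::
    "nat \<Rightarrow> ((coord \<Rightarrow> complex) \<Rightarrow> complex) \<Rightarrow> (coord \<Rightarrow> complex) \<Rightarrow> complex" where
  "total_deriv n F x = (\<Sum>l<n. \<Sum>k\<le>n+1. partial_deriv (Zc k l) F x * x (Zc k (Suc l)))"

definition jet_equation :: "nat \<Rightarrow> nat \<Rightarrow> nat \<Rightarrow> (coord \<Rightarrow> complex) \<Rightarrow> complex" where
  "jet_equation n d \<kappa> = (total_deriv n ^^ \<kappa>)
     (\<lambda>x. hypersurface_form n d (\<lambda>\<alpha>. x (Ac \<alpha>)) (\<lambda>k. x (Zc k 0)))"

definition affine_jets :: "nat \<Rightarrow> nat \<Rightarrow> nat \<Rightarrow> (nat \<Rightarrow> nat) \<Rightarrow> (coord \<Rightarrow> complex) set" where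
  "affine_jets n d i \<beta> =
    {x. (\<forall>c. c \<notin> jet_coords n d \<longrightarrow> x c = 0)
      \<and> x (Zc i 0) = 1 \<and> (\<forall>l\<in>{1..n}. x (Zc i l) = 0) \<and> x (Ac \<beta>) = 1
      \<and> (\<forall>\<kappa>\<le>n. jet_equation n d \<kappa> x = 0)}"

definition tangent_space ::
    "nat \<Rightarrow> nat \<Rightarrow> nat \<Rightarrow> (nat \<Rightarrow> nat) \<Rightarrow> (coord \<Rightarrow> complex) \<Rightarrow> (coord \<Rightarrow> complex) set" where
  "tangent_space n d i \<beta> x =
    {v. (\<forall>c. c \<notin> free_coords n d i \<beta> \<longrightarrow> v c = 0)
      \<and> (\<forall>\<kappa>\<le>n. (\<Sum>c\<in>free_coords n d i \<beta>. partial_deriv c (jet_equation n d \<kappa>) x * v c) = 0)}"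

text \<open>
  The change of charts, defined on a point \<open>x\<close> of an affine chart by passing to the disc
  \<open>t \<mapsto> \<Sum>\<^sub>l z\<^sub>k\<^bsup>(l)\<^esup> t\<^sup>l / l!\<close>, and its differential at \<open>x\<close> in the direction \<open>v\<close>.
\<close>

definition disc_of :: "nat \<Rightarrow> (coord \<Rightarrow> complex) \<Rightarrow> disc" where
  "disc_of n x = ((\<lambda>k t. \<Sum>l\<le>n. x (Zc k l) * t ^ l / fact l), (\<lambda>\<alpha>. x (Ac \<alpha>)))"

definition chart_change ::
    "nat \<Rightarrow> nat \<Rightarrow> nat \<Rightarrow> (nat \<Rightarrow> nat) \<Rightarrow> (coord \<Rightarrow> complex) \<Rightarrow> coord \<Rightarrow> complex" where
  "chart_change n d j \<gamma> x = disc_coords n d j \<gamma> (disc_of n x)"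

definition chart_change_differential ::
    "nat \<Rightarrow> nat \<Rightarrow> nat \<Rightarrow> (nat \<Rightarrow> nat) \<Rightarrow> (coord \<Rightarrow> complex) \<Rightarrow> (coord \<Rightarrow> complex) \<Rightarrow> coord \<Rightarrow> complex"
  where
  "chart_change_differential n d j \<gamma> x v =
    (\<lambda>c. deriv (\<lambda>s. chart_change n d j \<gamma> (\<lambda>b. x b + s * v b) c) 0)"


section \<open>Global sections of the twisted tangent sheaf\<close>

inductive_set polynomial_functions :: "coord set \<Rightarrow> ((coord \<Rightarrow> complex) \<Rightarrow> complex) set"
  for C :: "coord set" where
  const: "(\<lambda>_. a) \<in> polynomial_functions C"
| coord: "c \<in> C \<Longrightarrow> (\<lambda>x. x c) \<in> polynomial_functions C"
| add: "f \<in> polynomial_functions C \<Longrightarrow> g \<in> polynomial_functions C \<Longrightarrow>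
    (\<lambda>x. f x + g x) \<in> polynomial_functions C"
| mult: "f \<in> polynomial_functions C \<Longrightarrow> g \<in> polynomial_functions C \<Longrightarrow>
    (\<lambda>x. f x * g x) \<in> polynomial_functions C"

text \<open>
  A global section of \<open>T \<otimes> O(m) \<otimes> O(e)\<close> is given by its expressions \<open>V\<^bsub>(i,\<beta>)\<^esub> \<otimes> Z\<^sub>i\<^sup>m A\<^sub>\<beta>\<^sup>e\<close> in the
  charts. The charts are reduced affine complete intersections, so a section of the tangent sheaf over
  a chart, i.e. a derivation of its coordinate ring, is a polynomial vector field \<open>V\<^bsub>(i,\<beta>)\<^esub>\<close> whose
  derivatives of the defining equations vanish on the chart.
  On the overlap of two charts \<open>(i,\<beta>)\<close>, \<open>(j,\<gamma>)\<close> one has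
  \<open>V\<^bsub>(i,\<beta>)\<^esub> \<otimes> Z\<^sub>i\<^sup>m A\<^sub>\<beta>\<^sup>e = V\<^bsub>(j,\<gamma>)\<^esub> \<otimes> Z\<^sub>j\<^sup>m A\<^sub>\<gamma>\<^sup>e\<close>, where \<open>Z\<^sub>j / Z\<^sub>i = z\<^sub>j\<close> and \<open>A\<^sub>\<gamma> / A\<^sub>\<beta> = a\<^sub>\<gamma>\<close> in
  the coordinates of the chart \<open>(i,\<beta>)\<close>.
\<close>

type_synonym vector_fields =
  "nat \<Rightarrow> (nat \<Rightarrow> nat) \<Rightarrow> (coord \<Rightarrow> complex) \<Rightarrow> (coord \<Rightarrow> complex)"

definition twisted_sections :: "nat \<Rightarrow> nat \<Rightarrow> nat \<Rightarrow> nat \<Rightarrow> vector_fields set" where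
  "twisted_sections n d m e =
    {V. (\<forall>i\<le>n+1. \<forall>\<beta>\<in>multi_indices n d.
          (\<forall>c. (\<lambda>x. V i \<beta> x c) \<in> polynomial_functions (jet_coords n d)) \<and>
          (\<forall>x\<in>affine_jets n d i \<beta>. V i \<beta> x \<in> tangent_space n d i \<beta> x)) \<and>
        (\<forall>i\<le>n+1. \<forall>\<beta>\<in>multi_indices n d. \<forall>j\<le>n+1. \<forall>\<gamma>\<in>multi_indices n d.
          \<forall>x\<in>affine_jets n d i \<beta>. x (Zc j 0) \<noteq> 0 \<and> x (Ac \<gamma>) \<noteq> 0 \<longrightarrow>
            (\<forall>c. x (Zc j 0) ^ m * x (Ac \<gamma>) ^ e * V j \<gamma> (chart_change n d j \<gamma> x) c =
                 chart_change_differential n d j \<gamma> x (V i \<beta> x) c))}"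

text \<open>
  The notion below is meant for smooth points \<open>p\<close>, where the fibre of the tangent sheaf is the
  tangent space.
\<close>

definition generated_by_sections_at :: "nat \<Rightarrow> nat \<Rightarrow> nat \<Rightarrow> nat \<Rightarrow> disc set \<Rightarrow> bool" where
  "generated_by_sections_at n d m e p \<longleftrightarrow>
    (\<forall>i\<le>n+1. \<forall>\<beta>\<in>multi_indices n d. jet_in_chart i \<beta> p \<longrightarrow>
      module.span (\<lambda>(a::complex) (v::coord \<Rightarrow> complex). \<lambda>c. a * v c)
        ((\<lambda>V. V i \<beta> (chart_coords n d i \<beta> p)) ` twisted_sections n d m e)
      = tangent_space n d i \<beta> (chart_coords n d i \<beta> p))"


section \<open>The locus of vanishing Wronskians and its closure\<close>

definition zariski_closed :: "nat \<Rightarrow> nat \<Rightarrow> disc set set \<Rightarrow> bool" where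
  "zariski_closed n d S \<longleftrightarrow> S \<subseteq> vertical_jets n d \<and>
    (\<forall>i\<le>n+1. \<forall>\<beta>\<in>multi_indices n d. \<exists>P \<subseteq> polynomial_functions (jet_coords n d).
       \<forall>p\<in>vertical_jets n d. jet_in_chart i \<beta> p \<longrightarrow>
         (p \<in> S \<longleftrightarrow> (\<forall>f\<in>P. f (chart_coords n d i \<beta> p) = 0)))"

text \<open>The exponent \<open>(0, d, 0, \<dots>, 0)\<close>, so that \<open>(0, base_index d)\<close> is the chart containing \<open>X\<^sub>0\<close>.\<close>

definition base_index :: "nat \<Rightarrow> nat \<Rightarrow> nat" where
  "base_index d = (\<lambda>_. 0)(1 := d)"

definition wronskian_matrix :: "nat \<Rightarrow> (coord \<Rightarrow> complex) \<Rightarrow> complex mat" where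
  "wronskian_matrix n x = Matrix.mat (n+1) n (\<lambda>(r, s). x (Zc (r+1) (s+1)))"

definition affine_Sigma :: "nat \<Rightarrow> nat \<Rightarrow> (coord \<Rightarrow> complex) set" where
  "affine_Sigma n d = {x \<in> affine_jets n d 0 (base_index d).
     \<forall>I \<subseteq> {..<n+1}. card I = n \<longrightarrow> Determinant.det (submatrix (wronskian_matrix n x) I {..<n}) = 0}"

definition Sigma_locus :: "nat \<Rightarrow> nat \<Rightarrow> disc set set" where
  "Sigma_locus n d = zariski_closed n d hull
     {p \<in> vertical_jets n d. jet_in_chart 0 (base_index d) p \<and>
        chart_coords n d 0 (base_index d) p \<in> affine_Sigma n d}"


section \<open>Consistency of the encoding\<close>

lemma equiv_same_jet: "equiv (vertical_discs n d) (same_jet n d)"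
proof (rule equivI)
  show "refl_on (vertical_discs n d) (same_jet n d)"
    by (auto simp: refl_on_def same_jet_def)
  show "sym (same_jet n d)"
    by (rule symI) (auto simp: same_jet_def)
  show "trans (same_jet n d)"
    by (rule transI) (simp add: same_jet_def)
  show "same_jet n d \<subseteq> vertical_discs n d \<times> vertical_discs n d"
    by (auto simp: same_jet_def)
qed

lemma jet_in_chart_class:
  assumes "u \<in> vertical_discs n d" "i \<le> n+1" "\<beta> \<in> multi_indices n d"
  shows "jet_in_chart i \<beta> (same_jet n d `` {u}) \<longleftrightarrow> in_chart i \<beta> u"
proof -
  have "(u, u) \<in> same_jet n d"
    using assms by (auto simp: same_jet_def)
  then show ?thesis
    using assms unfolding jet_in_chart_def by (auto simp: same_jet_def simp del: in_chart.simps split_paired_All)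
qed

lemma chart_coords_class:
  assumes "u \<in> vertical_discs n d" "i \<le> n+1" "\<beta> \<in> multi_indices n d" "in_chart i \<beta> u"
  shows "chart_coords n d i \<beta> (same_jet n d `` {u}) = disc_coords n d i \<beta> u"
proof -
  have u: "u \<in> same_jet n d `` {u}"
    using assms(1) by (simp add: same_jet_def)
  have eq: "disc_coords n d i \<beta> v = disc_coords n d i \<beta> u" if "v \<in> same_jet n d `` {u}" for v
  proof -
    have "\<forall>i\<le>n+1. \<forall>\<beta>\<in>multi_indices n d. (in_chart i \<beta> u \<longleftrightarrow> in_chart i \<beta> v) \<and>
        (in_chart i \<beta> u \<longrightarrow> disc_coords n d i \<beta> u = disc_coords n d i \<beta> v)"
      using that unfolding same_jet_def Image_singleton_iff mem_Collect_eq case_prod_conv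
      by (elim conjE)
    from this[THEN spec, THEN mp, OF assms(2), THEN bspec, OF assms(3), THEN conjunct2,
        THEN mp, OF assms(4)]
    show ?thesis
      by (rule sym)
  qed
  have img: "disc_coords n d i \<beta> ` (same_jet n d `` {u}) = {disc_coords n d i \<beta> u}"
  proof (rule subset_antisym)
    show "disc_coords n d i \<beta> ` (same_jet n d `` {u}) \<subseteq> {disc_coords n d i \<beta> u}"
      by (rule image_subsetI) (unfold singleton_iff, rule eq)
    show "{disc_coords n d i \<beta> u} \<subseteq> disc_coords n d i \<beta> ` (same_jet n d `` {u})"
      using imageI[OF u] by (simp only: insert_subset empty_subsetI simp_thms)
  qed
  show ?thesis
    unfolding chart_coords_def img by (rule the_elem_eq)
qed

lemma card_multi_indices:
  "card (multi_indices n d) = fact (n+1+d) div (fact (n+1) * fact d)"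
proof -
  let ?L = "{l::nat list. size l = n+2 \<and> sum_list l = d}"
  have sum_eq: "sum_list (map \<alpha> [0..<n+2]) = (\<Sum>k\<le>n+1. \<alpha> k)" for \<alpha> :: "nat \<Rightarrow> nat"
    by (simp only: interv_sum_list_conv_sum_set_nat, rule sum.cong) auto
  have bij: "bij_betw (\<lambda>\<alpha>. map \<alpha> [0..<n+2]) (multi_indices n d) ?L"
  proof (rule bij_betw_byWitness[where f' = "\<lambda>l k. if k < n+2 then l ! k else 0"])
    have "(\<lambda>k. if k < n+2 then map \<alpha> [0..<n+2] ! k else 0) = \<alpha>" if a: "\<alpha> \<in> multi_indices n d" for \<alpha>
    proof
      fix k
      have "\<alpha> k = 0" if "\<not> k < n+2"
        using a that unfolding multi_indices_def mem_Collect_eq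
        by (elim conjE allE[of _ k] impE) arith
      then show "(if k < n+2 then map \<alpha> [0..<n+2] ! k else 0) = \<alpha> k"
        by (simp del: upt_Suc add_2_eq_Suc')
    qed
    then show "\<forall>\<alpha>\<in>multi_indices n d. (\<lambda>k. if k < n+2 then map \<alpha> [0..<n+2] ! k else 0) = \<alpha>"
      by (rule ballI)
    have eq: "map (\<lambda>k. if k < n+2 then l ! k else 0) [0..<n+2] = l" if l: "length l = n+2"
      for l :: "nat list"
      unfolding l[symmetric] by (rule nth_equalityI)
        (simp_all only: length_map length_upt diff_zero nth_map nth_upt add_0 if_True)
    then show "\<forall>l\<in>?L. map (\<lambda>k. if k < n+2 then l ! k else 0) [0..<n+2] = l"
      by blast
    show "(\<lambda>\<alpha>. map \<alpha> [0..<n+2]) ` multi_indices n d \<subseteq> ?L"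
    proof (rule image_subsetI)
      fix \<alpha> assume "\<alpha> \<in> multi_indices n d"
      then show "map \<alpha> [0..<n+2] \<in> ?L"
        unfolding multi_indices_def mem_Collect_eq sum_eq length_map length_upt by simp
    qed
    show "(\<lambda>l k. if k < n+2 then l ! k else 0) ` ?L \<subseteq> multi_indices n d"
    proof (rule image_subsetI)
      fix l assume l: "l \<in> ?L"
      then have len: "length l = n+2" and sum: "sum_list l = d"
        by blast+
      have "(\<Sum>k\<le>n+1. if k < n+2 then l ! k else 0) = d"
        unfolding sum_eq[symmetric] eq[OF len] by (rule sum)
      moreover have "\<forall>k>n+1. (if k < n+2 then l ! k else 0) = 0"
      proof (intro allI impI)
        fix k assume "k > n+1"
        then have "\<not> k < n+2" by arith
        then show "(if k < n+2 then l ! k else 0) = 0" by (rule if_not_P)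
      qed
      ultimately show "(\<lambda>k. if k < n+2 then l ! k else 0) \<in> multi_indices n d"
        unfolding multi_indices_def mem_Collect_eq by (rule conjI[rotated])
    qed
  qed
  have "card (multi_indices n d) = (d + (n+2) - 1) choose d"
    unfolding bij_betw_same_card[OF bij] by (rule card_length_sum_list)
  also have "d + (n+2) - 1 = n+1+d"
    by arith
  also have "(n+1+d) choose d = fact (n+1+d) div (fact d * fact (n+1+d-d))"
    by (rule binomial_fact') arith
  also have "n+1+d-d = n+1"
    by arith
  finally show ?thesis
    by (subst mult.commute)
qed

end

theory Submission
  imports Defs "HOL-Complex_Analysis.Complex_Analysis"
begin

text \<open>
  Call a jet \<open>t \<mapsto> [Z(t)]\<close> non-degenerate if \<open>Z(0), Z'(0), \<dots>, Z\<^bsup>(n)\<^esup>(0)\<close> are linearly independent in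
  \<open>\<complex>\<^bsup>n+2\<^esup>\<close>. The jets outside \<open>\<Sigma>\<close> are non-degenerate, and at these the tangent space is spanned by two kinds of
  global sections.

  The general linear group acts on the space of vertical jets, transitively on the non-degenerate jets of
  homogeneous coordinates. Its infinitesimal generators \<open>Z\<^sub>a \<mapsto> Z\<^sub>b\<close> are sections of the tangent sheaf that realise
  every motion of the jet (\<open>gl_sections_move_jet\<close>); multiplied by \<open>Z\<^sub>i\<^sup>m A\<^sub>\<beta>\<close> they become sections of the
  twisted sheaf.

  The remaining tangent vectors fix the jet and move the coefficients in the direction of a form of degree \<open>d\<close>
  that vanishes along the jet to order \<open>n\<close>. For a non-degenerate jet, the values of suitable monomials \<open>X\<^sub>i X\<^bsub>\<iota> r\<^esub>\<close>,
  \<open>0 \<le> r \<le> n\<close>, form a basis of the power series modulo \<open>t\<^bsup>n+1\<^esup>\<close>. Every further product \<open>X\<^sub>a X\<^sub>b\<close> is a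
  combination of them along the jet, and the resulting quadrics, multiplied by monomials, reduce every form vanishing along the
  jet to zero (\<open>unit_field_reduction\<close>). By Cramer's rule the coefficients of these quadrics, cleared of denominators, are
  determinants of size \<open>n+1\<close> whose entries are quadratic in the jet of \<open>Z\<close>. So they have weight \<open>2(n+1)\<close> in \<open>Z\<close>, which is
  at most \<open>(n\<^sup>2+5n)/2\<close> for \<open>n \<ge> 2\<close>. In \<open>A\<close> these fields are constant, and a factor \<open>A\<^sub>\<beta>\<^sup>2\<close> makes them sections
  of the sheaf twisted by \<open>O(1)\<close> (\<open>relation_section_in_twisted_sections\<close>).

  Both kinds are vector fields in the homogeneous coordinates \<open>(Z, A)\<close> with prescribed weights under
  \<open>(Z, A) \<mapsto> (\<lambda>(t) Z, \<mu> A)\<close>, and such fields descend to global sections (\<open>homogeneous_field_section\<close>). This is checked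
  on power series modulo \<open>t\<^bsup>n+1\<^esup>\<close>, in which the equations of the jet space read \<open>F(f) = 0\<close>
  (\<open>jet_equation_eq\<close>) and its tangent spaces are given by the linearised equation (\<open>tangent_space_iff\<close>).

  That jets outside \<open>\<Sigma>\<close> are non-degenerate needs an argument at infinity, because \<open>\<Sigma>\<close> is the closure of a locus in one
  chart: every degenerate jet is the limit, along a curve in the general linear group, of degenerate jets in that chart
  (\<open>degenerate_in_Sigma_locus\<close>).
\<close>

section \<open>Polynomial functions on jet space\<close>

lemmas polynomial_intros =
  polynomial_functions.const polynomial_functions.coord polynomial_functions.add polynomial_functions.mult

lemma polynomial_functions_sum:
  assumes "\<And>i. i \<in> I \<Longrightarrow> f i \<in> polynomial_functions C"
  shows "(\<lambda>x. \<Sum>i\<in>I. f i x) \<in> polynomial_functions C"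
  using assms by (induction I rule: infinite_finite_induct) (auto intro!: polynomial_intros)

lemma polynomial_functions_prod:
  assumes "\<And>i. i \<in> I \<Longrightarrow> f i \<in> polynomial_functions C"
  shows "(\<lambda>x. \<Prod>i\<in>I. f i x) \<in> polynomial_functions C"
  using assms by (induction I rule: infinite_finite_induct) (auto intro!: polynomial_intros)

lemma polynomial_functions_if:
  assumes "f \<in> polynomial_functions C" "g \<in> polynomial_functions C"
  shows "(\<lambda>x. if b then f x else g x) \<in> polynomial_functions C"
  using assms by (cases b) auto

lemma polynomial_functions_power:
  assumes "f \<in> polynomial_functions C"
  shows "(\<lambda>x. f x ^ m) \<in> polynomial_functions C"
  using assms by (induction m) (auto intro!: polynomial_intros)

lemma polynomial_functions_diff:
  assumes "f \<in> polynomial_functions C" "g \<in> polynomial_functions C"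
  shows "(\<lambda>x. f x - g x) \<in> polynomial_functions C"
proof -
  have "(\<lambda>x. f x + (-1) * g x) \<in> polynomial_functions C"
    using assms by (intro polynomial_intros)
  then show ?thesis by simp
qed

definition has_gradient ::
    "coord set \<Rightarrow> ((coord \<Rightarrow> complex) \<Rightarrow> complex) \<Rightarrow> (coord \<Rightarrow> (coord \<Rightarrow> complex) \<Rightarrow> complex) \<Rightarrow> bool" where
  "has_gradient C G D \<longleftrightarrow> (\<forall>c. D c \<in> polynomial_functions C) \<and>
    (\<forall>X X' t. (\<forall>c\<in>C. ((\<lambda>t. X t c) has_field_derivative X' c) (at t)) \<longrightarrow>
      ((\<lambda>t. G (X t)) has_field_derivative (\<Sum>c\<in>C. D c (X t) * X' c)) (at t))"

text \<open>
  Quantifying over all curves in \<open>has_gradient\<close> makes one induction yield both the chain rule and,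
  for coordinate lines, the identification of the formal with the analytic partial derivatives.
\<close>

lemma polynomial_functions_has_gradient:
  assumes "finite C" "G \<in> polynomial_functions C"
  shows "\<exists>D. has_gradient C G D"
  using assms(2)
proof induction
  case (const a)
  have "has_gradient C (\<lambda>_. a) (\<lambda>_ _. 0)"
    unfolding has_gradient_def by (simp add: polynomial_functions.const)
  then show ?case by blast
next
  case (coord c)
  have delta: "(\<Sum>b\<in>C. (if b = c then 1 else 0) * X' b) = X' c" for X' :: "coord \<Rightarrow> complex"
    using coord assms(1) by (simp add: if_distrib[of "\<lambda>u. u * _"] cong: if_cong)
  have "has_gradient C (\<lambda>x. x c) (\<lambda>b _. if b = c then 1 else 0)"
    unfolding has_gradient_def delta using coord polynomial_functions.const by blast
  then show ?case by blast
next
  case (add f g)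
  then obtain D E where DE: "has_gradient C f D" "has_gradient C g E"
    by blast
  have "has_gradient C (\<lambda>x. f x + g x) (\<lambda>c x. D c x + E c x)"
    unfolding has_gradient_def
  proof (intro conjI allI impI)
    fix X :: "complex \<Rightarrow> coord \<Rightarrow> complex" and X' t
    assume "\<forall>c\<in>C. ((\<lambda>t. X t c) has_field_derivative X' c) (at t)"
    then have "((\<lambda>t. f (X t)) has_field_derivative (\<Sum>c\<in>C. D c (X t) * X' c)) (at t)"
      "((\<lambda>t. g (X t)) has_field_derivative (\<Sum>c\<in>C. E c (X t) * X' c)) (at t)"
      using DE unfolding has_gradient_def by blast+
    from DERIV_add[OF this]
    show "((\<lambda>t. f (X t) + g (X t)) has_field_derivative (\<Sum>c\<in>C. (D c (X t) + E c (X t)) * X' c)) (at t)"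
      by (simp add: distrib_right sum.distrib)
  next
    show "(\<lambda>x. D c x + E c x) \<in> polynomial_functions C" for c
      using DE unfolding has_gradient_def by (intro polynomial_functions.add) blast+
  qed
  then show ?case by blast
next
  case (mult f g)
  then obtain D E where DE: "has_gradient C f D" "has_gradient C g E"
    by blast
  have "has_gradient C (\<lambda>x. f x * g x) (\<lambda>c x. D c x * g x + E c x * f x)"
    unfolding has_gradient_def
  proof (intro conjI allI impI)
    fix X :: "complex \<Rightarrow> coord \<Rightarrow> complex" and X' t
    assume "\<forall>c\<in>C. ((\<lambda>t. X t c) has_field_derivative X' c) (at t)"
    then have "((\<lambda>t. f (X t)) has_field_derivative (\<Sum>c\<in>C. D c (X t) * X' c)) (at t)"
      "((\<lambda>t. g (X t)) has_field_derivative (\<Sum>c\<in>C. E c (X t) * X' c)) (at t)"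
      using DE unfolding has_gradient_def by blast+
    note DERIV_mult[OF this]
    also have "(\<Sum>c\<in>C. D c (X t) * X' c) * g (X t) + (\<Sum>c\<in>C. E c (X t) * X' c) * f (X t) =
        (\<Sum>c\<in>C. (D c (X t) * g (X t) + E c (X t) * f (X t)) * X' c)"
      unfolding sum_distrib_right sum.distrib[symmetric] by (rule sum.cong) (simp_all add: algebra_simps)
    finally show "((\<lambda>t. f (X t) * g (X t)) has_field_derivative
        (\<Sum>c\<in>C. (D c (X t) * g (X t) + E c (X t) * f (X t)) * X' c)) (at t)" .
  next
    show "(\<lambda>x. D c x * g x + E c x * f x) \<in> polynomial_functions C" for c
      using DE mult(1,2) unfolding has_gradient_def
      by (intro polynomial_functions.add polynomial_functions.mult) blast+
  qed
  then show ?case by blast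
qed

lemma
  assumes "finite C" "G \<in> polynomial_functions C"
  shows polynomial_functions_partial_deriv: "\<And>c. c \<in> C \<Longrightarrow> partial_deriv c G \<in> polynomial_functions C"
    and polynomial_functions_chain_rule:
      "\<And>X X' t. (\<And>c. c \<in> C \<Longrightarrow> ((\<lambda>t. X t c) has_field_derivative X' c) (at t)) \<Longrightarrow>
        ((\<lambda>t. G (X t)) has_field_derivative (\<Sum>c\<in>C. partial_deriv c G (X t) * X' c)) (at t)"
proof -
  obtain D where "has_gradient C G D"
    using polynomial_functions_has_gradient[OF assms] by blast
  then have D: "\<And>c. D c \<in> polynomial_functions C"
      "\<And>X X' t. (\<forall>c\<in>C. ((\<lambda>t. X t c) has_field_derivative X' c) (at t)) \<Longrightarrow>
        ((\<lambda>t. G (X t)) has_field_derivative (\<Sum>c\<in>C. D c (X t) * X' c)) (at t)"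
    unfolding has_gradient_def by blast+
  have pd: "partial_deriv c G = D c" if c: "c \<in> C" for c
  proof
    fix x :: "coord \<Rightarrow> complex"
    have "\<forall>b\<in>C. ((\<lambda>s. (x(c := s)) b) has_field_derivative (if b = c then 1 else 0)) (at (x c))"
      by (auto intro!: derivative_eq_intros)
    from D(2)[OF this]
    have "((\<lambda>s. G (x(c := s))) has_field_derivative (\<Sum>b\<in>C. D b x * (if b = c then 1 else 0))) (at (x c))"
      unfolding fun_upd_triv .
    also have "(\<Sum>b\<in>C. D b x * (if b = c then 1 else 0)) = D c x"
      using c assms(1) by (simp add: if_distrib[of "\<lambda>u. _ * u"] cong: if_cong)
    finally show "partial_deriv c G x = D c x"
      unfolding partial_deriv_def by (rule DERIV_imp_deriv)
  qed
  show "partial_deriv c G \<in> polynomial_functions C" if "c \<in> C" for c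
    using pd[OF that] D(1) by simp
  show "((\<lambda>t. G (X t)) has_field_derivative (\<Sum>c\<in>C. partial_deriv c G (X t) * X' c)) (at t)"
    if "\<And>c. c \<in> C \<Longrightarrow> ((\<lambda>t. X t c) has_field_derivative X' c) (at t)" for X X' t
    using D(2)[of X X' t] that pd by simp
qed

lemma finite_multi_indices [simp]: "finite (multi_indices n d)"
proof (rule finite_subset)
  show "multi_indices n d \<subseteq> {f. \<forall>k. (k \<in> {..n+1} \<longrightarrow> f k \<in> {..d}) \<and> (k \<notin> {..n+1} \<longrightarrow> f k = 0)}"
  proof
    fix \<alpha> assume \<alpha>: "\<alpha> \<in> multi_indices n d"
    have "\<alpha> k \<le> d" if "k \<le> n+1" for k
      using member_le_sum[of k "{..n+1}" \<alpha>] that \<alpha> by (auto simp: multi_indices_def)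
    then show "\<alpha> \<in> {f. \<forall>k. (k \<in> {..n+1} \<longrightarrow> f k \<in> {..d}) \<and> (k \<notin> {..n+1} \<longrightarrow> f k = 0)}"
      using \<alpha> by (auto simp: multi_indices_def)
  qed
qed (rule finite_set_of_finite_funs; simp)

lemma finite_jet_coords [simp]: "finite (jet_coords n d)"
proof -
  have "{Zc k l | k l. k \<le> n+1 \<and> l \<le> n} = (\<lambda>(k,l). Zc k l) ` ({..n+1} \<times> {..n})"
    by auto
  then show ?thesis by (simp add: jet_coords_def)
qed

lemma Zc_in_jet_coords [simp]: "Zc k l \<in> jet_coords n d \<longleftrightarrow> k \<le> n+1 \<and> l \<le> n"
  by (auto simp: jet_coords_def)

lemma Ac_in_jet_coords [simp]: "Ac \<alpha> \<in> jet_coords n d \<longleftrightarrow> \<alpha> \<in> multi_indices n d"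
  by (auto simp: jet_coords_def)

lemma sum_jet_coords:
  fixes g :: "coord \<Rightarrow> complex"
  shows "(\<Sum>c\<in>jet_coords n d. g c) =
    (\<Sum>k\<le>n+1. \<Sum>l\<le>n. g (Zc k l)) + (\<Sum>\<alpha>\<in>multi_indices n d. g (Ac \<alpha>))"
proof -
  have img: "{Zc k l | k l. k \<le> n+1 \<and> l \<le> n} = (\<lambda>(k,l). Zc k l) ` ({..n+1} \<times> {..n})"
    by auto
  have "(\<Sum>c\<in>jet_coords n d. g c) =
      (\<Sum>c\<in>(\<lambda>(k,l). Zc k l) ` ({..n+1} \<times> {..n}). g c) + (\<Sum>c\<in>Ac ` multi_indices n d. g c)"
    unfolding jet_coords_def img by (rule sum.union_disjoint) auto
  also have "(\<Sum>c\<in>(\<lambda>(k,l). Zc k l) ` ({..n+1} \<times> {..n}). g c) = (\<Sum>p\<in>{..n+1} \<times> {..n}. g (Zc (fst p) (snd p)))"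
    by (subst sum.reindex) (auto simp: inj_on_def case_prod_beta)
  also have "\<dots> = (\<Sum>k\<le>n+1. \<Sum>l\<le>n. g (Zc k l))"
    by (simp add: sum.cartesian_product case_prod_beta)
  also have "(\<Sum>c\<in>Ac ` multi_indices n d. g c) = (\<Sum>\<alpha>\<in>multi_indices n d. g (Ac \<alpha>))"
    by (subst sum.reindex) (auto simp: inj_on_def)
  finally show ?thesis .
qed

section \<open>Jets as truncated power series\<close>

definition jet_series :: "nat \<Rightarrow> (coord \<Rightarrow> complex) \<Rightarrow> nat \<Rightarrow> complex fps" where
  "jet_series n x k = Abs_fps (\<lambda>l. if l \<le> n then x (Zc k l) / fact l else 0)"

definition form_series ::
    "nat \<Rightarrow> nat \<Rightarrow> ((nat \<Rightarrow> nat) \<Rightarrow> complex) \<Rightarrow> (nat \<Rightarrow> complex fps) \<Rightarrow> complex fps" where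
  "form_series n d A f = (\<Sum>\<alpha>\<in>multi_indices n d. fps_const (A \<alpha>) * (\<Prod>k\<le>n+1. f k ^ \<alpha> k))"

lemma jet_series_nth: "fps_nth (jet_series n x k) l = (if l \<le> n then x (Zc k l) / fact l else 0)"
  by (simp add: jet_series_def)

lemma has_fps_expansion_hypersurface_form:
  assumes "\<And>k. k \<le> n+1 \<Longrightarrow> Z k has_fps_expansion f k"
  shows "(\<lambda>t. hypersurface_form n d A (\<lambda>k. Z k t)) has_fps_expansion form_series n d A f"
  unfolding hypersurface_form_def form_series_def
  by (intro has_fps_expansion_sum has_fps_expansion_mult has_fps_expansion_const
      has_fps_expansion_prod has_fps_expansion_power assms) auto

lemma has_fps_expansion_jet_polynomial:
  "(\<lambda>t. \<Sum>l\<le>n. x (Zc k l) * t ^ l / fact l) has_fps_expansion jet_series n x k"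
proof -
  have "(\<lambda>t. \<Sum>l\<le>n. (x (Zc k l) / fact l) * t ^ l) has_fps_expansion
      (\<Sum>l\<le>n. fps_const (x (Zc k l) / fact l) * fps_X ^ l)"
    by (intro fps_expansion_intros)
  also have "(\<Sum>l\<le>n. fps_const (x (Zc k l) / fact l) * fps_X ^ l) = jet_series n x k"
    by (rule fps_ext) (simp add: fps_sum_nth jet_series_nth fps_X_power_nth if_distrib[of "\<lambda>u. _ * u"] sum.delta' cong: if_cong)
  finally show ?thesis
    by simp
qed

lemma deriv_has_fps_expansion:
  assumes "f has_fps_expansion (F :: complex fps)"
  shows "(deriv ^^ l) f 0 = fact l * fps_nth F l"
  using fps_nth_fps_expansion[OF assms, of l] by (simp add: field_simps)

text \<open>
  Along the curve of jets of the polynomial disc the operator \<open>D\<close> is differentiation in \<open>t\<close>; the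
  truncation of \<open>D\<close> at order \<open>n\<close> is harmless because the disc has degree at most \<open>n\<close>.
\<close>

definition prolongation :: "nat \<Rightarrow> (coord \<Rightarrow> complex) \<Rightarrow> complex \<Rightarrow> coord \<Rightarrow> complex" where
  "prolongation n x t c = (case c of
      Zc k l \<Rightarrow> (\<Sum>j\<le>n-l. x (Zc k (l+j)) * t ^ j / fact j)
    | Ac \<alpha> \<Rightarrow> x (Ac \<alpha>))"

lemma prolongation_deriv:
  "l \<le> n \<Longrightarrow> ((\<lambda>t. prolongation n x t (Zc k l)) has_field_derivative
      (if l < n then prolongation n x t (Zc k (Suc l)) else 0)) (at t)"
proof -
  assume l: "l \<le> n"
  have *: "((\<lambda>t. \<Sum>j\<le>m. x (Zc k (l+j)) * t ^ j / fact j) has_field_derivative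
      (\<Sum>j<m. x (Zc k (l+Suc j)) * t ^ j / fact j)) (at t)" for m
  proof (induction m)
    case (Suc m)
    have "((\<lambda>t. x (Zc k (l+Suc m)) * t ^ Suc m / fact (Suc m)) has_field_derivative
        x (Zc k (l+Suc m)) * t ^ m / fact m) (at t)"
    proof -
      have "((\<lambda>t. x (Zc k (l+Suc m)) / fact (Suc m) * t ^ Suc m) has_field_derivative
          x (Zc k (l+Suc m)) / fact (Suc m) * (of_nat (Suc m) * t ^ m)) (at t)"
        by (rule DERIV_cong[OF DERIV_cmult[OF DERIV_power[OF DERIV_ident]]]) simp
      then show ?thesis
        by (simp add: field_simps del: of_nat_Suc)
    qed
    from DERIV_add[OF Suc this] show ?case by simp
  qed simp
  show ?thesis
  proof (cases "l < n")
    case True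
    then obtain m where m: "n - l = Suc m" "n - Suc l = m"
      by (metis Suc_diff_Suc)
    show ?thesis
      using *[of "n - l"] True m by (simp add: prolongation_def lessThan_Suc_atMost)
  next
    case False
    then show ?thesis using *[of 0] l by (simp add: prolongation_def)
  qed
qed

lemma polynomial_functions_hypersurface:
  "(\<lambda>x. hypersurface_form n d (\<lambda>\<alpha>. x (Ac \<alpha>)) (\<lambda>k. x (Zc k 0))) \<in> polynomial_functions (jet_coords n d)"
  unfolding hypersurface_form_def
  by (intro polynomial_functions_sum polynomial_functions.mult polynomial_functions_prod
      polynomial_functions_power polynomial_functions.coord) auto

lemma polynomial_functions_total_deriv:
  assumes "G \<in> polynomial_functions (jet_coords n d)"
  shows "total_deriv n G \<in> polynomial_functions (jet_coords n d)"
proof -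
  have "(\<lambda>x. \<Sum>l<n. \<Sum>k\<le>n+1. partial_deriv (Zc k l) G x * x (Zc k (Suc l))) \<in> polynomial_functions (jet_coords n d)"
    by (intro polynomial_functions_sum polynomial_functions.mult polynomial_functions.coord
        polynomial_functions_partial_deriv assms) auto
  then show ?thesis
    by (simp add: total_deriv_def[abs_def])
qed

lemma polynomial_functions_jet_equation: "jet_equation n d \<kappa> \<in> polynomial_functions (jet_coords n d)"
  unfolding jet_equation_def
  by (induction \<kappa>) (auto intro: polynomial_functions_hypersurface polynomial_functions_total_deriv)

lemma total_deriv_prolongation:
  assumes "G \<in> polynomial_functions (jet_coords n d)"
  shows "((\<lambda>t. G (prolongation n x t)) has_field_derivative total_deriv n G (prolongation n x t)) (at t)"
proof -
  let ?X' = "\<lambda>c. case c of Zc k l \<Rightarrow> if l < n then prolongation n x t (Zc k (Suc l)) else 0 | Ac \<alpha> \<Rightarrow> 0"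
  have "((\<lambda>t. G (prolongation n x t)) has_field_derivative
     (\<Sum>c\<in>jet_coords n d. partial_deriv c G (prolongation n x t) * ?X' c)) (at t)"
  proof (rule polynomial_functions_chain_rule[OF finite_jet_coords assms])
    fix c assume "c \<in> jet_coords n d"
    then show "((\<lambda>t. prolongation n x t c) has_field_derivative ?X' c) (at t)"
    proof (cases c)
      case (Zc k l)
      with \<open>c \<in> jet_coords n d\<close> show ?thesis
        using prolongation_deriv[of l n x k t] by (cases "l < n") auto
    next
      case (Ac \<alpha>)
      then show ?thesis by (simp add: prolongation_def)
    qed
  qed
  also have "(\<Sum>c\<in>jet_coords n d. partial_deriv c G (prolongation n x t) * ?X' c) =
      (\<Sum>k\<le>n+1. \<Sum>l\<le>n. partial_deriv (Zc k l) G (prolongation n x t) *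
        (if l < n then prolongation n x t (Zc k (Suc l)) else 0))"
    by (simp add: sum_jet_coords)
  also have "\<dots> = (\<Sum>k\<le>n+1. \<Sum>l<n. partial_deriv (Zc k l) G (prolongation n x t) * prolongation n x t (Zc k (Suc l)))"
    by (intro sum.cong refl sum.mono_neutral_cong_right) auto
  also have "\<dots> = total_deriv n G (prolongation n x t)"
    unfolding total_deriv_def by (rule sum.swap)
  finally show ?thesis .
qed

lemma polynomial_functions_cong:
  assumes "G \<in> polynomial_functions C" "\<And>c. c \<in> C \<Longrightarrow> x c = y c"
  shows "G x = G y"
  using assms by induction auto

text \<open>
  This turns the equations of the jet space, and with them tangency, into congruences of power series
  modulo \<open>t\<^bsup>n+1\<^esup>\<close>.
\<close>

lemma jet_equation_eq:
  assumes "\<kappa> \<le> n"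
  shows "jet_equation n d \<kappa> x =
    fact \<kappa> * fps_nth (form_series n d (\<lambda>\<alpha>. x (Ac \<alpha>)) (jet_series n x)) \<kappa>"
proof -
  let ?F = "\<lambda>x. hypersurface_form n d (\<lambda>\<alpha>. x (Ac \<alpha>)) (\<lambda>k. x (Zc k 0))"
  have "(deriv ^^ \<kappa>) (\<lambda>t. ?F (prolongation n x t)) = (\<lambda>t. jet_equation n d \<kappa> (prolongation n x t))"
  proof (induction \<kappa>)
    case 0
    then show ?case by (simp add: jet_equation_def)
  next
    case (Suc \<kappa>)
    have "jet_equation n d (Suc \<kappa>) = total_deriv n (jet_equation n d \<kappa>)"
      by (simp add: jet_equation_def)
    with Suc show ?case
      using total_deriv_prolongation[OF polynomial_functions_jet_equation, of n d \<kappa> x]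
      by (auto intro!: ext DERIV_imp_deriv)
  qed
  then have "jet_equation n d \<kappa> (prolongation n x 0) = (deriv ^^ \<kappa>) (\<lambda>t. ?F (prolongation n x t)) 0"
    by simp
  also have "\<dots> = fact \<kappa> * fps_nth (form_series n d (\<lambda>\<alpha>. x (Ac \<alpha>)) (jet_series n x)) \<kappa>"
    using has_fps_expansion_hypersurface_form[of n "\<lambda>k t. \<Sum>l\<le>n. x (Zc k l) * t ^ l / fact l" "jet_series n x" d "\<lambda>\<alpha>. x (Ac \<alpha>)"]
      has_fps_expansion_jet_polynomial
    by (intro deriv_has_fps_expansion) (simp add: prolongation_def)
  also have "jet_equation n d \<kappa> (prolongation n x 0) = jet_equation n d \<kappa> x"
  proof (rule polynomial_functions_cong[OF polynomial_functions_jet_equation])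
    fix c assume "c \<in> jet_coords n d"
    have "(\<Sum>j\<le>m. y j * 0 ^ j / fact j) = (y 0 :: complex)" for m y
      by (induction m) auto
    then show "prolongation n x 0 c = x c"
      by (simp add: prolongation_def split: coord.split)
  qed
  finally show ?thesis .
qed


section \<open>Congruence of power series and determinants of jets\<close>

definition eq_upto :: "nat \<Rightarrow> complex fps \<Rightarrow> complex fps \<Rightarrow> bool" where
  "eq_upto n f g \<longleftrightarrow> (\<forall>l\<le>n. fps_nth f l = fps_nth g l)"

lemma eq_upto_refl [simp, intro]: "eq_upto n f f"
  by (simp add: eq_upto_def)

lemma eq_upto_sym: "eq_upto n f g \<Longrightarrow> eq_upto n g f"
  by (simp add: eq_upto_def)

lemma eq_upto_trans [trans]: "eq_upto n f g \<Longrightarrow> eq_upto n g h \<Longrightarrow> eq_upto n f h"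
  by (simp add: eq_upto_def)

lemma eq_upto_add: "eq_upto n f f' \<Longrightarrow> eq_upto n g g' \<Longrightarrow> eq_upto n (f + g) (f' + g')"
  by (simp add: eq_upto_def)

lemma eq_upto_diff: "eq_upto n f f' \<Longrightarrow> eq_upto n g g' \<Longrightarrow> eq_upto n (f - g) (f' - g')"
  by (simp add: eq_upto_def)

lemma eq_upto_mult:
  assumes "eq_upto n f f'" "eq_upto n g g'"
  shows "eq_upto n (f * g) (f' * g')"
  unfolding eq_upto_def
proof (intro allI impI)
  fix l assume "l \<le> n"
  then show "fps_nth (f * g) l = fps_nth (f' * g') l"
    unfolding fps_mult_nth using assms by (intro sum.cong) (auto simp: eq_upto_def)
qed

lemma eq_upto_sum: "(\<And>i. i \<in> I \<Longrightarrow> eq_upto n (f i) (g i)) \<Longrightarrow> eq_upto n (\<Sum>i\<in>I. f i) (\<Sum>i\<in>I. g i)"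
  by (auto simp: eq_upto_def fps_sum_nth intro: sum.cong)

lemma eq_upto_prod: "(\<And>i. i \<in> I \<Longrightarrow> eq_upto n (f i) (g i)) \<Longrightarrow> eq_upto n (\<Prod>i\<in>I. f i) (\<Prod>i\<in>I. g i)"
  by (induction I rule: infinite_finite_induct) (auto intro: eq_upto_mult)

lemma eq_upto_power: "eq_upto n f g \<Longrightarrow> eq_upto n (f ^ m) (g ^ m)"
  by (induction m) (auto intro: eq_upto_mult)

lemma eq_upto_cancel_left:
  assumes "eq_upto n (g * a) (g * b)" "fps_nth g 0 \<noteq> 0"
  shows "eq_upto n a b"
proof -
  have "eq_upto n (inverse g * (g * a)) (inverse g * (g * b))"
    by (rule eq_upto_mult) (use assms in auto)
  then show ?thesis
    using inverse_mult_eq_1[OF assms(2)] by (simp add: mult.assoc[symmetric])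
qed

definition jet_matrix :: "nat \<Rightarrow> (nat \<Rightarrow> complex fps) \<Rightarrow> complex mat" where
  "jet_matrix n H = Matrix.mat (n+1) (n+1) (\<lambda>(r, s). fps_nth (H r) s)"

definition jet_det :: "nat \<Rightarrow> (nat \<Rightarrow> complex fps) \<Rightarrow> complex" where
  "jet_det n H = Determinant.det (jet_matrix n H)"

lemma jet_matrix_carrier: "jet_matrix n H \<in> carrier_mat (n+1) (n+1)"
  by (simp add: jet_matrix_def)

lemma jet_det_cong:
  assumes "\<And>r. r \<le> n \<Longrightarrow> eq_upto n (H r) (H' r)"
  shows "jet_det n H = jet_det n H'"
proof -
  have "jet_matrix n H = jet_matrix n H'"
    unfolding jet_matrix_def using assms by (intro cong_mat) (auto simp: eq_upto_def)
  then show ?thesis by (simp add: jet_det_def)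
qed

text \<open>
  Multiplication by \<open>g\<close> modulo \<open>t\<^bsup>n+1\<^esup>\<close> is an upper triangular matrix with constant diagonal \<open>g(0)\<close>.
\<close>

lemma jet_det_mult: "jet_det n (\<lambda>r. g * H r) = fps_nth g 0 ^ (n+1) * jet_det n H"
proof -
  define T where "T = Matrix.mat (n+1) (n+1) (\<lambda>(s, t). if s \<le> t then fps_nth g (t - s) else 0)"
  have T: "T \<in> carrier_mat (n+1) (n+1)"
    by (simp add: T_def)
  have "jet_matrix n (\<lambda>r. g * H r) = jet_matrix n H * T"
  proof (rule eq_matI)
    fix r t assume "r < dim_row (jet_matrix n H * T)" "t < dim_col (jet_matrix n H * T)"
    then have rt: "r \<le> n" "t \<le> n"
      by (auto simp: jet_matrix_def T_def)
    have "fps_nth (g * H r) t = fps_nth (H r * g) t"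
      by (simp add: mult.commute)
    also have "\<dots> = (\<Sum>s=0..t. fps_nth (H r) s * fps_nth g (t - s))"
      by (simp add: fps_mult_nth)
    also have "\<dots> = (\<Sum>s=0..<n+1. fps_nth (H r) s * (if s \<le> t then fps_nth g (t - s) else 0))"
      using rt by (intro sum.mono_neutral_cong_left) auto
    finally show "jet_matrix n (\<lambda>r. g * H r) $$ (r, t) = (jet_matrix n H * T) $$ (r, t)"
      using rt by (simp add: jet_matrix_def T_def scalar_prod_def)
  qed (auto simp: jet_matrix_def T_def)
  then have "jet_det n (\<lambda>r. g * H r) = jet_det n H * Determinant.det T"
    unfolding jet_det_def by (simp only: det_mult[OF jet_matrix_carrier T])
  also have "Determinant.det T = prod_list (diag_mat T)"
    by (rule det_upper_triangular[OF _ T]) (auto simp: T_def upper_triangular_def)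
  also have "diag_mat T = map (\<lambda>_. fps_nth g 0) [0..<n+1]"
    by (simp add: diag_mat_def T_def)
  also have "prod_list \<dots> = fps_nth g 0 ^ (n+1)"
    by (simp add: map_replicate_const prod_list_replicate del: upt_Suc)
  finally show ?thesis by (simp add: mult.commute)
qed

lemma jet_det_update:
  assumes "r \<le> n"
  shows "jet_det n (H(r := h)) = (\<Sum>s<n+1. fps_nth h s * cofactor (jet_matrix n H) r s)"
proof -
  have "jet_det n (H(r := h)) = (\<Sum>s<n+1. jet_matrix n (H(r := h)) $$ (r, s) * cofactor (jet_matrix n (H(r := h))) r s)"
    unfolding jet_det_def by (rule laplace_expansion_row[OF jet_matrix_carrier]) (use assms in auto)
  also have "\<dots> = (\<Sum>s<n+1. fps_nth h s * cofactor (jet_matrix n H) r s)"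
  proof (rule sum.cong[OF refl])
    fix s assume s: "s \<in> {..<n+1}"
    have "mat_delete (jet_matrix n (H(r := h))) r s = mat_delete (jet_matrix n H) r s"
      by (rule eq_matI) (auto simp: mat_delete_def jet_matrix_def)
    then show "jet_matrix n (H(r := h)) $$ (r, s) * cofactor (jet_matrix n (H(r := h))) r s =
        fps_nth h s * cofactor (jet_matrix n H) r s"
      using s assms by (simp add: cofactor_def jet_matrix_def)
  qed
  finally show ?thesis .
qed

lemma cofactor_rows:
  assumes "r \<le> n" "r' \<le> n"
  shows "(\<Sum>s<n+1. fps_nth (H r) s * cofactor (jet_matrix n H) r' s) = (if r = r' then jet_det n H else 0)"
proof -
  have "(jet_matrix n H * adj_mat (jet_matrix n H)) $$ (r, r') = (if r = r' then jet_det n H else 0)"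
    using assms unfolding adj_mat(2)[OF jet_matrix_carrier] by (simp add: jet_det_def)
  also have "(jet_matrix n H * adj_mat (jet_matrix n H)) $$ (r, r') =
      (\<Sum>s<n+1. fps_nth (H r) s * cofactor (jet_matrix n H) r' s)"
    using assms by (auto simp: jet_matrix_def adj_mat_def scalar_prod_def atLeast0LessThan intro!: sum.cong)
  finally show ?thesis .
qed

lemma cofactor_columns:
  assumes "s \<le> n" "s' \<le> n"
  shows "(\<Sum>r<n+1. cofactor (jet_matrix n H) r s * fps_nth (H r) s') = (if s = s' then jet_det n H else 0)"
proof -
  have "(adj_mat (jet_matrix n H) * jet_matrix n H) $$ (s, s') = (if s = s' then jet_det n H else 0)"
    using assms unfolding adj_mat(3)[OF jet_matrix_carrier] by (simp add: jet_det_def)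
  also have "(adj_mat (jet_matrix n H) * jet_matrix n H) $$ (s, s') =
      (\<Sum>r<n+1. cofactor (jet_matrix n H) r s * fps_nth (H r) s')"
    using assms by (auto simp: jet_matrix_def adj_mat_def scalar_prod_def atLeast0LessThan intro!: sum.cong)
  finally show ?thesis .
qed

lemma jet_det_update_sum:
  assumes "r \<le> n"
  shows "jet_det n (H(r := \<Sum>i\<in>I. fps_const (c i) * h i)) = (\<Sum>i\<in>I. c i * jet_det n (H(r := h i)))"
  unfolding jet_det_update[OF assms]
  by (simp add: fps_sum_nth sum_distrib_left sum_distrib_right mult.assoc del: sum.lessThan_Suc) (rule sum.swap)

text \<open>
  Cramer's rule, free of division and so also valid at jets where the determinant vanishes: the
  sections built from it have to be tangent to the jet space everywhere.
\<close>

lemma jet_cramer: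
  "eq_upto n (\<Sum>r\<le>n. fps_const (jet_det n (H(r := h))) * H r) (fps_const (jet_det n H) * h)"
  unfolding eq_upto_def
proof (intro allI impI)
  fix l assume l: "l \<le> n"
  have "fps_nth (\<Sum>r\<le>n. fps_const (jet_det n (H(r := h))) * H r) l =
      (\<Sum>r<n+1. (\<Sum>s<n+1. fps_nth h s * cofactor (jet_matrix n H) r s) * fps_nth (H r) l)"
    unfolding fps_sum_nth fps_mult_left_const_nth
    by (rule sum.cong) (auto simp: jet_det_update)
  also have "\<dots> = (\<Sum>s<n+1. fps_nth h s * (\<Sum>r<n+1. cofactor (jet_matrix n H) r s * fps_nth (H r) l))"
    unfolding sum_distrib_right sum_distrib_left mult.assoc by (rule sum.swap)
  also have "\<dots> = (\<Sum>s<n+1. fps_nth h s * (if s = l then jet_det n H else 0))"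
    using l by (intro sum.cong refl arg_cong2[of _ _ _ _ "(*)"] cofactor_columns) auto
  also have "\<dots> = fps_nth (fps_const (jet_det n H) * h) l"
    using l by (simp add: if_distrib[of "\<lambda>u. _ * u"] mult.commute cong: if_cong del: sum.lessThan_Suc)
  finally show "fps_nth (\<Sum>r\<le>n. fps_const (jet_det n (H(r := h))) * H r) l =
      fps_nth (fps_const (jet_det n H) * h) l" .
qed

lemma jet_det_independent:
  assumes "jet_det n H \<noteq> 0" "eq_upto n (\<Sum>r\<le>n. fps_const (b r) * H r) 0" "r \<le> n"
  shows "b r = 0"
proof -
  have "0 = (\<Sum>s<n+1. (\<Sum>q<n+1. b q * fps_nth (H q) s) * cofactor (jet_matrix n H) r s)"
    using assms(2) by (intro sum.neutral[symmetric])
      (auto simp: eq_upto_def fps_sum_nth lessThan_Suc_atMost simp del: sum.lessThan_Suc sum.atMost_Suc)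
  also have "\<dots> = (\<Sum>q<n+1. b q * (\<Sum>s<n+1. fps_nth (H q) s * cofactor (jet_matrix n H) r s))"
    unfolding sum_distrib_right sum_distrib_left mult.assoc by (rule sum.swap)
  also have "\<dots> = (\<Sum>q<n+1. b q * (if q = r then jet_det n H else 0))"
    using assms(3) by (intro sum.cong refl arg_cong2[of _ _ _ _ "(*)"] cofactor_rows) auto
  also have "\<dots> = b r * jet_det n H"
    using assms(3) by (simp add: if_distrib[of "\<lambda>u. _ * u"] cong: if_cong del: sum.lessThan_Suc)
  finally show ?thesis using assms(1) by simp
qed

lemma jet_det_span:
  assumes "jet_det n H \<noteq> 0"
  obtains c where "eq_upto n h (\<Sum>r\<le>n. fps_const (c r) * H r)"
proof
  let ?D = "jet_det n H"
  have "eq_upto n (fps_const (1 / ?D) * (fps_const ?D * h))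
     (fps_const (1 / ?D) * (\<Sum>r\<le>n. fps_const (jet_det n (H(r := h))) * H r))"
    by (intro eq_upto_mult eq_upto_refl eq_upto_sym[OF jet_cramer])
  moreover have "fps_const (1 / ?D) * (fps_const ?D * h) = h"
    using assms unfolding mult.assoc[symmetric] fps_const_mult by simp
  moreover have "fps_const (1 / ?D) * (\<Sum>r\<le>n. fps_const (jet_det n (H(r := h))) * H r) =
     (\<Sum>r\<le>n. fps_const (jet_det n (H(r := h)) / ?D) * H r)"
    unfolding sum_distrib_left mult.assoc[symmetric] fps_const_mult by simp
  ultimately show "eq_upto n h (\<Sum>r\<le>n. fps_const (jet_det n (H(r := h)) / ?D) * H r)"
    by simp
qed

text \<open>
  As the determinant is linear in each row, the rows can be replaced by linear combinations one at a time.
\<close>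

lemma jet_det_combinations_vanish:
  assumes van: "\<And>\<iota>. (\<And>r. \<iota> r \<in> K) \<Longrightarrow> jet_det n (\<lambda>r. f (\<iota> r)) = 0" and "k0 \<in> K"
  shows "jet_det n (\<lambda>r. \<Sum>k\<in>K. fps_const (c r k) * f k) = 0"
proof -
  let ?g = "\<lambda>r. \<Sum>k\<in>K. fps_const (c r k) * f k"
  have "\<forall>\<iota>. (\<forall>r. \<iota> r \<in> K) \<longrightarrow> jet_det n (\<lambda>r. if r < m then ?g r else f (\<iota> r)) = 0" if "m \<le> n+1" for m
    using that
  proof (induction m)
    case 0
    then show ?case using van by simp
  next
    case (Suc m)
    show ?case
    proof (intro allI impI)
      fix \<iota> :: "nat \<Rightarrow> 'a" assume \<iota>: "\<forall>r. \<iota> r \<in> K"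
      let ?H = "\<lambda>r. if r < m then ?g r else f (\<iota> r)"
      have "(\<lambda>r. if r < Suc m then ?g r else f (\<iota> r)) = ?H(m := ?g m)"
        by auto
      then have "jet_det n (\<lambda>r. if r < Suc m then ?g r else f (\<iota> r)) = (\<Sum>k\<in>K. c m k * jet_det n (?H(m := f k)))"
        using jet_det_update_sum[of m n ?H "c m" f K] Suc.prems by simp
      also have "\<dots> = 0"
      proof (rule sum.neutral, rule ballI)
        fix k assume k: "k \<in> K"
        have "?H(m := f k) = (\<lambda>r. if r < m then ?g r else f ((\<iota>(m := k)) r))"
          by auto
        then show "c m k * jet_det n (?H(m := f k)) = 0"
          using Suc.IH Suc.prems \<iota> k by simp
      qed
      finally show "jet_det n (\<lambda>r. if r < Suc m then ?g r else f (\<iota> r)) = 0" .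
    qed
  qed
  from this[OF order_refl] have "jet_det n (\<lambda>r. if r < n+1 then ?g r else f ((\<lambda>_. k0) r)) = 0"
    using \<open>k0 \<in> K\<close> by (elim allE[of _ "\<lambda>_. k0"]) blast
  also have "jet_det n (\<lambda>r. if r < n+1 then ?g r else f ((\<lambda>_. k0) r)) = jet_det n ?g"
    by (rule jet_det_cong) auto
  finally show ?thesis .
qed

lemma polynomial_functions_jet_det:
  assumes "\<And>r l. r \<le> n \<Longrightarrow> l \<le> n \<Longrightarrow> (\<lambda>x. fps_nth (H x r) l) \<in> polynomial_functions C"
  shows "(\<lambda>x. jet_det n (H x)) \<in> polynomial_functions C"
proof -
  have "(\<lambda>x. \<Sum>p | p permutes {0..<n+1}. signof p * (\<Prod>i = 0..<n+1. fps_nth (H x i) (p i)))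
      \<in> polynomial_functions C"
  proof (intro polynomial_functions_sum polynomial_functions.mult polynomial_functions.const
      polynomial_functions_prod)
    fix p i assume "p \<in> {p. p permutes {0..<n+1}}" "i \<in> {0..<n+1}"
    then have "p i \<in> {0..<n+1}"
      using permutes_in_image by fastforce
    with \<open>i \<in> _\<close> show "(\<lambda>x. fps_nth (H x i) (p i)) \<in> polynomial_functions C"
      by (intro assms) auto
  qed
  also have "(\<lambda>x. \<Sum>p | p permutes {0..<n+1}. signof p * (\<Prod>i = 0..<n+1. fps_nth (H x i) (p i))) =
      (\<lambda>x. jet_det n (H x))"
  proof
    fix x
    have "fps_nth (H x i) (p i) = jet_matrix n (H x) $$ (i, p i)"
      if "p permutes {0..<n+1}" "i \<in> {0..<n+1}" for p i
      using that permutes_in_image[OF that(1), of i] by (simp add: jet_matrix_def)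
    then show "(\<Sum>p | p permutes {0..<n+1}. signof p * (\<Prod>i = 0..<n+1. fps_nth (H x i) (p i))) = jet_det n (H x)"
      unfolding jet_det_def det_def'[OF jet_matrix_carrier]
      by (intro sum.cong refl arg_cong2[of _ _ _ _ "(*)"] prod.cong) auto
  qed
  finally show ?thesis .
qed


section \<open>Differentiating families of power series\<close>

text \<open>
  The derivative at \<open>s = 0\<close>, taken coefficientwise. Differentials of functions of jets are computed on power series
  in \<open>t\<close> in this sense, and no derivative in \<open>s\<close> is ever exchanged with one in \<open>t\<close>.
\<close>

definition has_coeff_deriv :: "(complex \<Rightarrow> complex fps) \<Rightarrow> complex fps \<Rightarrow> bool" where
  "has_coeff_deriv G D \<longleftrightarrow> (\<forall>l. ((\<lambda>s. fps_nth (G s) l) has_field_derivative fps_nth D l) (at 0))"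

lemma has_coeff_deriv_const: "has_coeff_deriv (\<lambda>_. f) 0"
  by (simp add: has_coeff_deriv_def)

lemma has_coeff_deriv_affine: "has_coeff_deriv (\<lambda>s. f + fps_const s * q) q"
  unfolding has_coeff_deriv_def by (auto intro!: derivative_eq_intros)

lemma has_coeff_deriv_mult:
  assumes "has_coeff_deriv G D" "has_coeff_deriv H E"
  shows "has_coeff_deriv (\<lambda>s. G s * H s) (D * H 0 + G 0 * E)"
  unfolding has_coeff_deriv_def
proof
  fix l
  have "((\<lambda>s. \<Sum>i=0..l. fps_nth (G s) i * fps_nth (H s) (l - i)) has_field_derivative
      (\<Sum>i=0..l. fps_nth D i * fps_nth (H 0) (l - i) + fps_nth E (l - i) * fps_nth (G 0) i)) (at 0)"
    using assms by (intro DERIV_sum DERIV_mult) (auto simp: has_coeff_deriv_def)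
  then show "((\<lambda>s. fps_nth (G s * H s) l) has_field_derivative fps_nth (D * H 0 + G 0 * E) l) (at 0)"
    by (simp add: fps_mult_nth sum.distrib mult.commute[of "fps_nth E _"])
qed

lemma has_coeff_deriv_sum:
  assumes "\<And>i. i \<in> I \<Longrightarrow> has_coeff_deriv (G i) (D i)"
  shows "has_coeff_deriv (\<lambda>s. \<Sum>i\<in>I. G i s) (\<Sum>i\<in>I. D i)"
  using assms unfolding has_coeff_deriv_def fps_sum_nth by (auto intro!: DERIV_sum)

lemma has_coeff_deriv_power:
  assumes "has_coeff_deriv G D"
  shows "has_coeff_deriv (\<lambda>s. G s ^ m) (of_nat m * (G 0 ^ (m - 1) * D))"
proof (induction m)
  case 0
  show ?case using has_coeff_deriv_const[of 1] by simp
next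
  case (Suc m)
  have "D * G 0 ^ m + G 0 * (of_nat m * (G 0 ^ (m - 1) * D)) = of_nat (Suc m) * (G 0 ^ m * D)"
    by (cases m) (simp_all add: algebra_simps)
  with has_coeff_deriv_mult[OF assms Suc] show ?case by simp
qed

lemma has_coeff_deriv_prod:
  assumes "finite K" "\<And>k. k \<in> K \<Longrightarrow> has_coeff_deriv (G k) (D k)"
  shows "has_coeff_deriv (\<lambda>s. \<Prod>k\<in>K. G k s) (\<Sum>k\<in>K. D k * (\<Prod>i\<in>K-{k}. G i 0))"
  using assms
proof (induction K rule: finite_induct)
  case empty
  then show ?case using has_coeff_deriv_const[of 1] by simp
next
  case (insert a K)
  have "D a * (\<Prod>k\<in>K. G k 0) + G a 0 * (\<Sum>k\<in>K. D k * (\<Prod>i\<in>K-{k}. G i 0)) =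
      (\<Sum>k\<in>insert a K. D k * (\<Prod>i\<in>insert a K - {k}. G i 0))"
  proof -
    have "G a 0 * (D k * (\<Prod>i\<in>K-{k}. G i 0)) = D k * (\<Prod>i\<in>insert a K - {k}. G i 0)" if "k \<in> K" for k
    proof -
      have "insert a K - {k} = insert a (K - {k})" using that insert.hyps by auto
      then show ?thesis using insert.hyps by (simp add: ac_simps)
    qed
    then have "G a 0 * (\<Sum>k\<in>K. D k * (\<Prod>i\<in>K-{k}. G i 0)) = (\<Sum>k\<in>K. D k * (\<Prod>i\<in>insert a K - {k}. G i 0))"
      unfolding sum_distrib_left by (rule sum.cong[OF refl])
    then show ?thesis using insert.hyps by simp
  qed
  moreover have "has_coeff_deriv (\<lambda>s. G a s * (\<Prod>k\<in>K. G k s))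
      (D a * (\<Prod>k\<in>K. G k 0) + G a 0 * (\<Sum>k\<in>K. D k * (\<Prod>i\<in>K-{k}. G i 0)))"
    by (rule has_coeff_deriv_mult) (use insert in auto)
  ultimately show ?case
    using insert.hyps by simp
qed

lemma fps_nth_inverse_rec:
  "fps_nth (inverse f) (Suc l) = - inverse (fps_nth f 0) * (\<Sum>i=1..Suc l. fps_nth f i * fps_nth (inverse f) (Suc l - i))"
  for f :: "complex fps"
  by (simp add: fps_inverse_def)

text \<open>
  The recursion for the coefficients of the inverse only gives differentiability; the value of the derivative then
  follows by differentiating \<open>G(s) \<cdot> G(s)\<^sup>-\<^sup>1 = 1\<close>.
\<close>

lemma has_coeff_deriv_inverse:
  assumes G: "has_coeff_deriv G D" and nz: "fps_nth (G 0) 0 \<noteq> 0"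
  shows "has_coeff_deriv (\<lambda>s. inverse (G s)) (- D * inverse (G 0) * inverse (G 0))"
proof -
  have Gl: "((\<lambda>s. fps_nth (G s) l) has_field_derivative fps_nth D l) (at 0)" for l
    using G by (simp add: has_coeff_deriv_def)
  have diff: "\<exists>e. ((\<lambda>s. fps_nth (inverse (G s)) l) has_field_derivative e) (at 0)" for l
  proof (induction l rule: less_induct)
    case (less l)
    show ?case
    proof (cases l)
      case 0
      have "((\<lambda>s. inverse (fps_nth (G s) 0)) has_field_derivative
          - (inverse (fps_nth (G 0) 0) * fps_nth D 0 * inverse (fps_nth (G 0) 0))) (at 0)"
        by (rule DERIV_inverse'[OF Gl nz])
      then show ?thesis using 0 by auto
    next
      case (Suc m)
      obtain e where e: "\<And>i. i < l \<Longrightarrow> ((\<lambda>s. fps_nth (inverse (G s)) i) has_field_derivative e i) (at 0)"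
        using less by metis
      have "((\<lambda>s. \<Sum>i=1..l. fps_nth (G s) i * fps_nth (inverse (G s)) (l - i)) has_field_derivative
          (\<Sum>i=1..l. fps_nth D i * fps_nth (inverse (G 0)) (l - i) + e (l - i) * fps_nth (G 0) i)) (at 0)"
        using Suc by (intro DERIV_sum DERIV_mult Gl e) auto
      from DERIV_mult[OF DERIV_minus[OF DERIV_inverse'[OF Gl nz]] this]
      show ?thesis unfolding Suc fps_nth_inverse_rec by blast
    qed
  qed
  then obtain e where e: "\<And>l. ((\<lambda>s. fps_nth (inverse (G s)) l) has_field_derivative e l) (at 0)"
    by metis
  define E where "E = Abs_fps e"
  have E: "has_coeff_deriv (\<lambda>s. inverse (G s)) E"
    using e by (simp add: has_coeff_deriv_def E_def)
  have near: "eventually (\<lambda>s. fps_nth (G s) 0 \<noteq> 0) (nhds 0)"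
    using tendsto_imp_eventually_ne[OF isContD[OF DERIV_isCont[OF Gl[of 0]]] nz] nz
    by (simp add: eventually_nhds_conv_at)
  have "fps_nth (D * inverse (G 0) + G 0 * E) l = 0" for l
  proof -
    have "((\<lambda>s. fps_nth (G s * inverse (G s)) l) has_field_derivative fps_nth (D * inverse (G 0) + G 0 * E) l) (at 0)"
      using has_coeff_deriv_mult[OF G E] by (simp add: has_coeff_deriv_def)
    moreover have "((\<lambda>s. fps_nth (G s * inverse (G s)) l) has_field_derivative 0) (at 0)"
    proof (rule DERIV_cong_ev[THEN iffD2, OF refl _ refl])
      show "eventually (\<lambda>s. fps_nth (G s * inverse (G s)) l = fps_nth 1 l) (nhds 0)"
        using near by eventually_elim (simp add: inverse_mult_eq_1')
    qed simp
    ultimately show ?thesis by (rule DERIV_unique)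
  qed
  then have "D * inverse (G 0) + G 0 * E = 0"
    by (intro fps_ext) simp
  then have "inverse (G 0) * (G 0 * E) = - D * inverse (G 0) * inverse (G 0)"
    by (simp add: algebra_simps add_eq_0_iff)
  moreover have "inverse (G 0) * (G 0 * E) = E"
    using inverse_mult_eq_1[OF nz] by (simp add: mult.assoc[symmetric])
  ultimately show ?thesis using E by simp
qed

section \<open>Monomials and forms\<close>

definition monomial :: "nat \<Rightarrow> (nat \<Rightarrow> complex fps) \<Rightarrow> (nat \<Rightarrow> nat) \<Rightarrow> complex fps" where
  "monomial n f \<alpha> = (\<Prod>k\<le>n+1. f k ^ \<alpha> k)"

definition raise_index :: "nat \<Rightarrow> (nat \<Rightarrow> nat) \<Rightarrow> nat \<Rightarrow> nat" where
  "raise_index k \<alpha> = \<alpha>(k := \<alpha> k + 1)"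

definition lower_index :: "nat \<Rightarrow> (nat \<Rightarrow> nat) \<Rightarrow> nat \<Rightarrow> nat" where
  "lower_index k \<alpha> = \<alpha>(k := \<alpha> k - 1)"

lemma form_series_monomial: "form_series n d A f = (\<Sum>\<alpha>\<in>multi_indices n d. fps_const (A \<alpha>) * monomial n f \<alpha>)"
  by (simp add: form_series_def monomial_def)

lemma raise_lower_index: "\<alpha> k > 0 \<Longrightarrow> raise_index k (lower_index k \<alpha>) = \<alpha>"
  by (auto simp: raise_index_def lower_index_def)

lemma raise_index_in [simp]:
  assumes "k \<le> n+1"
  shows "raise_index k \<alpha> \<in> multi_indices n (Suc d) \<longleftrightarrow> \<alpha> \<in> multi_indices n d"
proof -
  have "(\<Sum>i\<le>n+1. raise_index k \<alpha> i) = Suc (\<Sum>i\<le>n+1. \<alpha> i)"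
    using assms by (subst (1 2) sum.remove[of _ k]) (auto simp: raise_index_def intro!: sum.cong)
  moreover have "(\<forall>i>n+1. raise_index k \<alpha> i = 0) \<longleftrightarrow> (\<forall>i>n+1. \<alpha> i = 0)"
    using assms by (auto simp: raise_index_def)
  ultimately show ?thesis by (simp add: multi_indices_def)
qed

lemma lower_index_in:
  assumes "\<alpha> \<in> multi_indices n (Suc d)" "\<alpha> k > 0"
  shows "lower_index k \<alpha> \<in> multi_indices n d"
proof -
  have "k \<le> n+1"
    using assms by (fastforce simp: multi_indices_def intro: leI)
  then show ?thesis
    using assms raise_lower_index[of \<alpha> k] raise_index_in[of k n "lower_index k \<alpha>" d] by simp
qed

lemma monomial_raise: "k \<le> n+1 \<Longrightarrow> monomial n f (raise_index k \<alpha>) = f k * monomial n f \<alpha>"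
  unfolding monomial_def
  by (subst (1 2) prod.remove[of _ k]) (auto simp: raise_index_def ac_simps intro!: prod.cong)

text \<open>\<open>form_partial n d A f k\<close> is \<open>\<partial>F / \<partial>X\<^sub>k\<close> at \<open>f\<close>, for the form \<open>F\<close> with coefficients \<open>A\<close>.\<close>

definition form_partial ::
    "nat \<Rightarrow> nat \<Rightarrow> ((nat \<Rightarrow> nat) \<Rightarrow> complex) \<Rightarrow> (nat \<Rightarrow> complex fps) \<Rightarrow> nat \<Rightarrow> complex fps" where
  "form_partial n d A f k =
    (\<Sum>\<alpha>\<in>multi_indices n d. fps_const (A \<alpha>) * (of_nat (\<alpha> k) * monomial n f (lower_index k \<alpha>)))"

lemma euler_identity:
  "(\<Sum>k\<le>n+1. f k * form_partial n d A f k) = of_nat d * form_series n d A f"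
proof -
  have *: "(\<Sum>k\<le>n+1. f k * (of_nat (\<alpha> k) * monomial n f (lower_index k \<alpha>))) = of_nat d * monomial n f \<alpha>"
    if "\<alpha> \<in> multi_indices n d" for \<alpha>
  proof -
    have "f k * (of_nat (\<alpha> k) * monomial n f (lower_index k \<alpha>)) = of_nat (\<alpha> k) * monomial n f \<alpha>" if "k \<le> n+1" for k
    proof (cases "\<alpha> k = 0")
      case False
      with monomial_raise[OF that, of f "lower_index k \<alpha>"] show ?thesis
        by (simp add: raise_lower_index ac_simps)
    qed simp
    then have "(\<Sum>k\<le>n+1. f k * (of_nat (\<alpha> k) * monomial n f (lower_index k \<alpha>))) =
        (\<Sum>k\<le>n+1. of_nat (\<alpha> k) * monomial n f \<alpha>)"
      by (intro sum.cong) auto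
    also have "\<dots> = of_nat (\<Sum>k\<le>n+1. \<alpha> k) * monomial n f \<alpha>"
      by (simp only: sum_distrib_right of_nat_sum)
    finally show ?thesis using that by (simp add: multi_indices_def del: of_nat_sum sum.atMost_Suc)
  qed
  have "(\<Sum>k\<le>n+1. f k * form_partial n d A f k) =
      (\<Sum>\<alpha>\<in>multi_indices n d. fps_const (A \<alpha>) * (\<Sum>k\<le>n+1. f k * (of_nat (\<alpha> k) * monomial n f (lower_index k \<alpha>))))"
    unfolding form_partial_def sum_distrib_left by (subst sum.swap) (simp add: ac_simps)
  also have "\<dots> = of_nat d * form_series n d A f"
    unfolding form_series_monomial sum_distrib_left[of "of_nat d"]
    by (intro sum.cong refl) (simp only: * mult.left_commute[of "of_nat d"])
  finally show ?thesis .
qed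

lemma has_coeff_deriv_monomial:
  assumes "\<And>k. k \<le> n+1 \<Longrightarrow> has_coeff_deriv (G k) (D k)"
  shows "has_coeff_deriv (\<lambda>s. monomial n (\<lambda>k. G k s) \<alpha>)
    (\<Sum>k\<le>n+1. D k * (of_nat (\<alpha> k) * monomial n (\<lambda>k. G k 0) (lower_index k \<alpha>)))"
proof -
  have "has_coeff_deriv (\<lambda>s. monomial n (\<lambda>k. G k s) \<alpha>)
      (\<Sum>k\<le>n+1. (of_nat (\<alpha> k) * (G k 0 ^ (\<alpha> k - 1) * D k)) * (\<Prod>i\<in>{..n+1}-{k}. G i 0 ^ \<alpha> i))"
    unfolding monomial_def by (intro has_coeff_deriv_prod has_coeff_deriv_power assms) auto
  also have "(\<Sum>k\<le>n+1. (of_nat (\<alpha> k) * (G k 0 ^ (\<alpha> k - 1) * D k)) * (\<Prod>i\<in>{..n+1}-{k}. G i 0 ^ \<alpha> i)) =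
      (\<Sum>k\<le>n+1. D k * (of_nat (\<alpha> k) * monomial n (\<lambda>k. G k 0) (lower_index k \<alpha>)))"
  proof (rule sum.cong[OF refl])
    fix k assume k: "k \<in> {..n+1}"
    have "monomial n (\<lambda>k. G k 0) (lower_index k \<alpha>) = G k 0 ^ (\<alpha> k - 1) * (\<Prod>i\<in>{..n+1}-{k}. G i 0 ^ \<alpha> i)"
      unfolding monomial_def using k
      by (subst prod.remove[of _ k]) (auto simp: lower_index_def intro!: prod.cong)
    then show "(of_nat (\<alpha> k) * (G k 0 ^ (\<alpha> k - 1) * D k)) * (\<Prod>i\<in>{..n+1}-{k}. G i 0 ^ \<alpha> i) =
        D k * (of_nat (\<alpha> k) * monomial n (\<lambda>k. G k 0) (lower_index k \<alpha>))"
      by (simp add: ac_simps)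
  qed
  finally show ?thesis .
qed

lemma has_coeff_deriv_form:
  "has_coeff_deriv (\<lambda>s. form_series n d (\<lambda>\<alpha>. A \<alpha> + s * B \<alpha>) (\<lambda>k. f k + fps_const s * q k))
    (form_series n d B f + (\<Sum>k\<le>n+1. q k * form_partial n d A f k))"
proof -
  have A: "has_coeff_deriv (\<lambda>s. fps_const (A \<alpha> + s * B \<alpha>)) (fps_const (B \<alpha>))" for \<alpha>
    using has_coeff_deriv_affine[of "fps_const (A \<alpha>)" "fps_const (B \<alpha>)"] by simp
  have M: "has_coeff_deriv (\<lambda>s. monomial n (\<lambda>k. f k + fps_const s * q k) \<alpha>)
      (\<Sum>k\<le>n+1. q k * (of_nat (\<alpha> k) * monomial n f (lower_index k \<alpha>)))" for \<alpha>
    using has_coeff_deriv_monomial[of n "\<lambda>k s. f k + fps_const s * q k" q \<alpha>] has_coeff_deriv_affine by simp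
  have "has_coeff_deriv (\<lambda>s. form_series n d (\<lambda>\<alpha>. A \<alpha> + s * B \<alpha>) (\<lambda>k. f k + fps_const s * q k))
     (\<Sum>\<alpha>\<in>multi_indices n d. fps_const (B \<alpha>) * monomial n (\<lambda>k. f k + fps_const 0 * q k) \<alpha> +
        fps_const (A \<alpha> + 0 * B \<alpha>) * (\<Sum>k\<le>n+1. q k * (of_nat (\<alpha> k) * monomial n f (lower_index k \<alpha>))))"
    unfolding form_series_monomial by (intro has_coeff_deriv_sum has_coeff_deriv_mult A M)
  also have "(\<Sum>\<alpha>\<in>multi_indices n d. fps_const (B \<alpha>) * monomial n (\<lambda>k. f k + fps_const 0 * q k) \<alpha> +
        fps_const (A \<alpha> + 0 * B \<alpha>) * (\<Sum>k\<le>n+1. q k * (of_nat (\<alpha> k) * monomial n f (lower_index k \<alpha>)))) =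
      form_series n d B f + (\<Sum>\<alpha>\<in>multi_indices n d. \<Sum>k\<le>n+1.
        q k * (fps_const (A \<alpha>) * (of_nat (\<alpha> k) * monomial n f (lower_index k \<alpha>))))"
    by (simp only: sum.distrib form_series_monomial fps_const_0_eq_0 mult_zero_left add_0_right
        sum_distrib_left mult.left_commute[of "fps_const _" "q _"])
  also have "(\<Sum>\<alpha>\<in>multi_indices n d. \<Sum>k\<le>n+1.
        q k * (fps_const (A \<alpha>) * (of_nat (\<alpha> k) * monomial n f (lower_index k \<alpha>)))) =
      (\<Sum>k\<le>n+1. q k * form_partial n d A f k)"
    unfolding form_partial_def sum_distrib_left by (rule sum.swap)
  finally show ?thesis .
qed

lemma monomial_cong: "(\<And>k. k \<le> n+1 \<Longrightarrow> eq_upto m (f k) (g k)) \<Longrightarrow> eq_upto m (monomial n f \<alpha>) (monomial n g \<alpha>)"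
  unfolding monomial_def by (intro eq_upto_prod eq_upto_power) auto

lemma monomial_scale: "\<alpha> \<in> multi_indices n d \<Longrightarrow> monomial n (\<lambda>k. g * f k) \<alpha> = g ^ d * monomial n f \<alpha>"
  unfolding monomial_def power_mult_distrib prod.distrib
  by (simp add: power_sum[symmetric] multi_indices_def del: prod.atMost_Suc sum.atMost_Suc)

lemma form_series_scale: "form_series n d A (\<lambda>k. g * f k) = g ^ d * form_series n d A f"
  unfolding form_series_monomial sum_distrib_left
  by (intro sum.cong refl) (simp add: monomial_scale ac_simps)


section \<open>Changes of charts and tangent spaces\<close>

lemma chart_change_Zc:
  assumes "x (Zc j 0) \<noteq> 0" "k \<le> n+1" "l \<le> n"
  shows "chart_change n d j \<gamma> x (Zc k l) = fact l * fps_nth (jet_series n x k * inverse (jet_series n x j)) l"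
proof -
  have nz: "fps_nth (jet_series n x j) 0 \<noteq> 0"
    using assms by (simp add: jet_series_nth)
  have "(\<lambda>t. (\<Sum>l\<le>n. x (Zc k l) * t ^ l / fact l) / (\<Sum>l\<le>n. x (Zc j l) * t ^ l / fact l))
      has_fps_expansion jet_series n x k / jet_series n x j"
    by (intro has_fps_expansion_divide' has_fps_expansion_jet_polynomial nz)
  from deriv_has_fps_expansion[OF this] show ?thesis
    using assms nz by (simp add: chart_change_def disc_of_def fps_divide_unit)
qed

lemma chart_change_Ac:
  "chart_change n d j \<gamma> x (Ac \<alpha>) = (if \<alpha> \<in> multi_indices n d then x (Ac \<alpha>) / x (Ac \<gamma>) else 0)"
  by (simp add: chart_change_def disc_of_def)

lemma chart_change_outside: "c \<notin> jet_coords n d \<Longrightarrow> chart_change n d j \<gamma> x c = 0"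
  by (cases c) (auto simp: chart_change_def disc_of_def)

lemma jet_series_chart_change:
  assumes "x (Zc j 0) \<noteq> 0" "k \<le> n+1"
  shows "eq_upto n (jet_series n x j * jet_series n (chart_change n d j \<gamma> x) k) (jet_series n x k)"
proof -
  have nz: "fps_nth (jet_series n x j) 0 \<noteq> 0"
    using assms by (simp add: jet_series_nth)
  have "eq_upto n (jet_series n (chart_change n d j \<gamma> x) k) (jet_series n x k * inverse (jet_series n x j))"
    using assms by (simp add: eq_upto_def jet_series_nth[of n "chart_change n d j \<gamma> x"] chart_change_Zc)
  from eq_upto_mult[OF eq_upto_refl this] 
  have "eq_upto n (jet_series n x j * jet_series n (chart_change n d j \<gamma> x) k)
      (jet_series n x j * (jet_series n x k * inverse (jet_series n x j)))" .
  also have "jet_series n x j * (jet_series n x k * inverse (jet_series n x j)) = jet_series n x k"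
    using inverse_mult_eq_1'[OF nz] by (simp add: mult.left_commute)
  finally show ?thesis .
qed

lemma chart_change_Zc_0:
  assumes "x (Zc j 0) \<noteq> 0" "k \<le> n+1"
  shows "chart_change n d j \<gamma> x (Zc k 0) = x (Zc k 0) / x (Zc j 0)"
  using chart_change_Zc[of x j k n 0, OF assms] by (simp add: jet_series_nth divide_inverse)

lemma jet_series_affine:
  "jet_series n (\<lambda>b. x b + s * v b) k = jet_series n x k + fps_const s * jet_series n v k"
  by (rule fps_ext) (simp add: jet_series_nth add_divide_distrib)

lemma chart_change_differential_Zc:
  fixes x v :: "coord \<Rightarrow> complex"
  assumes "x (Zc j 0) \<noteq> 0" "k \<le> n+1" "l \<le> n"
  defines "f \<equiv> jet_series n x" and "q \<equiv> jet_series n v"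
  shows "chart_change_differential n d j \<gamma> x v (Zc k l) =
    fact l * fps_nth ((q k * f j - f k * q j) * inverse (f j) * inverse (f j)) l"
proof -
  let ?G = "\<lambda>k s. f k + fps_const s * q k"
  let ?D = "(q k * f j - f k * q j) * inverse (f j) * inverse (f j)"
  have nz: "fps_nth (f j) 0 \<noteq> 0"
    using assms by (simp add: f_def jet_series_nth)
  have "has_coeff_deriv (\<lambda>s. ?G k s * inverse (?G j s))
      (q k * inverse (?G j 0) + ?G k 0 * (- q j * inverse (?G j 0) * inverse (?G j 0)))"
    by (intro has_coeff_deriv_mult has_coeff_deriv_inverse has_coeff_deriv_affine) (use nz in simp)
  also have "q k * inverse (?G j 0) + ?G k 0 * (- q j * inverse (?G j 0) * inverse (?G j 0)) = ?D"
  proof -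
    have "?D = q k * (f j * inverse (f j)) * inverse (f j) - f k * q j * inverse (f j) * inverse (f j)"
      by (simp add: algebra_simps)
    then show ?thesis using inverse_mult_eq_1'[OF nz] by (simp add: algebra_simps)
  qed
  finally have D: "((\<lambda>s. fps_nth (?G k s * inverse (?G j s)) l) has_field_derivative fps_nth ?D l) (at 0)"
    by (simp add: has_coeff_deriv_def)
  have "isCont (\<lambda>s. x (Zc j 0) + s * v (Zc j 0)) 0"
    by (intro continuous_intros)
  then have "eventually (\<lambda>s. x (Zc j 0) + s * v (Zc j 0) \<noteq> 0) (nhds 0)"
    using tendsto_imp_eventually_ne[OF isContD, of 0 "\<lambda>s. x (Zc j 0) + s * v (Zc j 0)" 0] assms(1)
    by (simp add: eventually_nhds_conv_at)
  then have "eventually (\<lambda>s. chart_change n d j \<gamma> (\<lambda>b. x b + s * v b) (Zc k l) =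
      fact l * fps_nth (?G k s * inverse (?G j s)) l) (nhds 0)"
    by eventually_elim (subst chart_change_Zc, simp, rule assms(2), rule assms(3),
        simp only: jet_series_affine f_def q_def)
  then have "((\<lambda>s. chart_change n d j \<gamma> (\<lambda>b. x b + s * v b) (Zc k l)) has_field_derivative
      fact l * fps_nth ?D l) (at 0)"
    by (rule DERIV_cong_ev[OF refl _ refl, THEN iffD2]) (rule DERIV_cmult[OF D])
  then show ?thesis
    unfolding chart_change_differential_def by (rule DERIV_imp_deriv)
qed

lemma chart_change_differential_Ac:
  assumes "x (Ac \<gamma>) \<noteq> 0" "\<alpha> \<in> multi_indices n d"
  shows "chart_change_differential n d j \<gamma> x v (Ac \<alpha>) =
    (v (Ac \<alpha>) * x (Ac \<gamma>) - x (Ac \<alpha>) * v (Ac \<gamma>)) / (x (Ac \<gamma>) * x (Ac \<gamma>))"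
proof -
  have "((\<lambda>s. (x (Ac \<alpha>) + s * v (Ac \<alpha>)) / (x (Ac \<gamma>) + s * v (Ac \<gamma>))) has_field_derivative
      (v (Ac \<alpha>) * x (Ac \<gamma>) - x (Ac \<alpha>) * v (Ac \<gamma>)) / (x (Ac \<gamma>) * x (Ac \<gamma>))) (at 0)"
    using assms(1) by (auto intro!: derivative_eq_intros)
  then show ?thesis
    unfolding chart_change_differential_def using assms(2) by (simp add: chart_change_Ac DERIV_imp_deriv)
qed

lemma chart_change_differential_outside:
  "c \<notin> jet_coords n d \<Longrightarrow> chart_change_differential n d j \<gamma> x v c = 0"
  by (simp add: chart_change_differential_def chart_change_outside)

lemma affine_jets_form:
  assumes "x \<in> affine_jets n d i \<beta>"
  shows "eq_upto n (form_series n d (\<lambda>\<alpha>. x (Ac \<alpha>)) (jet_series n x)) 0"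
  using assms by (auto simp: affine_jets_def eq_upto_def jet_equation_eq)

lemma affine_jets_series:
  assumes "x \<in> affine_jets n d i \<beta>"
  shows "jet_series n x i = 1"
  using assms by (intro fps_ext) (auto simp: affine_jets_def jet_series_nth)

lemma affine_jets_Ac: "x \<in> affine_jets n d i \<beta> \<Longrightarrow> x (Ac \<beta>) = 1"
  by (simp add: affine_jets_def)

lemma affine_jets_Zc: "x \<in> affine_jets n d i \<beta> \<Longrightarrow> x (Zc i 0) = 1"
  by (simp add: affine_jets_def)

lemma free_coords_subset: "free_coords n d i \<beta> \<subseteq> jet_coords n d"
  by (auto simp: free_coords_def)

lemma Zc_in_free_coords: "Zc k l \<in> free_coords n d i \<beta> \<longleftrightarrow> k \<le> n+1 \<and> l \<le> n \<and> k \<noteq> i"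
  by (auto simp: free_coords_def)

lemma Ac_in_free_coords: "Ac \<alpha> \<in> free_coords n d i \<beta> \<longleftrightarrow> \<alpha> \<in> multi_indices n d \<and> \<alpha> \<noteq> \<beta>"
  by (auto simp: free_coords_def)

lemma jet_equation_derivative:
  assumes "\<And>c. c \<notin> free_coords n d i \<beta> \<Longrightarrow> v c = 0" "\<kappa> \<le> n"
  shows "(\<Sum>c\<in>free_coords n d i \<beta>. partial_deriv c (jet_equation n d \<kappa>) x * v c) =
    fact \<kappa> * fps_nth (form_series n d (\<lambda>\<alpha>. v (Ac \<alpha>)) (jet_series n x) +
      (\<Sum>k\<le>n+1. jet_series n v k * form_partial n d (\<lambda>\<alpha>. x (Ac \<alpha>)) (jet_series n x) k)) \<kappa>"
    (is "?l = fact \<kappa> * fps_nth ?D \<kappa>")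
proof -
  have "((\<lambda>s. jet_equation n d \<kappa> (\<lambda>b. x b + s * v b)) has_field_derivative
      (\<Sum>c\<in>jet_coords n d. partial_deriv c (jet_equation n d \<kappa>) (\<lambda>b. x b + 0 * v b) * v c)) (at 0)"
    by (rule polynomial_functions_chain_rule[OF finite_jet_coords polynomial_functions_jet_equation])
      (auto intro!: derivative_eq_intros)
  moreover have "((\<lambda>s. jet_equation n d \<kappa> (\<lambda>b. x b + s * v b)) has_field_derivative fact \<kappa> * fps_nth ?D \<kappa>) (at 0)"
    unfolding jet_equation_eq[OF assms(2)] jet_series_affine
    by (intro DERIV_cmult has_coeff_deriv_form[unfolded has_coeff_deriv_def, rule_format])
  ultimately have "(\<Sum>c\<in>jet_coords n d. partial_deriv c (jet_equation n d \<kappa>) x * v c) = fact \<kappa> * fps_nth ?D \<kappa>"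
    using DERIV_unique by fastforce
  moreover have "(\<Sum>c\<in>jet_coords n d. partial_deriv c (jet_equation n d \<kappa>) x * v c) = ?l"
    by (intro sum.mono_neutral_right) (use assms(1) free_coords_subset in auto)
  ultimately show ?thesis by simp
qed

text \<open>
  By the chain rule along the lines \<open>x + s v\<close>, the equations of the tangent space are the coefficients of the
  linearised incidence equation.
\<close>

lemma tangent_space_iff:
  "v \<in> tangent_space n d i \<beta> x \<longleftrightarrow> (\<forall>c. c \<notin> free_coords n d i \<beta> \<longrightarrow> v c = 0) \<and>
    eq_upto n (form_series n d (\<lambda>\<alpha>. v (Ac \<alpha>)) (jet_series n x) +
      (\<Sum>k\<le>n+1. jet_series n v k * form_partial n d (\<lambda>\<alpha>. x (Ac \<alpha>)) (jet_series n x) k)) 0"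
  unfolding tangent_space_def mem_Collect_eq eq_upto_def
  by (intro conj_cong refl) (simp add: jet_equation_derivative)

section \<open>Sections from homogeneous vector fields\<close>

definition homogeneous_field ::
    "nat \<Rightarrow> nat \<Rightarrow> ((coord \<Rightarrow> complex) \<Rightarrow> nat \<Rightarrow> complex fps) \<Rightarrow>
      ((coord \<Rightarrow> complex) \<Rightarrow> (nat \<Rightarrow> nat) \<Rightarrow> complex) \<Rightarrow> vector_fields" where
  "homogeneous_field n d Q B j \<gamma> x c = (case c of
      Zc k l \<Rightarrow> if k \<le> n+1 \<and> l \<le> n then fact l * fps_nth (Q x k - jet_series n x k * Q x j) l else 0
    | Ac \<alpha> \<Rightarrow> if \<alpha> \<in> multi_indices n d then B x \<alpha> - x (Ac \<alpha>) * B x \<gamma> else 0)"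

lemma jet_series_homogeneous_field:
  "k \<le> n+1 \<Longrightarrow> eq_upto n (jet_series n (homogeneous_field n d Q B j \<gamma> x) k) (Q x k - jet_series n x k * Q x j)"
  by (simp add: eq_upto_def jet_series_nth[of n "homogeneous_field n d Q B j \<gamma> x"] homogeneous_field_def)

text \<open>
  The projection to the slice changes the field by a rescaling of \<open>f\<close>, which is tangent by Euler's identity, and
  by a multiple of \<open>A\<close>, which is tangent because \<open>F\<close> vanishes along the jet.
\<close>

lemma homogeneous_field_tangent:
  assumes x: "x \<in> affine_jets n d i \<beta>" and i: "i \<le> n+1" and \<beta>: "\<beta> \<in> multi_indices n d"
    and tangent: "eq_upto n (form_series n d (B x) (jet_series n x) +
        (\<Sum>k\<le>n+1. Q x k * form_partial n d (\<lambda>\<alpha>. x (Ac \<alpha>)) (jet_series n x) k)) 0"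
  shows "homogeneous_field n d Q B i \<beta> x \<in> tangent_space n d i \<beta> x"
proof -
  let ?v = "homogeneous_field n d Q B i \<beta> x"
  let ?f = "jet_series n x"
  let ?F = "form_series n d (\<lambda>\<alpha>. x (Ac \<alpha>)) ?f"
  let ?P = "form_partial n d (\<lambda>\<alpha>. x (Ac \<alpha>)) ?f"
  have outside: "?v c = 0" if "c \<notin> free_coords n d i \<beta>" for c
    using that affine_jets_series[OF x] affine_jets_Ac[OF x]
    by (cases c) (auto simp: homogeneous_field_def Zc_in_free_coords Ac_in_free_coords)
  have A: "form_series n d (\<lambda>\<alpha>. ?v (Ac \<alpha>)) ?f = form_series n d (B x) ?f - fps_const (B x \<beta>) * ?F"
    unfolding form_series_def sum_distrib_left sum_subtractf[symmetric]
    by (intro sum.cong refl)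
      (simp add: homogeneous_field_def algebra_simps fps_const_sub[symmetric] fps_const_mult[symmetric] del: fps_const_sub fps_const_mult)
  have Zeq: "eq_upto n (\<Sum>k\<le>n+1. jet_series n ?v k * ?P k) (\<Sum>k\<le>n+1. (Q x k - ?f k * Q x i) * ?P k)"
    by (intro eq_upto_sum eq_upto_mult jet_series_homogeneous_field) auto
  have Z: "(\<Sum>k\<le>n+1. (Q x k - ?f k * Q x i) * ?P k) = (\<Sum>k\<le>n+1. Q x k * ?P k) - Q x i * (of_nat d * ?F)"
    unfolding euler_identity[symmetric] sum_distrib_left sum_subtractf[symmetric]
    by (intro sum.cong refl) (simp add: algebra_simps)
  have "eq_upto n (form_series n d (\<lambda>\<alpha>. ?v (Ac \<alpha>)) ?f + (\<Sum>k\<le>n+1. jet_series n ?v k * ?P k))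
      (form_series n d (\<lambda>\<alpha>. ?v (Ac \<alpha>)) ?f + (\<Sum>k\<le>n+1. (Q x k - ?f k * Q x i) * ?P k))"
    by (intro eq_upto_add eq_upto_refl Zeq)
  also have "form_series n d (\<lambda>\<alpha>. ?v (Ac \<alpha>)) ?f + (\<Sum>k\<le>n+1. (Q x k - ?f k * Q x i) * ?P k) =
      (form_series n d (B x) ?f + (\<Sum>k\<le>n+1. Q x k * ?P k)) - (fps_const (B x \<beta>) + Q x i * of_nat d) * ?F"
    unfolding A Z by (simp add: algebra_simps)
  also have "eq_upto n \<dots> (0 - (fps_const (B x \<beta>) + Q x i * of_nat d) * 0)"
    by (intro eq_upto_diff eq_upto_mult eq_upto_refl tangent affine_jets_form[OF x])
  finally show ?thesis
    unfolding tangent_space_iff using outside by simp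
qed

lemma homogeneous_field_transition:
  assumes x: "x \<in> affine_jets n d i \<beta>" and i: "i \<le> n+1" and \<beta>: "\<beta> \<in> multi_indices n d"
    and j: "j \<le> n+1" and \<gamma>: "\<gamma> \<in> multi_indices n d"
    and xj: "x (Zc j 0) \<noteq> 0" and x\<gamma>: "x (Ac \<gamma>) \<noteq> 0"
    and hQ: "\<And>k. k \<le> n+1 \<Longrightarrow> eq_upto n (fps_const \<sigma> * (jet_series n x j * Q (chart_change n d j \<gamma> x) k)) (Q x k)"
    and hB: "\<And>\<alpha>. \<alpha> \<in> multi_indices n d \<Longrightarrow> \<sigma> * x (Ac \<gamma>) * B (chart_change n d j \<gamma> x) \<alpha> = B x \<alpha>"
  shows "\<sigma> * homogeneous_field n d Q B j \<gamma> (chart_change n d j \<gamma> x) c =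
    chart_change_differential n d j \<gamma> x (homogeneous_field n d Q B i \<beta> x) c"
proof (cases "c \<in> jet_coords n d")
  case False
  then show ?thesis
    by (cases c) (auto simp: homogeneous_field_def chart_change_differential_outside)
next
  case True
  let ?y = "chart_change n d j \<gamma> x"
  let ?v = "homogeneous_field n d Q B i \<beta> x"
  let ?f = "jet_series n x" and ?g = "jet_series n ?y" and ?q = "jet_series n ?v"
  show ?thesis
  proof (cases c)
    case (Ac \<alpha>)
    with True have \<alpha>: "\<alpha> \<in> multi_indices n d" by simp
    have "\<sigma> * homogeneous_field n d Q B j \<gamma> ?y c =
        (\<sigma> * x (Ac \<gamma>) * B ?y \<alpha> * x (Ac \<gamma>) - x (Ac \<alpha>) * (\<sigma> * x (Ac \<gamma>) * B ?y \<gamma>)) / (x (Ac \<gamma>) * x (Ac \<gamma>))"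
      using \<alpha> x\<gamma> by (simp add: Ac homogeneous_field_def chart_change_Ac field_simps)
    also have "\<dots> = (B x \<alpha> * x (Ac \<gamma>) - x (Ac \<alpha>) * B x \<gamma>) / (x (Ac \<gamma>) * x (Ac \<gamma>))"
      by (simp only: hB[OF \<alpha>] hB[OF \<gamma>])
    also have "\<dots> = chart_change_differential n d j \<gamma> x ?v c"
      unfolding Ac chart_change_differential_Ac[of x \<gamma>, OF x\<gamma> \<alpha>]
      using \<alpha> \<gamma> by (simp add: homogeneous_field_def algebra_simps)
    finally show ?thesis .
  next
    case (Zc k l)
    with True have k: "k \<le> n+1" and l: "l \<le> n" by auto
    have nz: "fps_nth (?f j) 0 \<noteq> 0"
      using xj by (simp add: jet_series_nth)
    note g = jet_series_chart_change[of x j _ n d \<gamma>, OF xj]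
    let ?R = "(?q k * ?f j - ?f k * ?q j) * inverse (?f j) * inverse (?f j)"
    have "eq_upto n (?f j * ?f j * (fps_const \<sigma> * (Q ?y k - ?g k * Q ?y j)))
        (?f j * (fps_const \<sigma> * (?f j * Q ?y k)) - (?f j * ?g k) * (fps_const \<sigma> * (?f j * Q ?y j)))"
      by (simp add: algebra_simps)
    also have "eq_upto n \<dots> (?f j * Q x k - ?f k * Q x j)"
      by (intro eq_upto_diff eq_upto_mult eq_upto_refl hQ g k j)
    also have "?f j * Q x k - ?f k * Q x j = (Q x k - ?f k * Q x i) * ?f j - ?f k * (Q x j - ?f j * Q x i)"
      by (simp add: algebra_simps)
    also have "eq_upto n \<dots> (?q k * ?f j - ?f k * ?q j)"
      by (intro eq_upto_diff eq_upto_mult eq_upto_refl eq_upto_sym[OF jet_series_homogeneous_field] k j)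
    also have "?q k * ?f j - ?f k * ?q j = ?f j * ?f j * ?R"
    proof -
      have "?f j * ?f j * ?R = (?q k * ?f j - ?f k * ?q j) * (?f j * inverse (?f j)) * (?f j * inverse (?f j))"
        by (simp only: ac_simps)
      then show ?thesis using inverse_mult_eq_1'[OF nz] by simp
    qed
    finally have "eq_upto n (fps_const \<sigma> * (Q ?y k - ?g k * Q ?y j)) ?R"
      by (rule eq_upto_cancel_left) (use nz in simp)
    then show ?thesis
      unfolding Zc chart_change_differential_Zc[of x j, OF xj k l]
      using k l by (simp add: eq_upto_def homogeneous_field_def)
  qed
qed

text \<open>
  A vector field on the space of homogeneous jets \<open>(Z, A)\<close> that has the right weights under
  \<open>(Z, A) \<mapsto> (\<lambda>(t) Z, \<mu> A)\<close> descends; its expression in a chart is its projection to the slice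
  along the orbits of these rescalings.
\<close>

lemma homogeneous_field_section:
  assumes polyQ: "\<And>k l. k \<le> n+1 \<Longrightarrow> l \<le> n \<Longrightarrow> (\<lambda>x. fps_nth (Q x k) l) \<in> polynomial_functions (jet_coords n d)"
    and polyB: "\<And>\<alpha>. \<alpha> \<in> multi_indices n d \<Longrightarrow> (\<lambda>x. B x \<alpha>) \<in> polynomial_functions (jet_coords n d)"
    and tangent: "\<And>x. eq_upto n (form_series n d (\<lambda>\<alpha>. x (Ac \<alpha>)) (jet_series n x)) 0 \<Longrightarrow>
      eq_upto n (form_series n d (B x) (jet_series n x) +
        (\<Sum>k\<le>n+1. Q x k * form_partial n d (\<lambda>\<alpha>. x (Ac \<alpha>)) (jet_series n x) k)) 0"
    and hQ: "\<And>x j \<gamma> k. \<lbrakk>j \<le> n+1; \<gamma> \<in> multi_indices n d; x (Zc j 0) \<noteq> 0; x (Ac \<gamma>) \<noteq> 0; k \<le> n+1\<rbrakk> \<Longrightarrow>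
      eq_upto n (fps_const (x (Zc j 0) ^ m * x (Ac \<gamma>) ^ e) *
        (jet_series n x j * Q (chart_change n d j \<gamma> x) k)) (Q x k)"
    and hB: "\<And>x j \<gamma> \<alpha>. \<lbrakk>j \<le> n+1; \<gamma> \<in> multi_indices n d; x (Zc j 0) \<noteq> 0; x (Ac \<gamma>) \<noteq> 0; \<alpha> \<in> multi_indices n d\<rbrakk> \<Longrightarrow>
      x (Zc j 0) ^ m * x (Ac \<gamma>) ^ e * x (Ac \<gamma>) * B (chart_change n d j \<gamma> x) \<alpha> = B x \<alpha>"
  shows "homogeneous_field n d Q B \<in> twisted_sections n d m e"
proof -
  have poly: "(\<lambda>x. homogeneous_field n d Q B i \<beta> x c) \<in> polynomial_functions (jet_coords n d)"
    if i: "i \<le> n+1" and \<beta>: "\<beta> \<in> multi_indices n d" for i \<beta> c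
  proof (cases c)
    case (Ac \<alpha>)
    then show ?thesis
      using \<beta> by (cases "\<alpha> \<in> multi_indices n d")
        (auto simp: homogeneous_field_def intro!: polynomial_functions_diff polyB polynomial_functions.mult
          polynomial_functions.coord polynomial_functions.const)
  next
    case (Zc k l)
    have "(\<lambda>x. fact l * (fps_nth (Q x k) l - (\<Sum>r=0..l. (1 / fact r * x (Zc k r)) * fps_nth (Q x i) (l - r))))
        \<in> polynomial_functions (jet_coords n d)" if kl: "k \<le> n+1" "l \<le> n"
      by (intro polynomial_functions_diff polyQ polynomial_functions.mult polynomial_functions_sum
          polynomial_functions.coord polynomial_functions.const) (use kl i in auto)
    moreover have "fps_nth (jet_series n x k * Q x i) l =
        (\<Sum>r=0..l. (1 / fact r * x (Zc k r)) * fps_nth (Q x i) (l - r))" if "l \<le> n" for x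
      unfolding fps_mult_nth using that by (intro sum.cong) (auto simp: jet_series_nth)
    ultimately show ?thesis
      by (cases "k \<le> n+1 \<and> l \<le> n") (auto simp: Zc homogeneous_field_def intro: polynomial_functions.const)
  qed
  show ?thesis
    unfolding twisted_sections_def mem_Collect_eq
  proof (intro conjI allI ballI impI poly homogeneous_field_tangent tangent)
    fix i \<beta> x assume "x \<in> affine_jets n d i \<beta>"
    then show "eq_upto n (form_series n d (\<lambda>\<alpha>. x (Ac \<alpha>)) (jet_series n x)) 0"
      by (rule affine_jets_form)
  next
    fix i \<beta> j \<gamma> x c
    assume "i \<le> n+1" "\<beta> \<in> multi_indices n d" "j \<le> n+1" "\<gamma> \<in> multi_indices n d"
      "x \<in> affine_jets n d i \<beta>" "x (Zc j 0) \<noteq> 0 \<and> x (Ac \<gamma>) \<noteq> 0"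
    then show "x (Zc j 0) ^ m * x (Ac \<gamma>) ^ e * homogeneous_field n d Q B j \<gamma> (chart_change n d j \<gamma> x) c =
        chart_change_differential n d j \<gamma> x (homogeneous_field n d Q B i \<beta> x) c"
      by (intro homogeneous_field_transition hQ hB) auto
  qed auto
qed


section \<open>Sections from the general linear group\<close>

text \<open>
  The infinitesimal substitution \<open>Z\<^sub>a \<mapsto> Z\<^sub>a + \<epsilon> Z\<^sub>b\<close> preserves incidence if the form \<open>F\<close> moves by
  \<open>- X\<^sub>b \<partial>F / \<partial>X\<^sub>a\<close>; its coefficients are collected here from the monomials of \<open>F\<close>.
\<close>

definition gl_coeff ::
    "nat \<Rightarrow> nat \<Rightarrow> nat \<Rightarrow> nat \<Rightarrow> (coord \<Rightarrow> complex) \<Rightarrow> (nat \<Rightarrow> nat) \<Rightarrow> complex" where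
  "gl_coeff n d a b x \<alpha> = - (\<Sum>\<beta>\<in>multi_indices n d.
     if \<beta> a > 0 \<and> raise_index b (lower_index a \<beta>) = \<alpha> then of_nat (\<beta> a) * x (Ac \<beta>) else 0)"

lemma raise_lower_in:
  assumes "\<alpha> \<in> multi_indices n d" "\<alpha> a > 0" "b \<le> n+1"
  shows "raise_index b (lower_index a \<alpha>) \<in> multi_indices n d"
proof (cases d)
  case 0
  have "a \<le> n+1"
    using assms by (fastforce simp: multi_indices_def intro: leI)
  then have "\<alpha> a \<le> (\<Sum>k\<le>n+1. \<alpha> k)"
    by (intro member_le_sum) auto
  then show ?thesis using assms 0 by (simp add: multi_indices_def)
next
  case (Suc d')
  then show ?thesis using assms lower_index_in[of \<alpha> n d' a] by simp
qed

lemma form_series_gl_coeff: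
  assumes b: "b \<le> n+1"
  shows "form_series n d (gl_coeff n d a b x) f = - (f b * form_partial n d (\<lambda>\<alpha>. x (Ac \<alpha>)) f a)"
proof -
  let ?M = "multi_indices n d"
  let ?s = "\<lambda>\<beta>. raise_index b (lower_index a \<beta>)"
  have "form_series n d (gl_coeff n d a b x) f =
      - (\<Sum>\<alpha>\<in>?M. \<Sum>\<beta>\<in>?M. (if \<beta> a > 0 \<and> ?s \<beta> = \<alpha> then fps_const (of_nat (\<beta> a) * x (Ac \<beta>)) * monomial n f \<alpha> else 0))"
    unfolding form_series_monomial
  proof (subst sum_negf[symmetric], rule sum.cong[OF refl])
    fix \<alpha> assume "\<alpha> \<in> ?M"
    have "fps_const (\<Sum>\<beta>\<in>?M. h \<beta>) = (\<Sum>\<beta>\<in>?M. fps_const (h \<beta>))" for h :: "_ \<Rightarrow> complex"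
      by (rule fps_ext) (simp add: fps_sum_nth)
    then have "fps_const (gl_coeff n d a b x \<alpha>) = - (\<Sum>\<beta>\<in>?M. fps_const
        (if \<beta> a > 0 \<and> ?s \<beta> = \<alpha> then of_nat (\<beta> a) * x (Ac \<beta>) else 0))"
      unfolding gl_coeff_def fps_const_neg[symmetric] by simp
    then show "fps_const (gl_coeff n d a b x \<alpha>) * monomial n f \<alpha> =
        - (\<Sum>\<beta>\<in>?M. if \<beta> a > 0 \<and> ?s \<beta> = \<alpha> then fps_const (of_nat (\<beta> a) * x (Ac \<beta>)) * monomial n f \<alpha> else 0)"
      by (simp add: sum_distrib_right if_distrib[of fps_const] if_distrib[of "\<lambda>u. u * _"] cong: if_cong)
  qed
  also have "\<dots> = - (\<Sum>\<beta>\<in>?M. \<Sum>\<alpha>\<in>?M. (if \<beta> a > 0 \<and> ?s \<beta> = \<alpha> then fps_const (of_nat (\<beta> a) * x (Ac \<beta>)) * monomial n f \<alpha> else 0))"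
    by (subst sum.swap) simp
  also have "\<dots> = - (\<Sum>\<beta>\<in>?M. f b * (fps_const (x (Ac \<beta>)) * (of_nat (\<beta> a) * monomial n f (lower_index a \<beta>))))"
  proof (rule arg_cong[of _ _ uminus], rule sum.cong[OF refl])
    fix \<beta> assume \<beta>: "\<beta> \<in> ?M"
    show "(\<Sum>\<alpha>\<in>?M. (if \<beta> a > 0 \<and> ?s \<beta> = \<alpha> then fps_const (of_nat (\<beta> a) * x (Ac \<beta>)) * monomial n f \<alpha> else 0)) =
        f b * (fps_const (x (Ac \<beta>)) * (of_nat (\<beta> a) * monomial n f (lower_index a \<beta>)))"
    proof (cases "\<beta> a > 0")
      case True
      have "(\<Sum>\<alpha>\<in>?M. (if \<beta> a > 0 \<and> ?s \<beta> = \<alpha> then fps_const (of_nat (\<beta> a) * x (Ac \<beta>)) * monomial n f \<alpha> else 0)) =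
          (\<Sum>\<alpha>\<in>?M. (if ?s \<beta> = \<alpha> then fps_const (of_nat (\<beta> a) * x (Ac \<beta>)) * monomial n f \<alpha> else 0))"
        using True by simp
      also have "\<dots> = fps_const (of_nat (\<beta> a) * x (Ac \<beta>)) * monomial n f (?s \<beta>)"
        using raise_lower_in[OF \<beta> True b] by (subst sum.delta') auto
      also have "\<dots> = f b * (fps_const (x (Ac \<beta>)) * (of_nat (\<beta> a) * monomial n f (lower_index a \<beta>)))"
        by (simp add: monomial_raise[OF b] fps_const_mult[symmetric] fps_of_nat ac_simps del: fps_const_mult)
      finally show ?thesis .
    qed simp
  qed
  finally show ?thesis
    by (simp add: form_partial_def sum_distrib_left)
qed

definition gl_section ::
    "nat \<Rightarrow> nat \<Rightarrow> nat \<Rightarrow> nat \<Rightarrow> (nat \<Rightarrow> nat) \<Rightarrow> nat \<Rightarrow> nat \<Rightarrow> vector_fields" where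
  "gl_section n d m i \<beta> a b = homogeneous_field n d
     (\<lambda>x k. if k = a then fps_const (x (Zc i 0) ^ m * x (Ac \<beta>)) * jet_series n x b else 0)
     (\<lambda>x \<alpha>. x (Zc i 0) ^ m * x (Ac \<beta>) * gl_coeff n d a b x \<alpha>)"

lemma form_series_cmult: "form_series n d (\<lambda>\<alpha>. c * A \<alpha>) f = fps_const c * form_series n d A f"
  unfolding form_series_def sum_distrib_left
  by (intro sum.cong refl) (simp add: fps_const_mult[symmetric] ac_simps del: fps_const_mult)

lemma polynomial_functions_jet_series:
  "k \<le> n+1 \<Longrightarrow> (\<lambda>x. fps_nth (jet_series n x k) l) \<in> polynomial_functions (jet_coords n d)"
proof (cases "l \<le> n")
  case True
  assume "k \<le> n+1"
  with True have "(\<lambda>x. 1 / fact l * x (Zc k l)) \<in> polynomial_functions (jet_coords n d)"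
    by (intro polynomial_intros) auto
  with True show ?thesis by (simp add: jet_series_nth)
qed (simp add: jet_series_nth polynomial_functions.const)

lemma gl_section_in_twisted_sections:
  assumes i: "i \<le> n+1" and \<beta>: "\<beta> \<in> multi_indices n d" and a: "a \<le> n+1" and b: "b \<le> n+1"
  shows "gl_section n d m i \<beta> a b \<in> twisted_sections n d m 1"
  unfolding gl_section_def
proof (rule homogeneous_field_section)
  fix k l
  have "(\<lambda>x. x (Zc i 0) ^ m * x (Ac \<beta>) * fps_nth (jet_series n x b) l) \<in> polynomial_functions (jet_coords n d)"
    using i \<beta> b
    by (intro polynomial_functions.mult polynomial_functions_power polynomial_functions.coord
        polynomial_functions_jet_series) auto
  then show "(\<lambda>x. fps_nth (if k = a then fps_const (x (Zc i 0) ^ m * x (Ac \<beta>)) * jet_series n x b else 0) l)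
      \<in> polynomial_functions (jet_coords n d)"
    by (cases "k = a") (auto intro: polynomial_functions.const)
next
  fix \<alpha>
  have "gl_coeff n d a b = (\<lambda>x \<alpha>. \<Sum>\<beta>\<in>multi_indices n d.
     (if \<beta> a > 0 \<and> raise_index b (lower_index a \<beta>) = \<alpha> then - of_nat (\<beta> a) else 0) * x (Ac \<beta>))"
    by (intro ext) (auto simp: gl_coeff_def sum_negf[symmetric] intro!: sum.cong)
  then show "(\<lambda>x. x (Zc i 0) ^ m * x (Ac \<beta>) * gl_coeff n d a b x \<alpha>) \<in> polynomial_functions (jet_coords n d)"
    using i \<beta>
    by (auto intro!: polynomial_functions.mult polynomial_functions_power polynomial_functions.coord
        polynomial_functions_sum polynomial_functions.const)
next
  fix x
  let ?c = "x (Zc i 0) ^ m * x (Ac \<beta>)" and ?f = "jet_series n x"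
  let ?P = "form_partial n d (\<lambda>\<alpha>. x (Ac \<alpha>)) ?f"
  have "(\<Sum>k\<le>n+1. (if k = a then fps_const ?c * ?f b else 0) * ?P k) = fps_const ?c * ?f b * ?P a"
    using a by (simp add: if_distrib[of "\<lambda>u. u * _"] cong: if_cong del: sum.atMost_Suc)
  then show "eq_upto n (form_series n d (\<lambda>\<alpha>. ?c * gl_coeff n d a b x \<alpha>) ?f +
      (\<Sum>k\<le>n+1. (if k = a then fps_const ?c * ?f b else 0) * ?P k)) 0"
    unfolding form_series_cmult form_series_gl_coeff[OF b] by (simp add: algebra_simps)
next
  fix x :: "coord \<Rightarrow> complex" and j \<gamma> k
  assume j: "j \<le> n+1" and \<gamma>: "\<gamma> \<in> multi_indices n d" and nz: "x (Zc j 0) \<noteq> 0" "x (Ac \<gamma>) \<noteq> 0"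
  let ?y = "chart_change n d j \<gamma> x"
  let ?cy = "?y (Zc i 0) ^ m * ?y (Ac \<beta>)" and ?cx = "x (Zc i 0) ^ m * x (Ac \<beta>)"
  have c: "x (Zc j 0) ^ m * x (Ac \<gamma>) ^ 1 * ?cy = ?cx"
    using nz \<beta> chart_change_Zc_0[of x j i n d \<gamma>, OF nz(1) i]
    by (simp add: chart_change_Ac power_divide)
  have "eq_upto n (fps_const ?cx * (jet_series n x j * jet_series n ?y b)) (fps_const ?cx * jet_series n x b)"
    by (intro eq_upto_mult eq_upto_refl jet_series_chart_change nz b)
  then have "eq_upto n (fps_const (x (Zc j 0) ^ m * x (Ac \<gamma>) ^ 1) * (jet_series n x j *
      (fps_const ?cy * jet_series n ?y b))) (fps_const ?cx * jet_series n x b)"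
    unfolding c[symmetric] fps_const_mult[symmetric] by (simp only: ac_simps)
  then show "eq_upto n (fps_const (x (Zc j 0) ^ m * x (Ac \<gamma>) ^ 1) * (jet_series n x j *
      (if k = a then fps_const ?cy * jet_series n ?y b else 0)))
      (if k = a then fps_const ?cx * jet_series n x b else 0)"
    by (cases "k = a") simp_all
next
  fix x :: "coord \<Rightarrow> complex" and j \<gamma> \<alpha>
  assume j: "j \<le> n+1" and \<gamma>: "\<gamma> \<in> multi_indices n d" and nz: "x (Zc j 0) \<noteq> 0" "x (Ac \<gamma>) \<noteq> 0"
  let ?y = "chart_change n d j \<gamma> x"
  let ?cy = "?y (Zc i 0) ^ m * ?y (Ac \<beta>)" and ?cx = "x (Zc i 0) ^ m * x (Ac \<beta>)"
  have c: "x (Zc j 0) ^ m * x (Ac \<gamma>) ^ 1 * ?cy = ?cx"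
    using nz \<beta> chart_change_Zc_0[of x j i n d \<gamma>, OF nz(1) i]
    by (simp add: chart_change_Ac power_divide)
  have "x (Ac \<gamma>) * gl_coeff n d a b ?y \<alpha> = gl_coeff n d a b x \<alpha>"
    unfolding gl_coeff_def mult_minus_right sum_distrib_left
    using nz by (intro arg_cong[of _ _ uminus] sum.cong) (auto simp: chart_change_Ac)
  then have "?cx * gl_coeff n d a b x \<alpha> =
      (x (Zc j 0) ^ m * x (Ac \<gamma>) ^ 1 * ?cy) * (x (Ac \<gamma>) * gl_coeff n d a b ?y \<alpha>)"
    by (simp only: c)
  then show "x (Zc j 0) ^ m * x (Ac \<gamma>) ^ 1 * x (Ac \<gamma>) * (?cy * gl_coeff n d a b ?y \<alpha>) =
      ?cx * gl_coeff n d a b x \<alpha>"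
    by (simp only: ac_simps)
qed

section \<open>Sections from quadrics through a jet\<close>

definition quadric_values :: "nat \<Rightarrow> (nat \<Rightarrow> nat) \<Rightarrow> (nat \<Rightarrow> nat) \<Rightarrow> (coord \<Rightarrow> complex) \<Rightarrow> nat \<Rightarrow> complex fps" where
  "quadric_values n p q x r = jet_series n x (p r) * jet_series n x (q r)"

text \<open>
  The coefficients of \<open>X\<^sup>\<nu>\<close> times the quadric
  \<open>det(H) X\<^sub>a X\<^sub>b - \<Sum>\<^sub>r det(H with H\<^sub>r replaced by f\<^sub>a f\<^sub>b) X\<^bsub>p r\<^esub> X\<^bsub>q r\<^esub>\<close>, where \<open>H\<^sub>r\<close> is the value
  of \<open>X\<^bsub>p r\<^esub> X\<^bsub>q r\<^esub>\<close> along the jet. By Cramer's rule it vanishes along the jet to order \<open>n\<close>. As all entries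
  are quadratic in the jet, rescaling the jet by \<open>\<lambda>(t)\<close> multiplies the coefficients by
  \<open>\<lambda>(0)\<close> to the power \<open>2(n+1)\<close>.
\<close>

definition relation_coeff ::
    "nat \<Rightarrow> (nat \<Rightarrow> nat) \<Rightarrow> (nat \<Rightarrow> nat) \<Rightarrow> nat \<Rightarrow> nat \<Rightarrow> (nat \<Rightarrow> nat) \<Rightarrow>
      (coord \<Rightarrow> complex) \<Rightarrow> (nat \<Rightarrow> nat) \<Rightarrow> complex" where
  "relation_coeff n p q a b \<nu> x \<alpha> =
    (if \<alpha> = raise_index a (raise_index b \<nu>) then jet_det n (quadric_values n p q x) else 0) -
    (\<Sum>r\<le>n. if \<alpha> = raise_index (p r) (raise_index (q r) \<nu>)
      then jet_det n ((quadric_values n p q x)(r := jet_series n x a * jet_series n x b)) else 0)"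

lemma form_series_single:
  assumes "\<mu> \<in> multi_indices n d"
  shows "form_series n d (\<lambda>\<alpha>. if \<alpha> = \<mu> then c else 0) f = fps_const c * monomial n f \<mu>"
proof -
  have "form_series n d (\<lambda>\<alpha>. if \<alpha> = \<mu> then c else 0) f =
      (\<Sum>\<alpha>\<in>multi_indices n d. if \<alpha> = \<mu> then fps_const c * monomial n f \<alpha> else 0)"
    unfolding form_series_monomial by (intro sum.cong) auto
  then show ?thesis using assms by simp
qed

lemma form_series_diff:
  "form_series n d (\<lambda>\<alpha>. A \<alpha> - B \<alpha>) f = form_series n d A f - form_series n d B f"
  unfolding form_series_def sum_subtractf[symmetric]
  by (intro sum.cong refl) (simp add: fps_const_sub[symmetric] algebra_simps del: fps_const_sub)

lemma fps_const_sum: "fps_const (\<Sum>i\<in>I. h i) = (\<Sum>i\<in>I. fps_const (h i))"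
  by (rule fps_ext) (simp add: fps_sum_nth)

lemma form_series_sum:
  "form_series n d (\<lambda>\<alpha>. \<Sum>r\<in>I. A r \<alpha>) f = (\<Sum>r\<in>I. form_series n d (A r) f)"
  unfolding form_series_def fps_const_sum sum_distrib_right by (rule sum.swap)

lemma form_series_relation_coeff:
  assumes \<nu>: "\<nu> \<in> multi_indices n d" and ab: "a \<le> n+1" "b \<le> n+1"
    and pq: "\<And>r. r \<le> n \<Longrightarrow> p r \<le> n+1" "\<And>r. r \<le> n \<Longrightarrow> q r \<le> n+1"
  shows "eq_upto n (form_series n (Suc (Suc d)) (relation_coeff n p q a b \<nu> x) (jet_series n x)) 0"
proof -
  let ?f = "jet_series n x" and ?H = "quadric_values n p q x"
  let ?det = "fps_const (jet_det n ?H) * (?f a * ?f b)"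
  let ?sum = "\<Sum>r\<le>n. fps_const (jet_det n (?H(r := ?f a * ?f b))) * ?H r"
  have "form_series n (Suc (Suc d)) (relation_coeff n p q a b \<nu> x) ?f =
      fps_const (jet_det n ?H) * monomial n ?f (raise_index a (raise_index b \<nu>)) -
      (\<Sum>r\<le>n. fps_const (jet_det n (?H(r := ?f a * ?f b))) * monomial n ?f (raise_index (p r) (raise_index (q r) \<nu>)))"
    unfolding relation_coeff_def[abs_def] form_series_diff form_series_sum using \<nu> ab pq
    by (intro arg_cong2[of _ _ _ _ "(-)"] sum.cong refl form_series_single) auto
  also have "\<dots> = monomial n ?f \<nu> * (?det - ?sum)"
    unfolding right_diff_distrib sum_distrib_left using ab pq
    by (intro arg_cong2[of _ _ _ _ "(-)"] sum.cong refl)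
      (simp_all add: monomial_raise quadric_values_def ac_simps)
  finally have "form_series n (Suc (Suc d)) (relation_coeff n p q a b \<nu> x) ?f = monomial n ?f \<nu> * (?det - ?sum)" .
  moreover have "eq_upto n (monomial n ?f \<nu> * (?det - ?sum)) (monomial n ?f \<nu> * (?det - ?det))"
    by (intro eq_upto_mult eq_upto_refl eq_upto_diff jet_cramer)
  ultimately show ?thesis by simp
qed

lemma relation_coeff_chart_change:
  assumes xj: "x (Zc j 0) \<noteq> 0" and ab: "a \<le> n+1" "b \<le> n+1"
    and pq: "\<And>r. r \<le> n \<Longrightarrow> p r \<le> n+1" "\<And>r. r \<le> n \<Longrightarrow> q r \<le> n+1"
  shows "x (Zc j 0) ^ (2 * (n+1)) * relation_coeff n p q a b \<nu> (chart_change n d j \<gamma> x) \<alpha> =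
    relation_coeff n p q a b \<nu> x \<alpha>"
proof -
  let ?y = "chart_change n d j \<gamma> x"
  let ?f = "jet_series n x" and ?g = "jet_series n ?y"
  have quad: "eq_upto n (?f k * ?f l) (?f j ^ 2 * (?g k * ?g l))" if "k \<le> n+1" "l \<le> n+1" for k l
  proof -
    have "eq_upto n ((?f j * ?g k) * (?f j * ?g l)) (?f k * ?f l)"
      by (intro eq_upto_mult jet_series_chart_change xj that)
    then show ?thesis by (rule eq_upto_sym[OF eq_upto_trans[rotated]]) (simp add: power2_eq_square ac_simps)
  qed
  have scale: "jet_det n H = x (Zc j 0) ^ (2 * (n+1)) * jet_det n H'"
    if "\<And>r. r \<le> n \<Longrightarrow> eq_upto n (H r) (?f j ^ 2 * H' r)" for H H'
  proof -
    have "jet_det n H = jet_det n (\<lambda>r. ?f j ^ 2 * H' r)"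
      by (rule jet_det_cong) (rule that)
    then show ?thesis
      by (simp add: jet_det_mult power_mult power2_eq_square jet_series_nth)
  qed
  have "jet_det n (quadric_values n p q x) = x (Zc j 0) ^ (2 * (n+1)) * jet_det n (quadric_values n p q ?y)"
    by (rule scale) (unfold quadric_values_def, intro quad pq)
  moreover have "jet_det n ((quadric_values n p q x)(r := ?f a * ?f b)) =
      x (Zc j 0) ^ (2 * (n+1)) * jet_det n ((quadric_values n p q ?y)(r := ?g a * ?g b))" for r
    by (rule scale) (use quad[OF ab] quad[OF pq] in \<open>auto simp: quadric_values_def\<close>)
  ultimately show ?thesis
    unfolding relation_coeff_def right_diff_distrib sum_distrib_left
    by (intro arg_cong2[of _ _ _ _ "(-)"] sum.cong refl) simp_all
qed

definition relation_section ::
    "nat \<Rightarrow> nat \<Rightarrow> nat \<Rightarrow> nat \<Rightarrow> (nat \<Rightarrow> nat) \<Rightarrow> (nat \<Rightarrow> nat) \<Rightarrow> (nat \<Rightarrow> nat) \<Rightarrow> nat \<Rightarrow> nat \<Rightarrow> (nat \<Rightarrow> nat) \<Rightarrow> vector_fields" where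
  "relation_section n d m i \<beta> p q a b \<nu> = homogeneous_field n d (\<lambda>_ _. 0)
     (\<lambda>x \<alpha>. x (Zc i 0) ^ (m - 2 * (n+1)) * x (Ac \<beta>) ^ 2 * relation_coeff n p q a b \<nu> x \<alpha>)"

lemma relation_section_in_twisted_sections:
  assumes i: "i \<le> n+1" and \<beta>: "\<beta> \<in> multi_indices n (Suc (Suc d))" and ab: "a \<le> n+1" "b \<le> n+1"
    and pq: "\<And>r. r \<le> n \<Longrightarrow> p r \<le> n+1" "\<And>r. r \<le> n \<Longrightarrow> q r \<le> n+1"
    and \<nu>: "\<nu> \<in> multi_indices n d" and m: "2 * (n+1) \<le> m"
  shows "relation_section n (Suc (Suc d)) m i \<beta> p q a b \<nu> \<in> twisted_sections n (Suc (Suc d)) m 1"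
  unfolding relation_section_def
proof (rule homogeneous_field_section)
  let ?P = "polynomial_functions (jet_coords n (Suc (Suc d)))"
  have quad: "(\<lambda>x. fps_nth (jet_series n x k * jet_series n x k') l) \<in> ?P" if "k \<le> n+1" "k' \<le> n+1" for k k' l
    unfolding fps_mult_nth using that
    by (intro polynomial_functions_sum polynomial_functions.mult polynomial_functions_jet_series)
  have "(\<lambda>x. jet_det n (quadric_values n p q x)) \<in> ?P"
    by (rule polynomial_functions_jet_det) (use quad[OF pq] in \<open>simp add: quadric_values_def\<close>)
  moreover have "(\<lambda>x. jet_det n ((quadric_values n p q x)(r := jet_series n x a * jet_series n x b))) \<in> ?P" for r
  proof (rule polynomial_functions_jet_det)
    fix s l assume "s \<le> n"
    then show "(\<lambda>x. fps_nth (((quadric_values n p q x)(r := jet_series n x a * jet_series n x b)) s) l) \<in> ?P"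
      using quad[OF ab] quad[OF pq] by (cases "s = r") (simp_all add: quadric_values_def)
  qed
  ultimately have "(\<lambda>x. relation_coeff n p q a b \<nu> x \<alpha>) \<in> ?P" for \<alpha>
    unfolding relation_coeff_def
    by (intro polynomial_functions_diff polynomial_functions_sum polynomial_functions_if polynomial_functions.const)
  then show "(\<lambda>x. x (Zc i 0) ^ (m - 2 * (n+1)) * x (Ac \<beta>) ^ 2 * relation_coeff n p q a b \<nu> x \<alpha>) \<in> ?P" for \<alpha>
    using i \<beta> by (intro polynomial_functions.mult polynomial_functions_power polynomial_functions.coord) auto
next
  fix x
  have "eq_upto n (fps_const (x (Zc i 0) ^ (m - 2 * (n+1)) * x (Ac \<beta>) ^ 2) *
      form_series n (Suc (Suc d)) (relation_coeff n p q a b \<nu> x) (jet_series n x))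
      (fps_const (x (Zc i 0) ^ (m - 2 * (n+1)) * x (Ac \<beta>) ^ 2) * 0)"
    by (intro eq_upto_mult eq_upto_refl form_series_relation_coeff \<nu> ab pq)
  then show "eq_upto n (form_series n (Suc (Suc d))
      (\<lambda>\<alpha>. x (Zc i 0) ^ (m - 2 * (n+1)) * x (Ac \<beta>) ^ 2 * relation_coeff n p q a b \<nu> x \<alpha>) (jet_series n x) +
      (\<Sum>k\<le>n+1. 0 * form_partial n (Suc (Suc d)) (\<lambda>\<alpha>. x (Ac \<alpha>)) (jet_series n x) k)) 0"
    by (simp add: form_series_cmult del: sum.atMost_Suc)
next
  fix x :: "coord \<Rightarrow> complex" and j \<gamma> \<alpha>
  assume nz: "x (Zc j 0) \<noteq> 0" "x (Ac \<gamma>) \<noteq> 0"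
  let ?y = "chart_change n (Suc (Suc d)) j \<gamma> x"
  let ?w = "m - 2 * (n+1)" and ?R = "relation_coeff n p q a b \<nu>"
  have yi: "x (Zc j 0) ^ ?w * ?y (Zc i 0) ^ ?w = x (Zc i 0) ^ ?w"
    using nz by (simp add: chart_change_Zc_0[of x j i n "Suc (Suc d)" \<gamma>, OF nz(1) i] power_divide)
  have y\<beta>: "x (Ac \<gamma>) ^ 2 * ?y (Ac \<beta>) ^ 2 = x (Ac \<beta>) ^ 2"
    using nz \<beta> by (simp add: chart_change_Ac power_divide)
  have R: "x (Zc j 0) ^ (2 * (n+1)) * ?R ?y \<alpha> = ?R x \<alpha>"
    by (rule relation_coeff_chart_change) (use nz ab pq in auto)
  have "x (Zc j 0) ^ m = x (Zc j 0) ^ ?w * x (Zc j 0) ^ (2 * (n+1))"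
    using m by (simp add: power_add[symmetric] del: mult_Suc_right)
  then have "x (Zc j 0) ^ m * x (Ac \<gamma>) ^ 1 * x (Ac \<gamma>) * (?y (Zc i 0) ^ ?w * ?y (Ac \<beta>) ^ 2 * ?R ?y \<alpha>) =
      (x (Zc j 0) ^ ?w * ?y (Zc i 0) ^ ?w) * (x (Ac \<gamma>) ^ 2 * ?y (Ac \<beta>) ^ 2) * (x (Zc j 0) ^ (2 * (n+1)) * ?R ?y \<alpha>)"
    by (simp add: power2_eq_square)
  then show "x (Zc j 0) ^ m * x (Ac \<gamma>) ^ 1 * x (Ac \<gamma>) * (?y (Zc i 0) ^ ?w * ?y (Ac \<beta>) ^ 2 * ?R ?y \<alpha>) =
      x (Zc i 0) ^ ?w * x (Ac \<beta>) ^ 2 * ?R x \<alpha>"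
    by (simp only: yi y\<beta> R)
qed (auto intro: polynomial_functions.const)


section \<open>Generation at non-degenerate jets\<close>

interpretation coord_functions: vector_space "\<lambda>(a::complex) (v::coord \<Rightarrow> complex). \<lambda>c. a * v c"
  by unfold_locales (auto simp: fun_eq_iff algebra_simps)

lemma sum_fun_apply: "(\<Sum>i\<in>I. f i) c = (\<Sum>i\<in>I. f i c)" for f :: "'b \<Rightarrow> 'c \<Rightarrow> complex"
  by (induction I rule: infinite_finite_induct) auto

lemma subspace_tangent_space: "coord_functions.subspace (tangent_space n d i \<beta> x)"
proof (rule coord_functions.subspaceI)
  show "0 \<in> tangent_space n d i \<beta> x"
    by (simp add: tangent_space_def)
  show "v + w \<in> tangent_space n d i \<beta> x" if "v \<in> tangent_space n d i \<beta> x" "w \<in> tangent_space n d i \<beta> x" for v w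
    using that by (simp add: tangent_space_def distrib_left sum.distrib)
  show "(\<lambda>c. a * v c) \<in> tangent_space n d i \<beta> x" if "v \<in> tangent_space n d i \<beta> x" for a v
    using that by (simp add: tangent_space_def mult.left_commute[of _ a] sum_distrib_left[symmetric])
qed

lemma exists_other_index:
  assumes "\<alpha> \<in> multi_indices n d" "\<alpha> i < d"
  obtains k where "k \<le> n+1" "k \<noteq> i" "\<alpha> k > 0"
proof -
  have "\<not> (\<forall>k\<in>{..n+1}-{i}. \<alpha> k = 0)"
  proof
    assume *: "\<forall>k\<in>{..n+1}-{i}. \<alpha> k = 0"
    have "d = (\<Sum>k\<le>n+1. \<alpha> k)"
      using assms(1) by (simp add: multi_indices_def)
    also have "\<dots> \<le> \<alpha> i"
    proof (cases "i \<le> n+1")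
      case True
      then show ?thesis
        using * by (subst sum.remove[of _ i]) auto
    next
      case False
      then have "\<forall>k\<in>{..n+1}. \<alpha> k = 0" using * by auto
      then show ?thesis by simp
    qed
    finally show False using assms(2) by simp
  qed
  then show ?thesis using that by blast
qed

lemma multi_index_eq_pure:
  assumes "\<alpha> \<in> multi_indices n d" "\<alpha> i = d"
  shows "\<alpha> = (\<lambda>_. 0)(i := d)"
proof (rule ext)
  fix k
  show "\<alpha> k = ((\<lambda>_. 0)(i := d)) k"
  proof (cases "k = i \<or> \<alpha> k = 0")
    case False
    then have k: "k \<le> n+1" "k \<noteq> i" "\<alpha> k > 0"
      using assms(1) by (auto simp: multi_indices_def not_less[symmetric])
    have "\<alpha> i + \<alpha> k \<le> (\<Sum>j\<le>n+1. \<alpha> j)"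
    proof (cases "i \<le> n+1")
      case True
      have "(\<Sum>j\<in>{i,k}. \<alpha> j) \<le> (\<Sum>j\<le>n+1. \<alpha> j)"
        using True k by (intro sum_mono2) auto
      then show ?thesis using k by simp
    next
      case False
      then have "\<alpha> i = 0"
        using assms(1) by (simp add: multi_indices_def)
      then show ?thesis
        using member_le_sum[of k "{..n+1}" \<alpha>] k by simp
    qed
    then show ?thesis
      using k assms by (simp add: multi_indices_def)
  qed (use assms in auto)
qed

text \<open>
  The field \<open>\<partial> / \<partial>A\<^sub>\<mu>\<close>, projected to the chart \<open>a\<^sub>\<beta> = 1\<close>. In general it is not tangent to the jet space;
  the sections built from quadrics are tangent combinations of such fields.
\<close>

definition unit_field ::
    "nat \<Rightarrow> nat \<Rightarrow> (nat \<Rightarrow> nat) \<Rightarrow> (coord \<Rightarrow> complex) \<Rightarrow> (nat \<Rightarrow> nat) \<Rightarrow> coord \<Rightarrow> complex" where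
  "unit_field n d \<beta> x \<mu> c = (case c of Zc k l \<Rightarrow> 0
    | Ac \<alpha> \<Rightarrow> if \<alpha> \<in> multi_indices n d
        then (if \<alpha> = \<mu> then 1 else 0) - x (Ac \<alpha>) * (if \<beta> = \<mu> then 1 else 0) else 0)"

lemma relation_section_value:
  assumes x: "x \<in> affine_jets n d i \<beta>"
  shows "relation_section n d m i \<beta> p q a b \<nu> i \<beta> x =
    (\<lambda>c. jet_det n (quadric_values n p q x) * unit_field n d \<beta> x (raise_index a (raise_index b \<nu>)) c -
      (\<Sum>r\<le>n. jet_det n ((quadric_values n p q x)(r := jet_series n x a * jet_series n x b)) *
         unit_field n d \<beta> x (raise_index (p r) (raise_index (q r) \<nu>)) c))"
proof
  fix c
  let ?J = "\<lambda>r. jet_det n ((quadric_values n p q x)(r := jet_series n x a * jet_series n x b))"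
  have R: "relation_coeff n p q a b \<nu> x \<alpha> =
      jet_det n (quadric_values n p q x) * (if \<alpha> = raise_index a (raise_index b \<nu>) then 1 else 0) -
      (\<Sum>r\<le>n. ?J r * (if \<alpha> = raise_index (p r) (raise_index (q r) \<nu>) then 1 else 0))" for \<alpha>
    unfolding relation_coeff_def by (intro arg_cong2[of _ _ _ _ "(-)"] sum.cong refl) auto
  show "relation_section n d m i \<beta> p q a b \<nu> i \<beta> x c =
    jet_det n (quadric_values n p q x) * unit_field n d \<beta> x (raise_index a (raise_index b \<nu>)) c -
      (\<Sum>r\<le>n. ?J r * unit_field n d \<beta> x (raise_index (p r) (raise_index (q r) \<nu>)) c)"
  proof (cases c)
    case (Ac \<alpha>)
    have "u - (\<Sum>r\<le>n. ?J r * g r) - y * (w - (\<Sum>r\<le>n. ?J r * h r)) =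
        (u - y * w) - (\<Sum>r\<le>n. ?J r * (g r - y * h r))" for u y w g h
      by (simp only: right_diff_distrib sum_subtractf sum_distrib_left mult.left_commute[of y]) simp
    then show ?thesis
      by (simp add: Ac relation_section_def homogeneous_field_def unit_field_def R
          affine_jets_Ac[OF x] affine_jets_Zc[OF x] algebra_simps del: sum.atMost_Suc)
  qed (simp add: relation_section_def homogeneous_field_def unit_field_def)
qed

lemma gl_section_value_Zc:
  assumes x: "x \<in> affine_jets n d i \<beta>" and "a \<noteq> i" "k \<le> n+1" "l \<le> n"
  shows "gl_section n d m i \<beta> a b i \<beta> x (Zc k l) = (if k = a then fact l * fps_nth (jet_series n x b) l else 0)"
  using assms by (simp add: gl_section_def homogeneous_field_def affine_jets_Ac[OF x] affine_jets_Zc[OF x])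

text \<open>
  The fields \<open>Z\<^sub>a \<mapsto> Z\<^sub>b\<close> with \<open>a \<noteq> i\<close> move the row \<open>a\<close> of the jet in the direction of the row \<open>b\<close>. At a
  non-degenerate jet the rows span everything, so every motion of the jet is obtained.
\<close>

lemma gl_sections_move_jet:
  assumes x: "x \<in> affine_jets n d i \<beta>" and i: "i \<le> n+1" and \<beta>: "\<beta> \<in> multi_indices n d"
    and \<iota>: "\<And>r. r \<le> n \<Longrightarrow> \<iota> r \<le> n+1"
    and nz: "jet_det n (\<lambda>r. jet_series n x (\<iota> r)) \<noteq> 0"
    and v: "v \<in> tangent_space n d i \<beta> x"
  obtains w where "w \<in> coord_functions.span ((\<lambda>V. V i \<beta> x) ` twisted_sections n d m 1)"
    "\<forall>k l. w (Zc k l) = v (Zc k l)"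
proof -
  let ?S = "(\<lambda>V. V i \<beta> x) ` twisted_sections n d m 1"
  let ?f = "jet_series n x"
  let ?G = "\<lambda>a r. gl_section n d m i \<beta> a (\<iota> r) i \<beta> x"
  have "\<exists>c. eq_upto n (jet_series n v k) (\<Sum>r\<le>n. fps_const (c r) * ?f (\<iota> r))" for k
    using jet_det_span[OF nz] by metis
  then obtain c where c: "\<And>k. eq_upto n (jet_series n v k) (\<Sum>r\<le>n. fps_const (c k r) * ?f (\<iota> r))"
    by metis
  define w where "w = (\<Sum>a\<in>{..n+1}-{i}. \<Sum>r\<le>n. (\<lambda>b. c a r * ?G a r b))"
  have w: "w \<in> coord_functions.span ?S"
    unfolding w_def
    by (intro coord_functions.span_sum coord_functions.span_scale coord_functions.span_base imageI
        gl_section_in_twisted_sections) (use i \<beta> \<iota> in auto)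
  have "?S \<subseteq> tangent_space n d i \<beta> x"
    using x i \<beta> by (auto simp: twisted_sections_def)
  then have wt: "w \<in> tangent_space n d i \<beta> x"
    using w subspace_tangent_space coord_functions.span_minimal by blast
  have "w (Zc k l) = v (Zc k l)" for k l
  proof (cases "Zc k l \<in> free_coords n d i \<beta>")
    case False
    then show ?thesis using wt v by (simp add: tangent_space_def)
  next
    case True
    then have kl: "k \<le> n+1" "l \<le> n" "k \<noteq> i"
      by (auto simp: Zc_in_free_coords)
    have "w (Zc k l) = (\<Sum>a\<in>{..n+1}-{i}. \<Sum>r\<le>n. c a r * (if k = a then fact l * fps_nth (?f (\<iota> r)) l else 0))"
      unfolding w_def sum_fun_apply
      by (intro sum.cong refl) (use kl in \<open>auto simp: gl_section_value_Zc[OF x]\<close>)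
    also have "\<dots> = (\<Sum>a\<in>{..n+1}-{i}. if a = k then (\<Sum>r\<le>n. c k r * (fact l * fps_nth (?f (\<iota> r)) l)) else 0)"
      by (intro sum.cong refl) auto
    also have "\<dots> = (\<Sum>r\<le>n. c k r * (fact l * fps_nth (?f (\<iota> r)) l))"
      using kl by simp
    also have "\<dots> = fact l * fps_nth (\<Sum>r\<le>n. fps_const (c k r) * ?f (\<iota> r)) l"
      by (simp add: fps_sum_nth sum_distrib_left mult.left_commute del: sum.atMost_Suc)
    also have "\<dots> = fact l * fps_nth (jet_series n v k) l"
      using c[of k] kl by (simp add: eq_upto_def)
    also have "\<dots> = v (Zc k l)"
      using kl by (simp add: jet_series_nth)
    finally show ?thesis .
  qed
  with w that show ?thesis by blast
qed

text \<open>
  A monomial with at least two factors other than \<open>X\<^sub>i\<close> is rewritten by a quadric into monomials with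
  more factors \<open>X\<^sub>i\<close>, and in the end into the \<open>X\<^sub>i\<^bsup>d-1\<^esup> X\<^bsub>\<iota> r\<^esub>\<close>, whose values along the jet are
  linearly independent.
\<close>

lemma unit_field_reduction:
  fixes e :: nat
  defines "d \<equiv> Suc (Suc e)"
  assumes x: "x \<in> affine_jets n d i \<beta>" and i: "i \<le> n+1" and \<beta>: "\<beta> \<in> multi_indices n d"
    and \<iota>: "\<And>r. r \<le> n \<Longrightarrow> \<iota> r \<le> n+1"
    and nz: "jet_det n (\<lambda>r. jet_series n x (\<iota> r)) \<noteq> 0" and m: "2 * (n+1) \<le> m"
    and \<alpha>: "\<alpha> \<in> multi_indices n d"
  defines "S \<equiv> (\<lambda>V. V i \<beta> x) ` twisted_sections n d m 1"
  defines "\<rho> \<equiv> \<lambda>r. raise_index i (raise_index (\<iota> r) ((\<lambda>_. 0)(i := e)))"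
  shows "\<exists>b. unit_field n d \<beta> x \<alpha> - (\<Sum>r\<le>n. (\<lambda>c. b r * unit_field n d \<beta> x (\<rho> r) c)) \<in> coord_functions.span S \<and>
    eq_upto n (monomial n (jet_series n x) \<alpha>) (\<Sum>r\<le>n. fps_const (b r) * jet_series n x (\<iota> r))"
proof -
  let ?f = "jet_series n x"
  define red where "red \<alpha> \<longleftrightarrow> (\<exists>b. unit_field n d \<beta> x \<alpha> -
      (\<Sum>r\<le>n. (\<lambda>c. b r * unit_field n d \<beta> x (\<rho> r) c)) \<in> coord_functions.span S \<and>
    eq_upto n (monomial n (jet_series n x) \<alpha>) (\<Sum>r\<le>n. fps_const (b r) * jet_series n x (\<iota> r)))" for \<alpha>
  let ?u = "unit_field n d \<beta> x"
  let ?H = "quadric_values n (\<lambda>_. i) \<iota> x"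
  let ?D = "jet_det n ?H"
  have fi: "?f i = 1" by (rule affine_jets_series[OF x])
  have H: "?H = (\<lambda>r. ?f (\<iota> r))"
    by (simp add: quadric_values_def fi fun_eq_iff)
  have D: "?D \<noteq> 0" using nz by (simp add: H)
  have step: "\<exists>t. ?u (raise_index a (raise_index b \<nu>)) -
        (\<Sum>r\<le>n. (\<lambda>c. t r * ?u (raise_index i (raise_index (\<iota> r) \<nu>)) c)) \<in> coord_functions.span S \<and>
      eq_upto n (monomial n ?f (raise_index a (raise_index b \<nu>)))
        (\<Sum>r\<le>n. fps_const (t r) * monomial n ?f (raise_index i (raise_index (\<iota> r) \<nu>)))"
    if ab: "a \<le> n+1" "b \<le> n+1" and \<nu>: "\<nu> \<in> multi_indices n e" for a b \<nu>
  proof (intro exI conjI)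
    let ?t = "\<lambda>r. jet_det n (?H(r := ?f a * ?f b)) / ?D"
    let ?V = "relation_section n d m i \<beta> (\<lambda>_. i) \<iota> a b \<nu> i \<beta> x"
    have "?V \<in> S"
      unfolding S_def d_def using i \<beta> ab \<iota> \<nu> m
      by (intro imageI relation_section_in_twisted_sections) (auto simp: d_def)
    then have "(\<lambda>c. (1 / ?D) * ?V c) \<in> coord_functions.span S"
      by (intro coord_functions.span_scale coord_functions.span_base)
    also have "(\<lambda>c. (1 / ?D) * ?V c) = ?u (raise_index a (raise_index b \<nu>)) -
        (\<Sum>r\<le>n. (\<lambda>c. ?t r * ?u (raise_index i (raise_index (\<iota> r) \<nu>)) c))"
      unfolding relation_section_value[OF x]
      using D by (simp add: fun_eq_iff sum_fun_apply right_diff_distrib sum_distrib_left diff_divide_distrib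
          sum_divide_distrib del: sum.atMost_Suc)
    finally show "?u (raise_index a (raise_index b \<nu>)) -
        (\<Sum>r\<le>n. (\<lambda>c. ?t r * ?u (raise_index i (raise_index (\<iota> r) \<nu>)) c)) \<in> coord_functions.span S" .
    have "eq_upto n (fps_const (1 / ?D) * (fps_const ?D * (?f a * ?f b)) * monomial n ?f \<nu>)
       (fps_const (1 / ?D) * (\<Sum>r\<le>n. fps_const (jet_det n (?H(r := ?f a * ?f b))) * ?H r) * monomial n ?f \<nu>)"
      by (intro eq_upto_mult eq_upto_refl eq_upto_sym[OF jet_cramer])
    moreover have "fps_const (1 / ?D) * (fps_const ?D * (?f a * ?f b)) * monomial n ?f \<nu> =
       monomial n ?f (raise_index a (raise_index b \<nu>))"
      using D ab unfolding mult.assoc[symmetric] fps_const_mult by (simp add: monomial_raise ac_simps)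
    moreover have "fps_const (1 / ?D) * (\<Sum>r\<le>n. fps_const (jet_det n (?H(r := ?f a * ?f b))) * ?H r) * monomial n ?f \<nu> =
       (\<Sum>r\<le>n. fps_const (?t r) * monomial n ?f (raise_index i (raise_index (\<iota> r) \<nu>)))"
      unfolding sum_distrib_left sum_distrib_right mult.assoc[symmetric] fps_const_mult
      using \<iota> i by (intro sum.cong refl) (simp add: monomial_raise fi H ac_simps)
    ultimately show "eq_upto n (monomial n ?f (raise_index a (raise_index b \<nu>)))
        (\<Sum>r\<le>n. fps_const (?t r) * monomial n ?f (raise_index i (raise_index (\<iota> r) \<nu>)))"
      by simp
  qed
  have pure: "(\<lambda>_. 0)(i := k) \<in> multi_indices n k" for k
    using i by (simp add: multi_indices_def del: sum.atMost_Suc)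
  have combine: "red (raise_index a (raise_index b \<nu>))"
    if a: "a \<le> n+1" and b: "b \<le> n+1" and \<nu>: "\<nu> \<in> multi_indices n e"
      and IH: "\<And>r. r \<le> n \<Longrightarrow> red (raise_index i (raise_index (\<iota> r) \<nu>))" for a b \<nu>
  proof -
    obtain t where t1: "?u (raise_index a (raise_index b \<nu>)) -
        (\<Sum>r\<le>n. (\<lambda>c. t r * ?u (raise_index i (raise_index (\<iota> r) \<nu>)) c)) \<in> coord_functions.span S"
      and t2: "eq_upto n (monomial n ?f (raise_index a (raise_index b \<nu>)))
        (\<Sum>r\<le>n. fps_const (t r) * monomial n ?f (raise_index i (raise_index (\<iota> r) \<nu>)))"
      using step[OF a b \<nu>] by blast
    have "\<exists>B. \<forall>r. r \<le> n \<longrightarrow> ?u (raise_index i (raise_index (\<iota> r) \<nu>)) - (\<Sum>s\<le>n. (\<lambda>c. B r s * ?u (\<rho> s) c)) \<in> coord_functions.span S \<and>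
       eq_upto n (monomial n ?f (raise_index i (raise_index (\<iota> r) \<nu>))) (\<Sum>s\<le>n. fps_const (B r s) * ?f (\<iota> s))"
      using IH unfolding red_def by (intro choice) blast
    then obtain B where
      B1: "\<And>r. r \<le> n \<Longrightarrow> ?u (raise_index i (raise_index (\<iota> r) \<nu>)) - (\<Sum>s\<le>n. (\<lambda>c. B r s * ?u (\<rho> s) c)) \<in> coord_functions.span S" and
      B2: "\<And>r. r \<le> n \<Longrightarrow> eq_upto n (monomial n ?f (raise_index i (raise_index (\<iota> r) \<nu>))) (\<Sum>s\<le>n. fps_const (B r s) * ?f (\<iota> s))"
      by blast
    let ?b = "\<lambda>s. \<Sum>r\<le>n. t r * B r s"
    show ?thesis
      unfolding red_def
    proof (intro exI conjI)
      have "(?u (raise_index a (raise_index b \<nu>)) - (\<Sum>r\<le>n. (\<lambda>c. t r * ?u (raise_index i (raise_index (\<iota> r) \<nu>)) c))) +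
          (\<Sum>r\<le>n. (\<lambda>c. t r * (?u (raise_index i (raise_index (\<iota> r) \<nu>)) - (\<Sum>s\<le>n. (\<lambda>c. B r s * ?u (\<rho> s) c))) c))
          \<in> coord_functions.span S"
        by (intro coord_functions.span_add coord_functions.span_sum coord_functions.span_scale t1 B1) auto
      also have "(?u (raise_index a (raise_index b \<nu>)) - (\<Sum>r\<le>n. (\<lambda>c. t r * ?u (raise_index i (raise_index (\<iota> r) \<nu>)) c))) +
          (\<Sum>r\<le>n. (\<lambda>c. t r * (?u (raise_index i (raise_index (\<iota> r) \<nu>)) - (\<Sum>s\<le>n. (\<lambda>c. B r s * ?u (\<rho> s) c))) c)) =
          ?u (raise_index a (raise_index b \<nu>)) - (\<Sum>s\<le>n. (\<lambda>c. ?b s * ?u (\<rho> s) c))"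
      proof
        fix c
        have "(\<Sum>r\<le>n. \<Sum>s\<le>n. t r * (B r s * ?u (\<rho> s) c)) = (\<Sum>s\<le>n. \<Sum>r\<le>n. t r * (B r s * ?u (\<rho> s) c))"
          by (rule sum.swap)
        then show "((?u (raise_index a (raise_index b \<nu>)) - (\<Sum>r\<le>n. (\<lambda>c. t r * ?u (raise_index i (raise_index (\<iota> r) \<nu>)) c))) +
          (\<Sum>r\<le>n. (\<lambda>c. t r * (?u (raise_index i (raise_index (\<iota> r) \<nu>)) - (\<Sum>s\<le>n. (\<lambda>c. B r s * ?u (\<rho> s) c))) c))) c =
          (?u (raise_index a (raise_index b \<nu>)) - (\<Sum>s\<le>n. (\<lambda>c. ?b s * ?u (\<rho> s) c))) c"
          by (simp add: sum_fun_apply right_diff_distrib sum_subtractf sum_distrib_left sum_distrib_right mult.assoc)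
      qed
      finally show "?u (raise_index a (raise_index b \<nu>)) - (\<Sum>s\<le>n. (\<lambda>c. ?b s * ?u (\<rho> s) c)) \<in> coord_functions.span S" .
      have "eq_upto n (\<Sum>r\<le>n. fps_const (t r) * monomial n ?f (raise_index i (raise_index (\<iota> r) \<nu>)))
          (\<Sum>r\<le>n. fps_const (t r) * (\<Sum>s\<le>n. fps_const (B r s) * ?f (\<iota> s)))"
        by (intro eq_upto_sum eq_upto_mult eq_upto_refl B2) auto
      moreover have "(\<Sum>r\<le>n. fps_const (t r) * (\<Sum>s\<le>n. fps_const (B r s) * ?f (\<iota> s))) =
          (\<Sum>s\<le>n. fps_const (?b s) * ?f (\<iota> s))"
        unfolding sum_distrib_left fps_const_sum sum_distrib_right fps_const_mult[symmetric] mult.assoc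
        by (rule sum.swap)
      ultimately show "eq_upto n (monomial n ?f (raise_index a (raise_index b \<nu>))) (\<Sum>s\<le>n. fps_const (?b s) * ?f (\<iota> s))"
        using eq_upto_trans[OF t2] by simp
    qed
  qed
  have base: "red (raise_index a (raise_index i ((\<lambda>_. 0)(i := e))))" if "a \<le> n+1" for a
  proof -
    have f\<rho>: "monomial n ?f (raise_index i (raise_index (\<iota> r) ((\<lambda>_. 0)(i := e)))) = ?f (\<iota> r)" if "r \<le> n" for r
    proof -
      have "monomial n ?f ((\<lambda>_. 0)(i := e)) = 1"
        unfolding monomial_def by (intro prod.neutral) (auto simp: fi)
      then show ?thesis using i \<iota>[OF that] by (simp add: monomial_raise fi)
    qed
    have "(\<Sum>r\<le>n. fps_const (t r) * monomial n ?f (raise_index i (raise_index (\<iota> r) ((\<lambda>_. 0)(i := e))))) =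
        (\<Sum>r\<le>n. fps_const (t r) * ?f (\<iota> r))" for t
      by (intro sum.cong refl) (simp add: f\<rho>)
    then show ?thesis
      using step[OF that i pure] unfolding red_def \<rho>_def by (simp only:)
  qed
  have "red \<alpha>"
    using \<alpha>
  proof (induction "d - \<alpha> i" arbitrary: \<alpha> rule: less_induct)
    case less
    have le: "\<alpha> i \<le> d"
      using member_le_sum[of i "{..n+1}" \<alpha>] i less.prems by (simp add: multi_indices_def)
    show ?case
    proof (cases "\<alpha> i < d - 1")
      case False
      obtain a where a: "a \<le> n+1" "\<alpha> a > 0" "lower_index a \<alpha> i = Suc e"
      proof (cases "\<alpha> i = d")
        case True
        then show ?thesis using i by (intro that[of i]) (auto simp: d_def lower_index_def)
      next
        case neq: False
        with le have "\<alpha> i < d" by simp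
        then obtain a where "a \<le> n+1" "a \<noteq> i" "\<alpha> a > 0"
          using exists_other_index[OF less.prems] by blast
        then show ?thesis
          using False neq le by (intro that[of a]) (auto simp: d_def lower_index_def)
      qed
      have "lower_index a \<alpha> = (\<lambda>_. 0)(i := Suc e)"
        using lower_index_in[of \<alpha> n "Suc e" a] less.prems a by (intro multi_index_eq_pure) (auto simp: d_def)
      also have "\<dots> = raise_index i ((\<lambda>_. 0)(i := e))"
        by (auto simp: raise_index_def)
      finally have "\<alpha> = raise_index a (raise_index i ((\<lambda>_. 0)(i := e)))"
        using raise_lower_index[of \<alpha> a] a by simp
      then show ?thesis using base[OF a(1)] by simp
    next
      case True
      then have "\<alpha> i < d" by simp
      then obtain a where a: "a \<le> n+1" "a \<noteq> i" "\<alpha> a > 0"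
        using exists_other_index[OF less.prems] by blast
      let ?\<alpha>' = "lower_index a \<alpha>"
      have \<alpha>': "?\<alpha>' \<in> multi_indices n (Suc e)"
        using lower_index_in[of \<alpha> n "Suc e" a] less.prems a by (simp add: d_def)
      moreover have "?\<alpha>' i < Suc e"
        using True a by (simp add: lower_index_def d_def)
      ultimately obtain b where b: "b \<le> n+1" "b \<noteq> i" "?\<alpha>' b > 0"
        using exists_other_index by blast
      let ?\<nu> = "lower_index b ?\<alpha>'"
      have \<nu>: "?\<nu> \<in> multi_indices n e"
        using lower_index_in[OF \<alpha>'] b by simp
      have eq: "\<alpha> = raise_index a (raise_index b ?\<nu>)"
        using a b by (simp add: raise_lower_index)
      have "red (raise_index a (raise_index b ?\<nu>))"
      proof (rule combine[OF a(1) b(1) \<nu>])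
        fix r assume r: "r \<le> n"
        have "\<alpha> i < raise_index i (raise_index (\<iota> r) ?\<nu>) i"
          using a b by (auto simp: raise_index_def lower_index_def)
        then have "d - raise_index i (raise_index (\<iota> r) ?\<nu>) i < d - \<alpha> i"
          using True by linarith
        then show "red (raise_index i (raise_index (\<iota> r) ?\<nu>))"
          by (rule less.hyps) (use \<nu> i \<iota>[OF r] in \<open>simp add: d_def\<close>)
      qed
      then show ?thesis using eq by simp
    qed
  qed
  then show ?thesis by (simp only: red_def)
qed

text \<open>
  The infinitesimal generators of the linear group cancel the motion of the jet. The rest is a form \<open>\<Sum> z\<^sub>\<alpha> X\<^sup>\<alpha>\<close> vanishing
  along the jet. Reducing each monomial leaves a combination of the \<open>X\<^sub>i\<^bsup>d-1\<^esup> X\<^bsub>\<iota> r\<^esub>\<close> that still vanishes along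
  the jet, so it is zero by independence.
\<close>

lemma generated_at_nondegenerate:
  assumes x: "x \<in> affine_jets n d i \<beta>" and i: "i \<le> n+1" and \<beta>: "\<beta> \<in> multi_indices n d"
    and \<iota>: "\<And>r. r \<le> n \<Longrightarrow> \<iota> r \<le> n+1"
    and nz: "jet_det n (\<lambda>r. jet_series n x (\<iota> r)) \<noteq> 0"
    and m: "2 * (n+1) \<le> m" and d: "2 \<le> d"
  shows "coord_functions.span ((\<lambda>V. V i \<beta> x) ` twisted_sections n d m 1) = tangent_space n d i \<beta> x"
proof
  let ?S = "(\<lambda>V. V i \<beta> x) ` twisted_sections n d m 1"
  have sub: "?S \<subseteq> tangent_space n d i \<beta> x"
    using x i \<beta> by (auto simp: twisted_sections_def)
  then show span_sub: "coord_functions.span ?S \<subseteq> tangent_space n d i \<beta> x"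
    using subspace_tangent_space coord_functions.span_minimal by blast
  show "tangent_space n d i \<beta> x \<subseteq> coord_functions.span ?S"
  proof
    fix v assume v: "v \<in> tangent_space n d i \<beta> x"
    obtain e where e: "d = Suc (Suc e)"
      using d by (metis add_2_eq_Suc le_Suc_ex)
    let ?f = "jet_series n x"
    let ?M = "multi_indices n d"
    let ?u = "unit_field n d \<beta> x"
    obtain w where w: "w \<in> coord_functions.span ?S" and wv: "\<forall>k l. w (Zc k l) = v (Zc k l)"
      by (rule gl_sections_move_jet[where m = m, OF x i \<beta> \<iota> nz v])
    define z where "z = v - w"
    have z: "z \<in> tangent_space n d i \<beta> x"
      unfolding z_def
      by (rule coord_functions.subspace_diff[OF subspace_tangent_space v subsetD[OF span_sub w]])
    have zZ: "z (Zc k l) = 0" for k l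
      by (simp add: z_def wv)
    then have "jet_series n z k = 0" for k
      by (intro fps_ext) (simp add: jet_series_nth)
    then have z_form: "eq_upto n (form_series n d (\<lambda>\<alpha>. z (Ac \<alpha>)) ?f) 0"
      using z by (simp add: tangent_space_iff)
    have z_out: "z c = 0" if "c \<notin> free_coords n d i \<beta>" for c
      using z that by (simp add: tangent_space_def)
    have z_sum: "z = (\<Sum>\<alpha>\<in>?M. (\<lambda>c. z (Ac \<alpha>) * ?u \<alpha> c))"
    proof
      fix c
      show "z c = (\<Sum>\<alpha>\<in>?M. (\<lambda>c. z (Ac \<alpha>) * ?u \<alpha> c)) c"
      proof (cases c)
        case (Zc k l)
        then show ?thesis by (simp add: zZ sum_fun_apply unit_field_def)
      next
        case (Ac \<mu>)
        have "z (Ac \<beta>) = 0"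
          by (rule z_out) (simp add: Ac_in_free_coords)
        then have "(\<Sum>\<alpha>\<in>?M. z (Ac \<alpha>) * ?u \<alpha> c) = (\<Sum>\<alpha>\<in>?M. if \<alpha> = \<mu> then z (Ac \<alpha>) else 0)" if "\<mu> \<in> ?M"
          using that by (intro sum.cong refl) (auto simp: Ac unit_field_def)
        moreover have "z (Ac \<mu>) = 0" if "\<mu> \<notin> ?M"
          by (rule z_out) (simp add: Ac_in_free_coords that)
        ultimately show ?thesis
          by (cases "\<mu> \<in> ?M") (auto simp: Ac sum_fun_apply unit_field_def)
      qed
    qed
    let ?\<rho> = "\<lambda>r. raise_index i (raise_index (\<iota> r) ((\<lambda>_. 0)(i := e)))"
    have "\<forall>\<alpha>\<in>?M. \<exists>b. ?u \<alpha> - (\<Sum>r\<le>n. (\<lambda>c. b r * ?u (?\<rho> r) c)) \<in> coord_functions.span ?S \<and>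
        eq_upto n (monomial n ?f \<alpha>) (\<Sum>r\<le>n. fps_const (b r) * ?f (\<iota> r))"
      unfolding e
      by (intro ballI unit_field_reduction x[unfolded e] i \<beta>[unfolded e] \<iota> nz m)
    from bchoice[OF this] obtain B where
      B1: "\<And>\<alpha>. \<alpha> \<in> ?M \<Longrightarrow> ?u \<alpha> - (\<Sum>r\<le>n. (\<lambda>c. B \<alpha> r * ?u (?\<rho> r) c)) \<in> coord_functions.span ?S" and
      B2: "\<And>\<alpha>. \<alpha> \<in> ?M \<Longrightarrow> eq_upto n (monomial n ?f \<alpha>) (\<Sum>r\<le>n. fps_const (B \<alpha> r) * ?f (\<iota> r))"
      by blast
    let ?b = "\<lambda>r. \<Sum>\<alpha>\<in>?M. z (Ac \<alpha>) * B \<alpha> r"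
    have "eq_upto n (\<Sum>\<alpha>\<in>?M. fps_const (z (Ac \<alpha>)) * (\<Sum>r\<le>n. fps_const (B \<alpha> r) * ?f (\<iota> r)))
        (\<Sum>\<alpha>\<in>?M. fps_const (z (Ac \<alpha>)) * monomial n ?f \<alpha>)"
      by (intro eq_upto_sum eq_upto_mult eq_upto_refl) (rule eq_upto_sym[OF B2])
    moreover have "(\<Sum>\<alpha>\<in>?M. fps_const (z (Ac \<alpha>)) * (\<Sum>r\<le>n. fps_const (B \<alpha> r) * ?f (\<iota> r))) =
        (\<Sum>r\<le>n. fps_const (?b r) * ?f (\<iota> r))"
      unfolding sum_distrib_left fps_const_sum sum_distrib_right fps_const_mult[symmetric] mult.assoc
      by (rule sum.swap)
    ultimately have "eq_upto n (\<Sum>r\<le>n. fps_const (?b r) * ?f (\<iota> r)) (form_series n d (\<lambda>\<alpha>. z (Ac \<alpha>)) ?f)"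
      unfolding form_series_monomial by (simp only:)
    from eq_upto_trans[OF this z_form]
    have "eq_upto n (\<Sum>r\<le>n. fps_const (?b r) * ?f (\<iota> r)) 0" .
    then have b: "?b r = 0" if "r \<le> n" for r
      using jet_det_independent[of n "\<lambda>r. ?f (\<iota> r)" ?b r, OF nz] that by blast
    have "(\<Sum>\<alpha>\<in>?M. (\<lambda>c. z (Ac \<alpha>) * (?u \<alpha> - (\<Sum>r\<le>n. (\<lambda>c. B \<alpha> r * ?u (?\<rho> r) c))) c)) \<in> coord_functions.span ?S"
      by (intro coord_functions.span_sum coord_functions.span_scale B1)
    also have "(\<Sum>\<alpha>\<in>?M. (\<lambda>c. z (Ac \<alpha>) * (?u \<alpha> - (\<Sum>r\<le>n. (\<lambda>c. B \<alpha> r * ?u (?\<rho> r) c))) c)) = z"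
    proof
      fix c
      have "(\<Sum>\<alpha>\<in>?M. \<Sum>r\<le>n. z (Ac \<alpha>) * (B \<alpha> r * ?u (?\<rho> r) c)) = (\<Sum>r\<le>n. ?b r * ?u (?\<rho> r) c)"
        unfolding sum_distrib_right mult.assoc by (rule sum.swap)
      also have "\<dots> = 0"
        by (intro sum.neutral ballI) (simp add: b)
      finally have "(\<Sum>\<alpha>\<in>?M. \<Sum>r\<le>n. z (Ac \<alpha>) * (B \<alpha> r * ?u (?\<rho> r) c)) = 0" .
      then show "(\<Sum>\<alpha>\<in>?M. (\<lambda>c. z (Ac \<alpha>) * (?u \<alpha> - (\<Sum>r\<le>n. (\<lambda>c. B \<alpha> r * ?u (?\<rho> r) c))) c)) c = z c"
        by (subst z_sum) (simp add: sum_fun_apply right_diff_distrib sum_subtractf sum_distrib_left)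
    qed
    finally have "z \<in> coord_functions.span ?S" .
    then have "w + z \<in> coord_functions.span ?S"
      using w by (intro coord_functions.span_add)
    then show "v \<in> coord_functions.span ?S"
      by (simp add: z_def)
  qed
qed


section \<open>Coordinates of discs\<close>

lemma disc_coords_series:
  assumes g: "\<And>k. k \<le> n+1 \<Longrightarrow> Z k has_fps_expansion g k" and i: "i \<le> n+1" and Zi: "Z i 0 \<noteq> 0"
    and k: "k \<le> n+1"
  shows "l \<le> n \<Longrightarrow> disc_coords n d i \<beta> (Z, A) (Zc k l) = fact l * fps_nth (g k * inverse (g i)) l"
    and "eq_upto n (g i * jet_series n (disc_coords n d i \<beta> (Z, A)) k) (g k)"
proof -
  have nz: "fps_nth (g i) 0 \<noteq> 0"
    using fps_nth_fps_expansion[OF g[OF i], of 0] Zi by simp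
  have "(\<lambda>t. Z k t / Z i t) has_fps_expansion g k / g i"
    by (intro has_fps_expansion_divide' g i k nz)
  from deriv_has_fps_expansion[OF this]
  have *: "disc_coords n d i \<beta> (Z, A) (Zc k l) = fact l * fps_nth (g k * inverse (g i)) l" if "l \<le> n" for l
    using that k nz by (simp add: fps_divide_unit)
  then show "l \<le> n \<Longrightarrow> disc_coords n d i \<beta> (Z, A) (Zc k l) = fact l * fps_nth (g k * inverse (g i)) l" .
  have "eq_upto n (jet_series n (disc_coords n d i \<beta> (Z, A)) k) (g k * inverse (g i))"
    by (simp add: eq_upto_def jet_series_nth * del: disc_coords.simps)
  then have "eq_upto n (g i * jet_series n (disc_coords n d i \<beta> (Z, A)) k) (g i * (g k * inverse (g i)))"
    by (intro eq_upto_mult eq_upto_refl)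
  also have "g i * (g k * inverse (g i)) = g k"
    using inverse_mult_eq_1'[OF nz] by (simp add: mult.left_commute)
  finally show "eq_upto n (g i * jet_series n (disc_coords n d i \<beta> (Z, A)) k) (g k)" .
qed

lemma form_series_cong:
  "(\<And>k. k \<le> n+1 \<Longrightarrow> eq_upto m (f k) (g k)) \<Longrightarrow> eq_upto m (form_series n d A f) (form_series n d A g)"
  unfolding form_series_monomial by (intro eq_upto_sum eq_upto_mult eq_upto_refl monomial_cong)

lemma disc_coords_in_affine_jets:
  assumes u: "(Z, A) \<in> vertical_discs n d" and i: "i \<le> n+1" and \<beta>: "\<beta> \<in> multi_indices n d"
    and chart: "in_chart i \<beta> (Z, A)"
  shows "disc_coords n d i \<beta> (Z, A) \<in> affine_jets n d i \<beta>"
proof -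
  let ?x = "disc_coords n d i \<beta> (Z, A)"
  define g where "g = (\<lambda>k. fps_expansion (Z k) 0)"
  have g: "Z k has_fps_expansion g k" if "k \<le> n+1" for k
    using u that by (auto simp: vertical_discs_def g_def intro: analytic_at_imp_has_fps_expansion_0)
  have Zi: "Z i 0 \<noteq> 0" and A\<beta>: "A \<beta> \<noteq> 0"
    using chart by auto
  have nz: "fps_nth (g i) 0 \<noteq> 0"
    using fps_nth_fps_expansion[OF g[OF i], of 0] Zi by simp
  have self: "?x (Zc i l) = (if l = 0 then 1 else 0)" if "l \<le> n" for l
  proof -
    have "?x (Zc i l) = fact l * fps_nth (g i * inverse (g i)) l"
      by (rule disc_coords_series(1)[where Z = Z and g = g and i = i, OF g i Zi i that])
    then show ?thesis using inverse_mult_eq_1'[OF nz] by simp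
  qed
  have van: "eq_upto n (form_series n d A g) 0"
  proof -
    have "fps_nth (form_series n d A g) \<kappa> = (deriv ^^ \<kappa>) (\<lambda>t. hypersurface_form n d A (\<lambda>k. Z k t)) 0 / fact \<kappa>" for \<kappa>
      by (rule fps_nth_fps_expansion[OF has_fps_expansion_hypersurface_form]) (rule g)
    then show ?thesis
      using u by (simp add: eq_upto_def vertical_discs_def)
  qed
  let ?f = "jet_series n ?x" and ?F = "form_series n d (\<lambda>\<alpha>. ?x (Ac \<alpha>)) (jet_series n ?x)"
  have A: "form_series n d (\<lambda>\<alpha>. ?x (Ac \<alpha>)) h = fps_const (1 / A \<beta>) * form_series n d A h" for h
    unfolding form_series_cmult[symmetric] by (simp add: form_series_def)
  have "eq_upto n (form_series n d A (\<lambda>k. g i * ?f k)) (form_series n d A g)"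
    by (intro form_series_cong disc_coords_series(2) g i Zi)
  from eq_upto_trans[OF this van] have "eq_upto n (g i ^ d * form_series n d A ?f) (g i ^ d * 0)"
    by (simp add: form_series_scale)
  then have "eq_upto n (form_series n d A ?f) 0"
    by (rule eq_upto_cancel_left) (use nz in \<open>simp add: fps_power_zeroth\<close>)
  then have "eq_upto n ?F (fps_const (1 / A \<beta>) * 0)"
    unfolding A by (intro eq_upto_mult eq_upto_refl)
  then have "jet_equation n d \<kappa> ?x = 0" if "\<kappa> \<le> n" for \<kappa>
    using that by (simp add: jet_equation_eq eq_upto_def del: disc_coords.simps)
  moreover have "?x c = 0" if "c \<notin> jet_coords n d" for c
    using that by (cases c) auto
  moreover have "?x (Ac \<beta>) = 1"
    using A\<beta> \<beta> by simp
  ultimately show ?thesis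
    using self by (simp add: affine_jets_def del: disc_coords.simps)
qed

section \<open>Substitutions in forms\<close>

lemma monomials_independent:
  fixes K :: "nat set" and A :: "(nat \<Rightarrow> nat) \<Rightarrow> complex"
  assumes "finite K" "finite M" "\<And>\<alpha> k. \<alpha> \<in> M \<Longrightarrow> k \<notin> K \<Longrightarrow> \<alpha> k = 0"
    and "\<And>u. (\<And>k. u k \<noteq> 0) \<Longrightarrow> (\<Sum>\<alpha>\<in>M. A \<alpha> * (\<Prod>k\<in>K. u k ^ \<alpha> k)) = 0"
    and "\<alpha> \<in> M"
  shows "A \<alpha> = 0"
  using assms
proof (induction K arbitrary: M A \<alpha> rule: finite_induct)
  case empty
  have "\<beta> = (\<lambda>_. 0)" if "\<beta> \<in> M" for \<beta>
    using empty(2)[OF that] by auto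
  then have "M = {\<lambda>_. 0}"
    using empty(4) by blast
  then show ?case
    using empty(3)[of "\<lambda>_. 1"] empty(4) by auto
next
  case (insert k K)
  define j where "j = \<alpha> k"
  let ?Mj = "{\<beta> \<in> M. \<beta> k = j}"
  let ?M' = "(\<lambda>\<beta>. \<beta>(k := 0)) ` ?Mj"
  let ?A' = "\<lambda>\<beta>. A (\<beta>(k := j))"
  have inj: "inj_on (\<lambda>\<beta>. \<beta>(k := (0::nat))) ?Mj"
  proof (rule inj_onI)
    fix \<beta> \<gamma> assume "\<beta> \<in> ?Mj" "\<gamma> \<in> ?Mj" and eq: "\<beta>(k := 0) = \<gamma>(k := 0)"
    then have "\<beta> k = \<gamma> k" by simp
    then have "\<beta> = (\<beta>(k := 0))(k := \<gamma> k)" by (metis fun_upd_triv fun_upd_upd)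
    also have "\<dots> = \<gamma>" using eq by simp
    finally show "\<beta> = \<gamma>" .
  qed
  have "?A' (\<alpha>(k := 0)) = 0"
  proof (rule insert.IH[of ?M' ?A' "\<alpha>(k := 0)"])
    show "finite ?M'" using insert.prems by simp
    show "\<beta> l = 0" if "\<beta> \<in> ?M'" "l \<notin> K" for \<beta> l
      using that insert.prems(2) by (cases "l = k") auto
    show "\<alpha>(k := 0) \<in> ?M'"
      using insert.prems(4) by (auto simp: j_def)
    fix u :: "nat \<Rightarrow> complex" assume u: "\<And>k. u k \<noteq> 0"
    define D where "D = Max ((\<lambda>\<beta>. \<beta> k) ` M)"
    have D: "\<beta> k \<le> D" if "\<beta> \<in> M" for \<beta>
      using that insert.prems(1) by (auto simp: D_def)
    define c where "c i = (\<Sum>\<beta>\<in>{\<beta> \<in> M. \<beta> k = i}. A \<beta> * (\<Prod>l\<in>K. u l ^ \<beta> l))" for i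
    have "(\<Sum>i\<le>D. c i * t ^ i) = 0" if "t \<noteq> 0" for t
    proof -
      have "0 = (\<Sum>\<beta>\<in>M. A \<beta> * (\<Prod>l\<in>insert k K. (u(k := t)) l ^ \<beta> l))"
        using insert.prems(3)[of "u(k := t)"] u that by simp
      also have "\<dots> = (\<Sum>\<beta>\<in>M. A \<beta> * (\<Prod>l\<in>K. u l ^ \<beta> l) * t ^ \<beta> k)"
      proof (rule sum.cong[OF refl])
        fix \<beta>
        have "(\<Prod>l\<in>K. (u(k := t)) l ^ \<beta> l) = (\<Prod>l\<in>K. u l ^ \<beta> l)"
          using insert.hyps by (intro prod.cong) auto
        then show "A \<beta> * (\<Prod>l\<in>insert k K. (u(k := t)) l ^ \<beta> l) = A \<beta> * (\<Prod>l\<in>K. u l ^ \<beta> l) * t ^ \<beta> k"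
          using insert.hyps by simp
      qed
      also have "\<dots> = (\<Sum>i\<le>D. \<Sum>\<beta>\<in>{\<beta> \<in> M. \<beta> k = i}. A \<beta> * (\<Prod>l\<in>K. u l ^ \<beta> l) * t ^ \<beta> k)"
        using insert.prems(1) D by (intro sum.group[symmetric]) auto
      also have "\<dots> = (\<Sum>i\<le>D. c i * t ^ i)"
        unfolding c_def sum_distrib_right by (intro sum.cong refl) auto
      finally show ?thesis by simp
    qed
    then have "UNIV - {0} \<subseteq> {t. (\<Sum>i\<le>D. c i * t ^ i) = 0}"
      by auto
    moreover have "infinite (UNIV - {0::complex})"
      using infinite_UNIV_char_0 by (simp add: infinite_remove)
    ultimately have "infinite {t. (\<Sum>i\<le>D. c i * t ^ i) = 0}"
      using finite_subset by blast
    then have "c j = 0"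
      using polyfun_finite_roots[where n = D and c = c] D insert.prems(4) by (auto simp: j_def)
    moreover have "(\<Sum>\<beta>\<in>?M'. ?A' \<beta> * (\<Prod>l\<in>K. u l ^ \<beta> l)) = c j"
      unfolding c_def
    proof (subst sum.reindex[OF inj], rule sum.cong[OF refl])
      fix \<beta> assume \<beta>: "\<beta> \<in> ?Mj"
      have "(\<Prod>l\<in>K. u l ^ (\<beta>(k := 0)) l) = (\<Prod>l\<in>K. u l ^ \<beta> l)"
        using insert.hyps by (intro prod.cong) auto
      then show "((\<lambda>\<beta>. ?A' \<beta> * (\<Prod>l\<in>K. u l ^ \<beta> l)) \<circ> (\<lambda>\<beta>. \<beta>(k := 0))) \<beta> = A \<beta> * (\<Prod>l\<in>K. u l ^ \<beta> l)"
        using \<beta> by auto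
    qed
    ultimately show "(\<Sum>\<beta>\<in>?M'. ?A' \<beta> * (\<Prod>l\<in>K. u l ^ \<beta> l)) = 0" by simp
  qed
  then show ?case by (simp add: j_def)
qed

lemma hypersurface_form_nonzero:
  assumes "\<alpha> \<in> multi_indices n d" "A \<alpha> \<noteq> 0"
  obtains u where "\<And>k. u k \<noteq> 0" "hypersurface_form n d A u \<noteq> 0"
proof -
  have "\<not> (\<forall>u. (\<forall>k. u k \<noteq> 0) \<longrightarrow> hypersurface_form n d A u = 0)"
  proof
    assume "\<forall>u. (\<forall>k. u k \<noteq> 0) \<longrightarrow> hypersurface_form n d A u = 0"
    then have van: "hypersurface_form n d A u = 0" if "\<And>k. u k \<noteq> 0" for u
      using that by blast
    have "A \<alpha> = 0"
    proof (rule monomials_independent[of "{..n+1}" "multi_indices n d" A \<alpha>])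
      show "\<beta> k = 0" if "\<beta> \<in> multi_indices n d" "k \<notin> {..n+1}" for \<beta> k
        using that by (simp add: multi_indices_def)
      show "(\<Sum>\<alpha>\<in>multi_indices n d. A \<alpha> * (\<Prod>k\<le>n+1. u k ^ \<alpha> k)) = 0" if "\<And>k. u k \<noteq> 0" for u
        using van[OF that] unfolding hypersurface_form_def .
    qed (use assms in auto)
    then show False using assms by simp
  qed
  then show ?thesis using that by blast
qed

lemma hypersurface_form_inject:
  assumes "\<And>u. hypersurface_form n d A u = hypersurface_form n d B u" "\<alpha> \<in> multi_indices n d"
  shows "A \<alpha> = B \<alpha>"
proof -
  have "hypersurface_form n d (\<lambda>\<alpha>. A \<alpha> - B \<alpha>) u = 0" for u
    using assms(1)[of u] by (simp add: hypersurface_form_def left_diff_distrib sum_subtractf del: prod.atMost_Suc)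
  then show ?thesis
    using hypersurface_form_nonzero[OF assms(2), of "\<lambda>\<alpha>. A \<alpha> - B \<alpha>"] by fastforce
qed

lemma hypersurface_form_scale: "hypersurface_form n d A (\<lambda>k. c * u k) = c ^ d * hypersurface_form n d A u"
  unfolding hypersurface_form_def sum_distrib_left
proof (rule sum.cong[OF refl])
  fix \<alpha> assume "\<alpha> \<in> multi_indices n d"
  then have "(\<Prod>k\<le>n+1. c ^ \<alpha> k) = c ^ d"
    by (simp add: power_sum[symmetric] multi_indices_def del: prod.atMost_Suc sum.atMost_Suc)
  then show "A \<alpha> * (\<Prod>k\<le>n+1. (c * u k) ^ \<alpha> k) = c ^ d * (A \<alpha> * (\<Prod>k\<le>n+1. u k ^ \<alpha> k))"
    by (simp add: power_mult_distrib prod.distrib del: prod.atMost_Suc)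
qed

lemma base_index_in [simp]: "base_index d \<in> multi_indices n d"
proof -
  have "(\<Sum>k\<le>n+1. base_index d k) = (\<Sum>k\<le>n+1. if k = 1 then d else 0)"
    by (intro sum.cong) (auto simp: base_index_def)
  then show ?thesis
    by (simp add: multi_indices_def base_index_def del: sum.atMost_Suc)
qed

lemma hypersurface_form_base:
  "hypersurface_form n d A (\<lambda>k. if k = 1 then 1 else 0) = A (base_index d)"
proof -
  have "(\<Prod>k\<le>n+1. (if k = 1 then 1 else 0) ^ \<alpha> k) = (if \<alpha> = base_index d then 1 else (0::complex))"
    if \<alpha>: "\<alpha> \<in> multi_indices n d" for \<alpha>
  proof (cases "\<alpha> = base_index d")
    case True
    then show ?thesis by (auto simp: base_index_def intro!: prod.neutral)
  next
    case False
    then have "\<alpha> 1 \<noteq> d"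
      using multi_index_eq_pure[OF \<alpha>, of 1] by (auto simp: base_index_def)
    moreover have "\<alpha> 1 \<le> d"
      using member_le_sum[of 1 "{..n+1}" \<alpha>] \<alpha> by (simp add: multi_indices_def)
    ultimately obtain k where "k \<le> n+1" "k \<noteq> 1" "\<alpha> k > 0"
      using exists_other_index[OF \<alpha>, of 1] by auto
    then show ?thesis
      using False by (intro prod_zero[THEN trans]) auto
  qed
  then have "hypersurface_form n d A (\<lambda>k. if k = 1 then 1 else 0) =
      (\<Sum>\<alpha>\<in>multi_indices n d. if \<alpha> = base_index d then A \<alpha> else 0)"
    unfolding hypersurface_form_def by (intro sum.cong refl) auto
  then show ?thesis by simp
qed

lemma monomial_substitution:
  assumes L: "\<And>k l. L k l holomorphic_on UNIV" and "\<alpha> \<in> multi_indices n d"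
  shows "\<exists>B. (\<forall>\<beta>. (\<lambda>s. B s \<beta>) holomorphic_on UNIV) \<and>
    (\<forall>s u. hypersurface_form n d (B s) u = (\<Prod>k\<le>n+1. (\<Sum>l\<le>n+1. L k l s * u l) ^ \<alpha> k))"
  using assms(2)
proof (induction d arbitrary: \<alpha>)
  case 0
  have M: "multi_indices n 0 = {\<lambda>_. 0}"
  proof
    show "multi_indices n 0 \<subseteq> {\<lambda>_. 0}"
    proof
      fix \<gamma> assume \<gamma>: "\<gamma> \<in> multi_indices n 0"
      then show "\<gamma> \<in> {\<lambda>_. 0}"
        using multi_index_eq_pure[OF \<gamma>, of "n+2"] by (auto simp: multi_indices_def fun_eq_iff)
    qed
  qed (simp add: multi_indices_def)
  with 0 have "\<alpha> = (\<lambda>_. 0)" by simp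
  then show ?case
    by (intro exI[of _ "\<lambda>_ _. 1"]) (simp add: hypersurface_form_def M)
next
  case (Suc d)
  have "\<alpha> (n+2) < Suc d"
    using Suc.prems by (simp add: multi_indices_def)
  then obtain a where a': "a \<le> n+1" and a: "\<alpha> a > 0"
    using exists_other_index[OF Suc.prems] by blast
  define \<beta> where "\<beta> = lower_index a \<alpha>"
  have \<beta>: "\<beta> \<in> multi_indices n d" and \<alpha>: "\<alpha> = raise_index a \<beta>"
    using lower_index_in[OF Suc.prems a] raise_lower_index[of \<alpha> a] a by (auto simp: \<beta>_def)
  obtain B where B: "\<forall>\<beta>. (\<lambda>s. B s \<beta>) holomorphic_on UNIV"
    "\<And>s u. hypersurface_form n d (B s) u = (\<Prod>k\<le>n+1. (\<Sum>l\<le>n+1. L k l s * u l) ^ \<beta> k)"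
    using Suc.IH[OF \<beta>] by blast
  let ?M = "multi_indices n d"
  define C where "C s \<gamma> = (\<Sum>l\<le>n+1. \<Sum>\<beta>\<in>?M. (if raise_index l \<beta> = \<gamma> then 1 else 0) * (L a l s * B s \<beta>))" for s \<gamma>
  have "(\<lambda>s. C s \<gamma>) holomorphic_on UNIV" for \<gamma>
    unfolding C_def using B(1) L by (intro holomorphic_intros) auto
  moreover have "hypersurface_form n (Suc d) (C s) u = (\<Prod>k\<le>n+1. (\<Sum>l\<le>n+1. L k l s * u l) ^ \<alpha> k)" for s u
  proof -
    have mono: "(\<Prod>k\<le>n+1. v k ^ raise_index l \<gamma> k) = v l * (\<Prod>k\<le>n+1. v k ^ \<gamma> k)" if "l \<le> n+1" for v :: "nat \<Rightarrow> complex" and l \<gamma>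
      using that by (subst (1 2) prod.remove[of _ l]) (auto simp: raise_index_def ac_simps intro!: prod.cong)
    have "hypersurface_form n (Suc d) (C s) u =
        (\<Sum>\<gamma>\<in>multi_indices n (Suc d). \<Sum>l\<le>n+1. \<Sum>\<beta>\<in>?M. if raise_index l \<beta> = \<gamma> then L a l s * B s \<beta> * (\<Prod>k\<le>n+1. u k ^ \<gamma> k) else 0)"
      unfolding hypersurface_form_def C_def sum_distrib_right
      by (intro sum.cong refl) auto
    also have "\<dots> = (\<Sum>l\<le>n+1. \<Sum>\<beta>\<in>?M. \<Sum>\<gamma>\<in>multi_indices n (Suc d). if raise_index l \<beta> = \<gamma> then L a l s * B s \<beta> * (\<Prod>k\<le>n+1. u k ^ \<gamma> k) else 0)"
      by (rule trans[OF sum.swap], rule sum.cong[OF refl], rule sum.swap)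
    also have "\<dots> = (\<Sum>l\<le>n+1. \<Sum>\<beta>\<in>?M. L a l s * u l * (B s \<beta> * (\<Prod>k\<le>n+1. u k ^ \<beta> k)))"
    proof (intro sum.cong refl)
      fix l \<beta> assume "l \<in> {..n+1}" "\<beta> \<in> ?M"
      then have "raise_index l \<beta> \<in> multi_indices n (Suc d)" "l \<le> n+1" by simp_all
      then show "(\<Sum>\<gamma>\<in>multi_indices n (Suc d). if raise_index l \<beta> = \<gamma> then L a l s * B s \<beta> * (\<Prod>k\<le>n+1. u k ^ \<gamma> k) else 0) =
          L a l s * u l * (B s \<beta> * (\<Prod>k\<le>n+1. u k ^ \<beta> k))"
        using mono[of l u \<beta>] by (simp add: ac_simps del: prod.atMost_Suc raise_index_in)
    qed
    also have "\<dots> = (\<Sum>l\<le>n+1. L a l s * u l) * hypersurface_form n d (B s) u"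
      unfolding hypersurface_form_def sum_product ..
    also have "\<dots> = (\<Prod>k\<le>n+1. (\<Sum>l\<le>n+1. L k l s * u l) ^ \<alpha> k)"
      unfolding \<alpha> mono[OF a'] B(2) ..
    finally show ?thesis .
  qed
  ultimately show ?case by blast
qed

text \<open>
  Holomorphy in \<open>s\<close> serves twice: the coefficients of \<open>F \<circ> L(s)\<close> are continuous at \<open>s = 0\<close>, and one that is not
  identically zero has no zeros with \<open>s \<noteq> 0\<close> small.
\<close>

lemma form_substitution:
  assumes L: "\<And>k l. L k l holomorphic_on UNIV"
  obtains B where "\<And>\<beta>. (\<lambda>s. B s \<beta>) holomorphic_on UNIV"
    "\<And>s u. hypersurface_form n d (B s) u = hypersurface_form n d A (\<lambda>k. \<Sum>l\<le>n+1. L k l s * u l)"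
proof -
  have "\<forall>\<alpha>\<in>multi_indices n d. \<exists>B. (\<forall>\<beta>. (\<lambda>s. B s \<beta>) holomorphic_on UNIV) \<and>
    (\<forall>s u. hypersurface_form n d (B s) u = (\<Prod>k\<le>n+1. (\<Sum>l\<le>n+1. L k l s * u l) ^ \<alpha> k))"
    by (intro ballI monomial_substitution L)
  from bchoice[OF this] obtain B where
    B1: "\<And>\<alpha> \<beta>. \<alpha> \<in> multi_indices n d \<Longrightarrow> (\<lambda>s. B \<alpha> s \<beta>) holomorphic_on UNIV" and
    B2: "\<And>\<alpha> s u. \<alpha> \<in> multi_indices n d \<Longrightarrow>
      hypersurface_form n d (B \<alpha> s) u = (\<Prod>k\<le>n+1. (\<Sum>l\<le>n+1. L k l s * u l) ^ \<alpha> k)"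
    by blast
  show ?thesis
  proof (rule that[of "\<lambda>s \<beta>. \<Sum>\<alpha>\<in>multi_indices n d. A \<alpha> * B \<alpha> s \<beta>"])
    show "(\<lambda>s. \<Sum>\<alpha>\<in>multi_indices n d. A \<alpha> * B \<alpha> s \<beta>) holomorphic_on UNIV" for \<beta>
      by (intro holomorphic_intros B1)
    fix s u
    have "hypersurface_form n d (\<lambda>\<beta>. \<Sum>\<alpha>\<in>multi_indices n d. A \<alpha> * B \<alpha> s \<beta>) u =
        (\<Sum>\<alpha>\<in>multi_indices n d. A \<alpha> * hypersurface_form n d (B \<alpha> s) u)"
      unfolding hypersurface_form_def sum_distrib_right sum_distrib_left mult.assoc by (rule sum.swap)
    also have "\<dots> = hypersurface_form n d A (\<lambda>k. \<Sum>l\<le>n+1. L k l s * u l)"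
      unfolding hypersurface_form_def[of n d A] by (intro sum.cong refl) (simp only: B2)
    finally show "hypersurface_form n d (\<lambda>\<beta>. \<Sum>\<alpha>\<in>multi_indices n d. A \<alpha> * B \<alpha> s \<beta>) u =
        hypersurface_form n d A (\<lambda>k. \<Sum>l\<le>n+1. L k l s * u l)" .
  qed
qed


section \<open>Degenerate jets lie in the closure of the Wronskian locus\<close>

lemma eventually_nonzero_at_0:
  assumes "g holomorphic_on UNIV" "g z \<noteq> 0"
  shows "\<forall>\<^sub>F s in at 0. g s \<noteq> (0::complex)"
proof (cases "g 0 = 0")
  case True
  obtain r where r: "0 < r" "\<And>s. s \<in> ball 0 r - {0} \<Longrightarrow> g s \<noteq> 0"
    using isolated_zeros[OF assms(1) open_UNIV connected_UNIV _ True _ assms(2)] by auto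
  then show ?thesis
    unfolding eventually_at by (intro exI[of _ r]) (auto simp: dist_commute)
next
  case False
  have "isCont g 0"
    using holomorphic_on_imp_continuous_on[OF assms(1)] by (simp add: continuous_on_eq_continuous_at)
  then show ?thesis
    using False by (intro tendsto_imp_eventually_ne[OF isContD])
qed

lemma polynomial_functions_tendsto:
  assumes "f \<in> polynomial_functions C" "\<And>c. c \<in> C \<Longrightarrow> ((\<lambda>s. X s c) \<longlongrightarrow> x c) F"
  shows "((\<lambda>s. f (X s)) \<longlongrightarrow> f x) F"
  using assms(1) by induction (auto intro: tendsto_intros assms(2))

lemma has_coeff_deriv_tendsto:
  assumes "has_coeff_deriv G D"
  shows "((\<lambda>s. fps_nth (G s) l) \<longlongrightarrow> fps_nth (G 0) l) (at 0)"
  using assms unfolding has_coeff_deriv_def by (blast intro: isContD DERIV_isCont)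

lemma submatrix_initial_columns:
  assumes "I \<subseteq> {..<n+1}" "card I = n"
  shows "submatrix (wronskian_matrix n x) I {..<n} =
    Matrix.mat n n (\<lambda>(r, s). x (Zc (pick I r + 1) (s + 1)))"
    and "\<And>r. r < n \<Longrightarrow> pick I r < n+1"
proof -
  have I: "{i. i < n+1 \<and> i \<in> I} = I"
    using assms(1) by auto
  have J: "{j. j < n \<and> j \<in> {..<n}} = {..<n}"
    by auto
  have pick_I: "pick I r < n+1" if "r < n" for r
    using that assms(2) pick_le[of r "n+1" I] unfolding I by simp
  then show "\<And>r. r < n \<Longrightarrow> pick I r < n+1" .
  have pick_J: "pick {..<n} s = s" if "s < n" for s
    using pick_reduce_set[of s n UNIV] that by (simp add: pick_UNIV lessThan_def)
  show "submatrix (wronskian_matrix n x) I {..<n} =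
    Matrix.mat n n (\<lambda>(r, s). x (Zc (pick I r + 1) (s + 1)))"
    unfolding submatrix_def using assms(2)
    by (intro eq_matI) (auto simp: wronskian_matrix_def I[simplified] pick_I[simplified] pick_J)
qed

text \<open>
  In a chart with \<open>z\<^sub>i = 1\<close> the first row \<open>(1, 0, \<dots>, 0)\<close> of a jet determinant reduces it to a Wronskian of size \<open>n\<close>;
  comparing kernels avoids keeping track of the factorials.
\<close>

lemma wronskian_minor_vanishes:
  assumes first: "\<And>l. l \<le> n \<Longrightarrow> fps_nth (f (\<kappa> 0)) l = (if l = 0 then 1 else 0)"
    and van: "jet_det n (\<lambda>r. f (\<kappa> r)) = 0"
  shows "Determinant.det (Matrix.mat n n (\<lambda>(r, s). fact (s+1) * fps_nth (f (\<kappa> (r+1))) (s+1))) = 0"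
proof -
  let ?M = "jet_matrix n (\<lambda>r. f (\<kappa> r))"
  let ?W = "Matrix.mat n n (\<lambda>(r, s). fact (s+1) * fps_nth (f (\<kappa> (r+1))) (s+1)) :: complex mat"
  obtain v where v: "v \<in> carrier_vec (n+1)" "v \<noteq> 0\<^sub>v (n+1)" "?M *\<^sub>v v = 0\<^sub>v (n+1)"
    using van det_0_iff_vec_prod_zero[OF jet_matrix_carrier] unfolding jet_det_def by blast
  have row: "(\<Sum>s<n+1. fps_nth (f (\<kappa> r)) s * vec_index v s) = 0" if "r \<le> n" for r
  proof -
    have "vec_index (?M *\<^sub>v v) r = 0"
      using that by (simp add: v(3))
    then show ?thesis
      using that v(1) by (simp add: jet_matrix_def scalar_prod_def atLeast0LessThan carrier_vecD)
  qed
  have "(\<Sum>s<n+1. fps_nth (f (\<kappa> 0)) s * vec_index v s) = (\<Sum>s<n+1. if s = 0 then vec_index v 0 else 0)"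
    by (intro sum.cong refl) (auto simp: first)
  then have v0: "vec_index v 0 = 0"
    using row[of 0] by (simp del: sum.lessThan_Suc)
  define w where "w = Matrix.vec n (\<lambda>s. vec_index v (s+1) / fact (s+1))"
  have "?W *\<^sub>v w = 0\<^sub>v n"
  proof (rule eq_vecI)
    fix r assume "r < dim_vec (0\<^sub>v n :: complex vec)"
    then have r: "r < n" by simp
    have "vec_index (?W *\<^sub>v w) r = (\<Sum>s<n. fps_nth (f (\<kappa> (r+1))) (s+1) * vec_index v (s+1))"
      using r by (simp add: w_def scalar_prod_def atLeast0LessThan del: fact_Suc)
    also have "\<dots> = (\<Sum>s<n+1. fps_nth (f (\<kappa> (r+1))) s * vec_index v s)"
      using v0 by (simp add: sum.lessThan_Suc_shift del: sum.lessThan_Suc)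
    also have "\<dots> = 0"
      using r by (intro row) simp
    finally show "vec_index (?W *\<^sub>v w) r = vec_index (0\<^sub>v n) r"
      using r by simp
  qed simp
  moreover have "w \<noteq> 0\<^sub>v n"
  proof
    assume w0: "w = 0\<^sub>v n"
    have "v = 0\<^sub>v (n+1)"
    proof (rule eq_vecI)
      fix s assume "s < dim_vec (0\<^sub>v (n+1) :: complex vec)"
      then have s: "s < n+1" by simp
      show "vec_index v s = vec_index (0\<^sub>v (n+1)) s"
      proof (cases s)
        case 0
        then show ?thesis using v0 by simp
      next
        case (Suc t)
        then have "vec_index w t = 0" using w0 s by simp
        then show ?thesis using Suc s by (simp add: w_def del: fact_Suc)
      qed
    qed (use v(1) in auto)
    then show False using v(2) by simp
  qed
  moreover have "w \<in> carrier_vec n"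
    by (simp add: w_def)
  ultimately show ?thesis
    using det_0_iff_vec_prod_zero[of ?W n] by auto
qed

lemma degenerate_in_affine_Sigma:
  assumes u: "(Z, A) \<in> vertical_discs n d" and chart: "in_chart 0 (base_index d) (Z, A)"
    and g: "\<And>k. k \<le> n+1 \<Longrightarrow> Z k has_fps_expansion g k"
    and van: "\<And>\<iota>. (\<And>r. \<iota> r \<le> n+1) \<Longrightarrow> jet_det n (\<lambda>r. g (\<iota> r)) = 0"
  shows "disc_coords n d 0 (base_index d) (Z, A) \<in> affine_Sigma n d"
proof -
  let ?x = "disc_coords n d 0 (base_index d) (Z, A)"
  have Z0: "Z 0 0 \<noteq> 0" using chart by simp
  have x: "?x \<in> affine_jets n d 0 (base_index d)"
    by (rule disc_coords_in_affine_jets[OF u _ base_index_in chart]) simp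
  have nz: "fps_nth (g 0) 0 \<noteq> 0"
    using fps_nth_fps_expansion[OF g[of 0], of 0] Z0 by simp
  show ?thesis
    unfolding affine_Sigma_def
  proof (intro CollectI conjI x allI impI)
    fix I assume I: "I \<subseteq> {..<n+1}" "card I = n"
    \<comment> \<open>Row \<open>0\<close> is the constant series \<open>z\<^sub>0 = 1\<close>; the default \<open>0\<close> for \<open>r > n\<close> keeps \<open>\<kappa> r \<le> n+1\<close>.\<close>
    define \<kappa> where "\<kappa> r = (if r = 0 \<or> r > n then 0 else pick I (r - 1) + 1)" for r
    have \<kappa>: "\<kappa> r \<le> n+1" for r
      using submatrix_initial_columns(2)[OF I, of "r-1"] by (auto simp: \<kappa>_def less_Suc_eq_le)
    have "0 = jet_det n (\<lambda>r. g (\<kappa> r))"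
      using van[OF \<kappa>] by simp
    also have "\<dots> = jet_det n (\<lambda>r. g 0 * jet_series n ?x (\<kappa> r))"
      by (intro jet_det_cong eq_upto_sym[OF disc_coords_series(2)] g Z0 \<kappa>) auto
    also have "\<dots> = fps_nth (g 0) 0 ^ (n+1) * jet_det n (\<lambda>r. jet_series n ?x (\<kappa> r))"
      by (rule jet_det_mult)
    finally have "jet_det n (\<lambda>r. jet_series n ?x (\<kappa> r)) = 0"
      using nz by simp
    then have "Determinant.det (Matrix.mat n n (\<lambda>(r, s).
        fact (s+1) * fps_nth (jet_series n ?x (\<kappa> (r+1))) (s+1))) = 0"
      by (intro wronskian_minor_vanishes) (simp_all add: \<kappa>_def affine_jets_series[OF x] del: disc_coords.simps)
    also have "Matrix.mat n n (\<lambda>(r, s). fact (s+1) * fps_nth (jet_series n ?x (\<kappa> (r+1))) (s+1)) =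
        submatrix (wronskian_matrix n ?x) I {..<n}"
      unfolding submatrix_initial_columns(1)[OF I]
      by (intro cong_mat) (auto simp: jet_series_nth \<kappa>_def simp del: disc_coords.simps fact_Suc)
    finally show "Determinant.det (submatrix (wronskian_matrix n ?x) I {..<n}) = 0" .
  qed
qed

lemma hypersurface_form_cong:
  "(\<And>k. k \<le> n+1 \<Longrightarrow> u k = v k) \<Longrightarrow> hypersurface_form n d A u = hypersurface_form n d A v"
  unfolding hypersurface_form_def by (intro sum.cong refl arg_cong2[of _ _ _ _ "(*)"] prod.cong) auto

lemma linear_form_nonzero_at:
  fixes n i :: nat
  assumes "i \<le> n+1" "z i \<noteq> (0::complex)"
  obtains c where "(\<Sum>k\<le>n+1. c k * z k) \<noteq> 0" "c 1 = 1"
proof (cases "z 1 = 0")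
  case True
  then have "i \<noteq> 1" using assms by auto
  have "(\<Sum>k\<le>n+1. (if k = 1 \<or> k = i then 1 else 0) * z k) = (\<Sum>k\<le>n+1. if k = i then z k else 0)"
    using True by (intro sum.cong refl) auto
  also have "\<dots> = z i"
    using assms(1) by (simp del: sum.atMost_Suc)
  finally show ?thesis
    using assms(2) by (intro that[of "\<lambda>k. if k = 1 \<or> k = i then 1 else 0"]) simp_all
next
  case False
  have "(\<Sum>k\<le>n+1. (if k = 1 then 1 else 0) * z k) = (\<Sum>k\<le>n+1. if k = 1 then z k else 0)"
    by (intro sum.cong refl) auto
  also have "\<dots> = z 1"
    by (simp del: sum.atMost_Suc)
  finally show ?thesis
    using False by (intro that[of "\<lambda>k. if k = 1 then 1 else 0"]) simp_all
qed

text \<open>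
  A degenerate jet is a limit of degenerate jets in the chart \<open>Z\<^sub>0 \<noteq> 0\<close>, \<open>A\<^bsub>0d0\<dots>0\<^esub> \<noteq> 0\<close>: it is moved by
  the linear maps \<open>h\<^sub>s = 1 + s \<phi>(\<cdot>) w\<close>, which act on forms by \<open>F \<mapsto> F \<circ> h\<^sub>s\<close> and on discs, up to the scalar
  \<open>1 + s \<phi>(w)\<close>, by the inverse of \<open>h\<^sub>s\<close>. A generic choice of \<open>\<phi>\<close> and \<open>w\<close> brings the jet into that chart for small \<open>s \<noteq> 0\<close>.
\<close>

lemma degenerate_in_Sigma_locus:
  assumes disc: "(Z, A) \<in> vertical_discs n d" and i: "i \<le> n+1" and \<beta>: "\<beta> \<in> multi_indices n d"
    and chart: "in_chart i \<beta> (Z, A)"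
    and van: "\<And>\<iota>. (\<And>r. \<iota> r \<le> n+1) \<Longrightarrow> jet_det n (\<lambda>r. jet_series n (disc_coords n d i \<beta> (Z, A)) (\<iota> r)) = 0"
  shows "same_jet n d `` {(Z, A)} \<in> Sigma_locus n d"
proof -
  define g where "g = (\<lambda>k. fps_expansion (Z k) 0)"
  have g: "Z k has_fps_expansion g k" if "k \<le> n+1" for k
    using disc that by (auto simp: vertical_discs_def g_def intro: analytic_at_imp_has_fps_expansion_0)
  have Zi: "Z i 0 \<noteq> 0" and A\<beta>: "A \<beta> \<noteq> 0"
    using chart by auto
  have g_van: "jet_det n (\<lambda>r. g (\<iota> r)) = 0" if "\<And>r. \<iota> r \<le> n+1" for \<iota>
  proof -
    have "jet_det n (\<lambda>r. g (\<iota> r)) = jet_det n (\<lambda>r. g i * jet_series n (disc_coords n d i \<beta> (Z, A)) (\<iota> r))"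
      by (intro jet_det_cong eq_upto_sym[OF disc_coords_series(2)] g Zi i that)
    then show ?thesis using van[OF that] by (simp only: jet_det_mult mult_zero_right)
  qed
  obtain c where c: "(\<Sum>k\<le>n+1. c k * Z k 0) \<noteq> 0" "c 1 = 1"
    using linear_form_nonzero_at[of i n "\<lambda>k. Z k 0", OF i Zi] by blast
  \<comment> \<open>The condition \<open>w\<^sub>0 = u\<^sub>0 \<noteq> 0\<close> makes \<open>Z\<^sub>0\<close> nonzero for small \<open>s \<noteq> 0\<close>; and \<open>F(h\<^sub>s e\<^sub>1)\<close>, the new coefficient of
    \<open>X\<^sub>1\<^sup>d\<close>, equals \<open>F(u) \<noteq> 0\<close> at \<open>s = 1\<close>, so it is not identically zero in \<open>s\<close>.\<close>
  obtain u where u: "\<And>k. u k \<noteq> 0" "hypersurface_form n d A u \<noteq> 0"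
    using hypersurface_form_nonzero[of \<beta> n d A, OF \<beta> A\<beta>] by blast
  define w where "w k = u k - (if k = 1 then 1 else 0)" for k
  define \<phi> where "\<phi> = (\<Sum>k\<le>n+1. c k * w k)"
  define L where "L k l s = (if k = l then 1 else 0) + s * w k * c l" for k l and s :: complex
  have L_sum: "(\<Sum>l\<le>n+1. L k l s * y l) = y k + s * w k * (\<Sum>l\<le>n+1. c l * y l)" if "k \<le> n+1" for k s y
  proof -
    have "(\<Sum>l\<le>n+1. L k l s * y l) = (\<Sum>l\<le>n+1. (if l = k then y l else 0) + s * w k * (c l * y l))"
      by (intro sum.cong refl) (auto simp: L_def algebra_simps)
    also have "\<dots> = y k + s * w k * (\<Sum>l\<le>n+1. c l * y l)"
      using that by (simp add: sum.distrib sum_distrib_left del: sum.atMost_Suc)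
    finally show ?thesis .
  qed
  have "L k l holomorphic_on UNIV" for k l
    unfolding L_def by (intro holomorphic_intros)
  then obtain B where B: "\<And>\<alpha>. (\<lambda>s. B s \<alpha>) holomorphic_on UNIV"
    "\<And>s y. hypersurface_form n d (B s) y = hypersurface_form n d A (\<lambda>k. \<Sum>l\<le>n+1. L k l s * y l)"
    using form_substitution[of L n d A] by blast
  have B': "hypersurface_form n d (B s) y = hypersurface_form n d A (\<lambda>k. y k + s * w k * (\<Sum>l\<le>n+1. c l * y l))" for s y
    unfolding B(2) by (rule hypersurface_form_cong) (rule L_sum)
  have B0: "B 0 \<alpha> = A \<alpha>" if "\<alpha> \<in> multi_indices n d" for \<alpha>
    by (rule hypersurface_form_inject[OF _ that]) (simp add: B')
  define Zs where "Zs s k t = (1 + s * \<phi>) * Z k t - s * w k * (\<Sum>l\<le>n+1. c l * Z l t)" for s k t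
  define G where "G k s = g k + fps_const s * (fps_const \<phi> * g k - fps_const (w k) * (\<Sum>l\<le>n+1. fps_const (c l) * g l))" for k s
  have G: "Zs s k has_fps_expansion G k s" if "k \<le> n+1" for s k
  proof -
    have "(\<lambda>t. (1 + s * \<phi>) * Z k t - s * w k * (\<Sum>l\<le>n+1. c l * Z l t)) has_fps_expansion
        fps_const (1 + s * \<phi>) * g k - fps_const (s * w k) * (\<Sum>l\<le>n+1. fps_const (c l) * g l)"
      by (intro fps_expansion_intros g) (use that in auto)
    moreover have "fps_const (1 + s * \<phi>) * g k - fps_const (s * w k) * (\<Sum>l\<le>n+1. fps_const (c l) * g l) = G k s"
      unfolding G_def fps_const_add[symmetric] fps_const_mult[symmetric] fps_const_1_eq_1 by (simp only: algebra_simps) simp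
    ultimately show ?thesis by (simp add: Zs_def[abs_def])
  qed
  have G0: "G k 0 = g k" for k
    by (simp add: G_def)
  have G_deriv: "has_coeff_deriv (G k) (fps_const \<phi> * g k - fps_const (w k) * (\<Sum>l\<le>n+1. fps_const (c l) * g l))" for k
    unfolding G_def[abs_def] by (rule has_coeff_deriv_affine)
  have form_Zs: "hypersurface_form n d (B s) (\<lambda>k. Zs s k t) = (1 + s * \<phi>) ^ d * hypersurface_form n d A (\<lambda>k. Z k t)" for s t
  proof -
    have "(\<Sum>l\<le>n+1. c l * Zs s l t) = (\<Sum>l\<le>n+1. c l * Z l t)"
    proof -
      have "(\<Sum>l\<le>n+1. c l * Zs s l t) = (1 + s * \<phi>) * (\<Sum>l\<le>n+1. c l * Z l t) - s * \<phi> * (\<Sum>l\<le>n+1. c l * Z l t)"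
        unfolding Zs_def \<phi>_def right_diff_distrib sum_subtractf sum_distrib_left[of "1 + _"]
        by (simp only: sum_distrib_left sum_distrib_right mult_ac)
      then show ?thesis by (simp add: algebra_simps)
    qed
    then have "hypersurface_form n d (B s) (\<lambda>k. Zs s k t) = hypersurface_form n d A (\<lambda>k. (1 + s * \<phi>) * Z k t)"
      unfolding B' by (simp add: Zs_def)
    then show ?thesis by (simp add: hypersurface_form_scale)
  qed
  have ev: "\<forall>\<^sub>F s in at 0. Zs s 0 0 \<noteq> 0 \<and> B s (base_index d) \<noteq> 0 \<and> Zs s i 0 \<noteq> 0 \<and> B s \<beta> \<noteq> 0"
  proof (intro eventually_conj)
    have Zs_hol: "(\<lambda>s. Zs s k 0) holomorphic_on UNIV" for k
      unfolding Zs_def by (intro holomorphic_intros)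
    have "Zs (if Z 0 0 = 0 then 1 else 0) 0 0 \<noteq> 0"
      using c(1) u(1)[of 0] by (simp add: Zs_def w_def del: sum.atMost_Suc)
    with Zs_hol show "\<forall>\<^sub>F s in at 0. Zs s 0 0 \<noteq> 0"
      by (rule eventually_nonzero_at_0)
    have "Zs 0 i 0 \<noteq> 0"
      using Zi by (simp add: Zs_def)
    with Zs_hol show "\<forall>\<^sub>F s in at 0. Zs s i 0 \<noteq> 0"
      by (rule eventually_nonzero_at_0)
    have "B 0 \<beta> \<noteq> 0"
      using A\<beta> B0[OF \<beta>] by simp
    with B(1) show "\<forall>\<^sub>F s in at 0. B s \<beta> \<noteq> 0"
      by (rule eventually_nonzero_at_0)
    have "(\<Sum>l\<le>n+1. c l * (if l = 1 then 1 else 0)) = (\<Sum>l\<le>n+1. if l = 1 then 1 else 0)"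
      using c(2) by (intro sum.cong refl) auto
    then have "B 1 (base_index d) = hypersurface_form n d A u"
      unfolding hypersurface_form_base[of n d "B 1", symmetric] B'
      by (intro hypersurface_form_cong) (simp add: w_def del: sum.atMost_Suc)
    with u(2) have "B 1 (base_index d) \<noteq> 0" by simp
    with B(1) show "\<forall>\<^sub>F s in at 0. B s (base_index d) \<noteq> 0"
      by (rule eventually_nonzero_at_0)
  qed
  have disc_s: "(Zs s, B s) \<in> vertical_discs n d" if s: "Zs s 0 0 \<noteq> 0" "B s (base_index d) \<noteq> 0" for s
  proof -
    have "(deriv ^^ \<kappa>) (\<lambda>t. hypersurface_form n d (B s) (\<lambda>k. Zs s k t)) 0 = 0" if "\<kappa> \<le> n" for \<kappa>
    proof -
      have F: "(\<lambda>t. hypersurface_form n d A (\<lambda>k. Z k t)) has_fps_expansion form_series n d A g"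
        by (rule has_fps_expansion_hypersurface_form) (rule g)
      then have "(\<lambda>t. (1 + s * \<phi>) ^ d * hypersurface_form n d A (\<lambda>k. Z k t)) has_fps_expansion
          fps_const ((1 + s * \<phi>) ^ d) * form_series n d A g"
        by (rule has_fps_expansion_cmult_left)
      then have "(deriv ^^ \<kappa>) (\<lambda>t. (1 + s * \<phi>) ^ d * hypersurface_form n d A (\<lambda>k. Z k t)) 0 =
          (1 + s * \<phi>) ^ d * (deriv ^^ \<kappa>) (\<lambda>t. hypersurface_form n d A (\<lambda>k. Z k t)) 0"
        by (simp add: deriv_has_fps_expansion[OF F] deriv_has_fps_expansion)
      then show ?thesis
        using disc that by (simp add: form_Zs vertical_discs_def)
    qed
    moreover have "Zs s k analytic_on {0}" if "k \<le> n+1" for k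
      using G[OF that] by (rule has_fps_expansion_imp_analytic_0)
    moreover have "\<exists>k\<le>n+1. Zs s k 0 \<noteq> 0"
      using s by (intro exI[of _ 0]) simp
    ultimately show ?thesis
      using s(2) base_index_in[of d n] unfolding vertical_discs_def by blast
  qed
  have Sigma_s: "same_jet n d `` {(Zs s, B s)} \<in> {p \<in> vertical_jets n d. jet_in_chart 0 (base_index d) p \<and>
        chart_coords n d 0 (base_index d) p \<in> affine_Sigma n d}"
    if s: "Zs s 0 0 \<noteq> 0" "B s (base_index d) \<noteq> 0" for s
  proof -
    have chart_s: "in_chart 0 (base_index d) (Zs s, B s)" using s by simp
    have G_van: "jet_det n (\<lambda>r. G (\<iota> r) s) = 0" if \<iota>: "\<And>r. \<iota> r \<le> n+1" for \<iota>
    proof -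
      have "G k s = (\<Sum>l\<in>{..n+1}. fps_const ((if l = k then 1 + s * \<phi> else 0) - s * w k * c l) * g l)" if "k \<le> n+1" for k
      proof -
        have "(\<Sum>l\<in>{..n+1}. fps_const ((if l = k then 1 + s * \<phi> else 0) - s * w k * c l) * g l) =
            (\<Sum>l\<in>{..n+1}. (if l = k then fps_const (1 + s * \<phi>) * g l else 0) - fps_const s * fps_const (w k) * (fps_const (c l) * g l))"
          by (intro sum.cong refl) (simp add: fps_const_sub[symmetric] fps_const_mult[symmetric] algebra_simps del: fps_const_sub fps_const_mult)
        also have "\<dots> = fps_const (1 + s * \<phi>) * g k - fps_const s * fps_const (w k) * (\<Sum>l\<le>n+1. fps_const (c l) * g l)"
          using that by (simp add: sum_subtractf sum_distrib_left del: sum.atMost_Suc)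
        also have "\<dots> = G k s"
          unfolding G_def fps_const_add[symmetric] fps_const_mult[symmetric] fps_const_1_eq_1 by (simp only: algebra_simps) simp
        finally show ?thesis by simp
      qed
      then have "jet_det n (\<lambda>r. G (\<iota> r) s) =
          jet_det n (\<lambda>r. \<Sum>l\<in>{..n+1}. fps_const ((if l = \<iota> r then 1 + s * \<phi> else 0) - s * w (\<iota> r) * c l) * g l)"
        using \<iota> by simp
      also have "\<dots> = 0"
        by (rule jet_det_combinations_vanish[where ?k0.0 = 0]) (use g_van in auto)
      finally show ?thesis .
    qed
    have "disc_coords n d 0 (base_index d) (Zs s, B s) \<in> affine_Sigma n d"
    proof (rule degenerate_in_affine_Sigma[OF disc_s[OF s] chart_s, of "\<lambda>k. G k s"])
      show "jet_det n (\<lambda>r. G (\<iota> r) s) = 0" if "\<And>r. \<iota> r \<le> n+1" for \<iota>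
        using that by (rule G_van)
    qed (rule G)
    then show ?thesis
      using disc_s[OF s] chart_s jet_in_chart_class[OF disc_s[OF s] _ base_index_in, of 0]
        chart_coords_class[OF disc_s[OF s] _ base_index_in chart_s]
      by (auto simp: vertical_jets_def intro: quotientI)
  qed
  have coords_tendsto: "((\<lambda>s. disc_coords n d i \<beta> (Zs s, B s) c) \<longlongrightarrow> disc_coords n d i \<beta> (Z, A) c) (at 0)"
    if c: "c \<in> jet_coords n d" for c
  proof (cases c)
    case (Zc k l)
    with c have k: "k \<le> n+1" and l: "l \<le> n" by auto
    have nz: "fps_nth (G i 0) 0 \<noteq> 0"
      using fps_nth_fps_expansion[OF g[OF i], of 0] Zi by (simp add: G0)
    have "((\<lambda>s. fact l * fps_nth (G k s * inverse (G i s)) l) \<longlongrightarrow> fact l * fps_nth (G k 0 * inverse (G i 0)) l) (at 0)"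
      by (intro tendsto_mult_left has_coeff_deriv_tendsto[OF has_coeff_deriv_mult[OF G_deriv has_coeff_deriv_inverse[OF G_deriv nz]]])
    moreover have "fact l * fps_nth (G k 0 * inverse (G i 0)) l = disc_coords n d i \<beta> (Z, A) c"
      unfolding Zc G0
      by (rule disc_coords_series(1)[where Z = Z and g = g and i = i, OF g i Zi k l, symmetric])
    moreover have "\<forall>\<^sub>F s in at 0. fact l * fps_nth (G k s * inverse (G i s)) l = disc_coords n d i \<beta> (Zs s, B s) c"
      using ev
    proof eventually_elim
      case (elim s)
      then show ?case
        unfolding Zc
        by (intro disc_coords_series(1)[where Z = "Zs s" and g = "\<lambda>k. G k s" and i = i, symmetric] G i k l) auto
    qed
    ultimately show ?thesis
      using Lim_transform_eventually by force
  next
    case (Ac \<alpha>)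
    with c have \<alpha>: "\<alpha> \<in> multi_indices n d" by simp
    have "isCont (\<lambda>s. B s \<gamma>) 0" for \<gamma>
      using holomorphic_on_imp_continuous_on[OF B(1)[of \<gamma>]] by (simp add: continuous_on_eq_continuous_at)
    then have B_tendsto: "((\<lambda>s. B s \<gamma>) \<longlongrightarrow> B 0 \<gamma>) (at 0)" for \<gamma>
      by (rule isContD)
    have "((\<lambda>s. B s \<alpha> / B s \<beta>) \<longlongrightarrow> B 0 \<alpha> / B 0 \<beta>) (at 0)"
      by (rule tendsto_divide[OF B_tendsto B_tendsto]) (use A\<beta> B0[OF \<beta>] in simp)
    then show ?thesis
      using \<alpha> by (simp add: Ac B0 \<beta>)
  qed
  have "same_jet n d `` {(Z, A)} \<in> S"
    if S: "zariski_closed n d S" and sub: "{p \<in> vertical_jets n d. jet_in_chart 0 (base_index d) p \<and>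
        chart_coords n d 0 (base_index d) p \<in> affine_Sigma n d} \<subseteq> S" for S
  proof -
    obtain P where P: "P \<subseteq> polynomial_functions (jet_coords n d)"
      "\<And>p. p \<in> vertical_jets n d \<Longrightarrow> jet_in_chart i \<beta> p \<Longrightarrow> p \<in> S \<longleftrightarrow> (\<forall>f\<in>P. f (chart_coords n d i \<beta> p) = 0)"
      using S i \<beta> unfolding zariski_closed_def by metis
    have P_disc: "same_jet n d `` {v} \<in> S \<longleftrightarrow> (\<forall>f\<in>P. f (disc_coords n d i \<beta> v) = 0)"
      if v: "v \<in> vertical_discs n d" "in_chart i \<beta> v" for v
    proof -
      have "same_jet n d `` {v} \<in> vertical_jets n d"
        using v by (auto simp: vertical_jets_def intro: quotientI)
      then show ?thesis
        using P(2) jet_in_chart_class[OF v(1) i \<beta>] chart_coords_class[OF v(1) i \<beta> v(2)] v(2) by metis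
    qed
    have "f (disc_coords n d i \<beta> (Z, A)) = 0" if f: "f \<in> P" for f
    proof -
      have "((\<lambda>s. f (disc_coords n d i \<beta> (Zs s, B s))) \<longlongrightarrow> f (disc_coords n d i \<beta> (Z, A))) (at 0)"
        by (rule polynomial_functions_tendsto[OF subsetD[OF P(1) f] coords_tendsto])
      moreover have "\<forall>\<^sub>F s in at 0. f (disc_coords n d i \<beta> (Zs s, B s)) = 0"
        using ev
      proof eventually_elim
        case (elim s)
        then have "same_jet n d `` {(Zs s, B s)} \<in> S"
          using Sigma_s sub by blast
        then show ?case
          using P_disc[OF disc_s[of s]] elim f by simp
      qed
      ultimately have "((\<lambda>s::complex. 0) \<longlongrightarrow> f (disc_coords n d i \<beta> (Z, A))) (at 0)"
        by (rule Lim_transform_eventually)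
      then show ?thesis
        by (simp add: tendsto_const_iff)
    qed
    then show ?thesis
      using P_disc[OF disc chart] by blast
  qed
  then show ?thesis
    unfolding Sigma_locus_def hull_def by blast
qed

theorem mainTheorem2:
  fixes n d :: nat
  assumes "2 \<le> n" and "n < d"
  shows "\<forall>p \<in> vertical_jets n d - Sigma_locus n d.
           generated_by_sections_at n d ((n^2 + 5*n) div 2) 1 p"
proof
  fix p assume p: "p \<in> vertical_jets n d - Sigma_locus n d"
  then obtain v where v: "v \<in> vertical_discs n d" and p_eq: "p = same_jet n d `` {v}"
    unfolding vertical_jets_def by (blast elim: quotientE)
  obtain Z A where ZA: "v = (Z, A)" by (cases v)
  have m: "2 * (n+1) \<le> (n^2 + 5*n) div 2"
  proof -
    have "2 * n \<le> n^2"
      using assms(1) by (simp add: power2_eq_square)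
    moreover have "2 * (n+1) * 2 = 4 * n + 4"
      by simp
    ultimately have "2 * (n+1) * 2 \<le> n^2 + 5*n"
      using assms(1) by linarith
    then show ?thesis by (simp only: less_eq_div_iff_mult_less_eq)
  qed
  show "generated_by_sections_at n d ((n^2 + 5*n) div 2) 1 p"
    unfolding generated_by_sections_at_def
  proof (intro allI ballI impI)
    fix i \<beta> assume i: "i \<le> n+1" and \<beta>: "\<beta> \<in> multi_indices n d" and "jet_in_chart i \<beta> p"
    then have chart: "in_chart i \<beta> v"
      using jet_in_chart_class[OF v i \<beta>] by (simp add: p_eq)
    have coords: "chart_coords n d i \<beta> p = disc_coords n d i \<beta> v"
      unfolding p_eq by (rule chart_coords_class[OF v i \<beta> chart])
    have x: "disc_coords n d i \<beta> v \<in> affine_jets n d i \<beta>"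
      using disc_coords_in_affine_jets[of Z A] v i \<beta> chart unfolding ZA by blast
    obtain \<iota> where \<iota>: "\<And>r. \<iota> r \<le> n+1"
      and nz: "jet_det n (\<lambda>r. jet_series n (disc_coords n d i \<beta> v) (\<iota> r)) \<noteq> 0"
      using degenerate_in_Sigma_locus[of Z A n d i \<beta>] v i \<beta> chart p unfolding ZA p_eq by blast
    show "module.span (\<lambda>(a::complex) (v::coord \<Rightarrow> complex). \<lambda>c. a * v c)
        ((\<lambda>V. V i \<beta> (chart_coords n d i \<beta> p)) ` twisted_sections n d ((n^2 + 5*n) div 2) 1)
      = tangent_space n d i \<beta> (chart_coords n d i \<beta> p)"
      unfolding coords
      by (rule generated_at_nondegenerate[OF x i \<beta> \<iota> nz m]) (use assms in simp)
  qed
qed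

end
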